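(* Let $(A,R)$ be a cotriangular Hopf algebra with dual triangular Hopf algebra $(U,\mathscr R)$, where $U$ separates the elements of $A$. Let $\pi:A\to H$ be a surjective Hopf algebra map such that $B=A^{coH}\subseteq A$, with coaction $\delta=(\mathrm{id}\otimes\pi)\circ\Delta$, is a Hopf--Galois extension (a quantum principal bundle over the quantum homogeneous space $B$). Assume $(H,R_H)$ is cotriangular with $R=R_H\circ(\pi\otimes\pi)$. Then the braided gauge transformations $\mathrm{aut}^{\mathsf R}_B(A)$, where $\mathsf R=\mathscr R^{-1}$ is the universal $R$-matrix of $K=U^{op}$, are the vertical braided vector fields in $B\otimes\mathrm{Der}^{\mathfrak R}(A)_{\mathrm{inv}}$ (that is, the elements of $B\otimes \mathrm{Der}^{\mathfrak R}(A)_{\mathrm{inv}}$ which, as linear maps $A\to A$, vanish on $B$), where $\mathrm{Der}^{\mathfrak R}(A)_{\mathrm{inv}}$ are the right-invariant vector fields defining the bicovariant differential calculus on $(A,R)$. This linear space isomorphism is an isomorphism of $U_H^{op}$-braided Lie algebras, where $U_H\subset U$ is the triangular Hopf algebra dual to $H$.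
   Context: $\Bbbk$ is a field, or the ring of formal power series in a variable over a field; $\otimes$ over $\Bbbk$; sums understood. A triangular Hopf algebra $(K,\mathsf R)$: $\mathsf R=\mathsf R^\alpha\otimes\mathsf R_\alpha\in K\otimes K$ (in a topological completion if $K$ is not finite dimensional) is invertible with $\Delta^{cop}(k)=\mathsf R\Delta(k)\mathsf R^{-1}$, $(\Delta\otimes\mathrm{id})\mathsf R=\mathsf R_{13}\mathsf R_{23}$, $(\mathrm{id}\otimes\Delta)\mathsf R=\mathsf R_{13}\mathsf R_{12}$, $\mathsf R^{-1}=\mathsf R_{21}$. A cotriangular Hopf algebra $(A,R)$: $R:A\otimes A\to\Bbbk$ is convolution invertible with inverse $\bar R$, $m_{op}=R*m*\bar R$, $R\circ(m\otimes\mathrm{id})=R_{13}*R_{23}$, $R\circ(\mathrm{id}\otimes m)=R_{13}*R_{12}$, $\bar R=R_{21}$. The dual triangular Hopf algebra $(U,\mathscr R)$ comes with a Hopf pairing $\langle\ ,\ \rangle:U\otimes A\to\Bbbk$ with $R(a\otimes a')=\langle\mathscr R^\alpha,a\rangle\langle\mathscr R_\alpha,a'\rangle$. The opposite Hopf algebra $U^{op}$ is triangular with $R$-matrix $\mathscr R^{-1}$, and $U^{op}\otimes U$ is triangular with $\mathfrak R=(\mathrm{id}\otimes\mathrm{flip}\otimes\mathrm{id})(\mathscr R^{-1}\otimes\mathscr R)$. The algebra $A$ is a $U^{op}\otimes U$-module algebra via $(\zeta\otimes\xi)\triangleright a=\langle\zeta,a_{(1)}\rangle a_{(2)}\langle\xi,a_{(3)}\rangle$;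 restricting to $U^{op}$ it is a $U^{op}$-module algebra, $\zeta\triangleright a=\langle\zeta,a_{(1)}\rangle a_{(2)}$, whose action commutes with $\delta$. Let $(H,R_H)$ have dual triangular Hopf algebra $(U_H,\mathscr R_H)$; dually to $\pi$, $U_H\subset U$ with $\langle\xi,a\rangle=\langle\xi,\pi(a)\rangle$ for $\xi\in U_H$, and $\mathscr R_H=\mathscr R\in U_H\otimes U_H\subset U\otimes U$. For a triangular Hopf algebra $(K,\mathsf R)$ and a $K$-module algebra $A$, $\mathrm{Hom}(A,A)$ has $K$-action $(k\triangleright\psi)(a)=k_{(1)}\triangleright\psi(S(k_{(2)})\triangleright a)$, and $$\mathrm{Der}^{\mathsf R}(A)=\{\psi\in\mathrm{Hom}(A,A)\mid\psi(aa')=\psi(a)a'+(\mathsf R_\alpha\triangleright a)(\mathsf R^\alpha\triangleright\psi)(a')\}$$ is a $K$-braided Lie algebra with bracket $[\psi,\lambda]=\psi\circ\lambda-(\mathsf R_\alpha\triangleright\lambda)\circ(\mathsf R^\alpha\triangleright\psi)$. (A $K$-braided Lie algebra is a $K$-module with a bracket that is $K$-equivariant, satisfies $[u,v]=-[\mathsf R_\alpha\triangleright v,\mathsf R^\alpha\triangleright u]$ and $[u,[v,w]]=[[u,v],w]+[\mathsf R_\alpha\triangleright v,[\mathsf R^\alpha\triangleright u,w]]$; isomorphisms are $K$-equivariant bracket-preserving linear isomorphisms.) Using $(K,\mathsf R)=(U^{op},\mathscr R^{-1})$, $$\mathrm{aut}^{\mathsf R}_B(A)=\{u\in\mathrm{Der}^{\mathsf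 R}(A)\mid\delta(u(a))=u(a_{(0)})\otimes a_{(1)},\ u(b)=0\ \forall a\in A,b\in B\},$$ a braided Lie subalgebra; since $\mathscr R=\mathscr R_H$, it can equally be regarded as a $U_H^{op}$-braided Lie algebra. $\mathrm{Der}^{\mathfrak R}(A)$ is the space of braided derivations with respect to $(U^{op}\otimes U,\mathfrak R)$. Its right-invariant elements are $$\mathrm{Der}^{\mathfrak R}(A)_{\mathrm{inv}}=\{u\in\mathrm{Der}^{\mathfrak R}(A)\mid\Delta(u(a))=u(a_{(1)})\otimes a_{(2)}\ \forall a\in A\},$$ and by the fundamental theorem of bicovariant bimodules $\mathrm{Der}^{\mathfrak R}(A)=A\otimes\mathrm{Der}^{\mathfrak R}(A)_{\mathrm{inv}}$, where $a\otimes u$ is identified with the map $a'\mapsto a\,u(a')$; in this way $B\otimes\mathrm{Der}^{\mathfrak R}(A)_{\mathrm{inv}}$ is a space of linear maps $A\to A$. Since $\mathscr R=\mathscr R_H$, $\mathrm{Der}^{\mathfrak R}(A)$ is also a $U_H^{op}\otimes U_H$-braided Lie algebra (with $\mathfrak R_H=\mathfrak R$); the $U_H$-action on $B\otimes\mathrm{Der}^{\mathfrak R}(A)_{\mathrm{inv}}$ is trivial, so that this space, and its subspace of elements vanishing on $B$, are $U_H^{op}$-braided Lie algebras. *)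

theory Defs
  imports Complex_Main "HOL-Computational_Algebra.Formal_Power_Series"
begin

section \<open>Ground ring\<close>

definition field_or_power_series :: "('k::comm_ring_1 \<Rightarrow> 'f::field fps) \<Rightarrow> bool" where
  "field_or_power_series \<phi> \<longleftrightarrow>
     (\<forall>c::'k. c \<noteq> 0 \<longrightarrow> c dvd 1) \<or>
     (bij \<phi> \<and> \<phi> 1 = 1 \<and> (\<forall>x y. \<phi> (x + y) = \<phi> x + \<phi> y) \<and> (\<forall>x y. \<phi> (x * y) = \<phi> x * \<phi> y))"

text \<open>Congruence modulo the n-th power of the maximal ideal of the ground ring. For a field the only
  non-unit is 0, so for positive n this is equality; for a power series ring it is the adic topology
  of the variable.\<close>

definition adic_close :: "nat \<Rightarrow> 'k::comm_ring_1 \<Rightarrow> 'k \<Rightarrow> bool" where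
  "adic_close n x y \<longleftrightarrow> (\<exists>c. \<not> c dvd 1 \<and> c ^ n dvd (x - y))"


section \<open>Tensor products\<close>

text \<open>An element of a tensor product is given by a list of pure tensors (a formal sum). Two lists
  denote the same element iff they are related by the congruence below. The set of pairs (f, g)
  contains the relations f a \<otimes> b = a \<otimes> g b: scalar multiplications for the tensor product over the
  ground ring, multiplications by elements of B for the balanced tensor product over B. A map into
  a tensor product, e.g. a coproduct, is given by a choice of representing lists, so that the
  Sweedler sum over a bilinear expression f is \<Sum>(x, y)\<leftarrow>\<Delta> a. f x y.\<close>

inductive tens_eq ::
  "(('a \<Rightarrow> 'a) \<times> ('b \<Rightarrow> 'b)) set \<Rightarrow> ('a::ab_group_add \<times> 'b::ab_group_add) list \<Rightarrow> ('a \<times> 'b) list \<Rightarrow> bool"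
  for bal where
  tens_refl: "tens_eq bal t t"
| tens_sym: "tens_eq bal s t \<Longrightarrow> tens_eq bal t s"
| tens_trans: "tens_eq bal s t \<Longrightarrow> tens_eq bal t w \<Longrightarrow> tens_eq bal s w"
| tens_append: "tens_eq bal s s' \<Longrightarrow> tens_eq bal t t' \<Longrightarrow> tens_eq bal (s @ t) (s' @ t')"
| tens_comm: "tens_eq bal (s @ t) (t @ s)"
| tens_zero: "tens_eq bal [(0, b)] []"
| tens_add_left: "tens_eq bal [(a + a', b)] [(a, b), (a', b)]"
| tens_add_right: "tens_eq bal [(a, b + b')] [(a, b), (a, b')]"
| tens_balance: "(f, g) \<in> bal \<Longrightarrow> tens_eq bal [(f a, b)] [(a, g b)]"

definition tensor_eq ::
  "('k \<Rightarrow> 'a \<Rightarrow> 'a) \<Rightarrow> ('k \<Rightarrow> 'b \<Rightarrow> 'b) \<Rightarrow>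
   ('a::ab_group_add \<times> 'b::ab_group_add) list \<Rightarrow> ('a \<times> 'b) list \<Rightarrow> bool" where
  "tensor_eq s s' = tens_eq (range (\<lambda>c. (s c, s' c)))"

inductive tensor3_eq ::
  "('k \<Rightarrow> 'a \<Rightarrow> 'a) \<Rightarrow> ('a::ab_group_add \<times> 'a \<times> 'a) list \<Rightarrow> ('a \<times> 'a \<times> 'a) list \<Rightarrow> bool"
  for s where
  tens3_refl: "tensor3_eq s t t"
| tens3_sym: "tensor3_eq s t w \<Longrightarrow> tensor3_eq s w t"
| tens3_trans: "tensor3_eq s t w \<Longrightarrow> tensor3_eq s w v \<Longrightarrow> tensor3_eq s t v"
| tens3_append: "tensor3_eq s t t' \<Longrightarrow> tensor3_eq s w w' \<Longrightarrow> tensor3_eq s (t @ w) (t' @ w')"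
| tens3_comm: "tensor3_eq s (t @ w) (w @ t)"
| tens3_zero: "tensor3_eq s [(0, y, z)] []"
| tens3_add_1: "tensor3_eq s [(x + x', y, z)] [(x, y, z), (x', y, z)]"
| tens3_add_2: "tensor3_eq s [(x, y + y', z)] [(x, y, z), (x, y', z)]"
| tens3_add_3: "tensor3_eq s [(x, y, z + z')] [(x, y, z), (x, y, z')]"
| tens3_scale_12: "tensor3_eq s [(s c x, y, z)] [(x, s c y, z)]"
| tens3_scale_23: "tensor3_eq s [(x, s c y, z)] [(x, y, s c z)]"


section \<open>Hopf algebras\<close>

text \<open>Ring structure and addition come from the type class of the carrier type; the record holds the
  remaining structure.\<close>

record ('k, 'a) hopf =
  scl :: "'k \<Rightarrow> 'a \<Rightarrow> 'a"
  cop :: "'a \<Rightarrow> ('a \<times> 'a) list"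
  cou :: "'a \<Rightarrow> 'k"
  ant :: "'a \<Rightarrow> 'a"

definition cop3 :: "('k, 'a) hopf \<Rightarrow> 'a \<Rightarrow> ('a \<times> 'a \<times> 'a) list" where
  "cop3 A a = [(x, y, z). (x, w) \<leftarrow> cop A a, (y, z) \<leftarrow> cop A w]"

locale hopf_algebra = module "scl A" for A :: "('k::comm_ring_1, 'a::ring_1) hopf" +
  assumes scl_mult_left: "scl A c x * y = scl A c (x * y)"
    and scl_mult_right: "x * scl A c y = scl A c (x * y)"
    and cop_add: "tensor_eq (scl A) (scl A) (cop A (x + y)) (cop A x @ cop A y)"
    and cop_scl: "tensor_eq (scl A) (scl A) (cop A (scl A c x)) [(scl A c p, q). (p, q) \<leftarrow> cop A x]"
    and cou_linear: "module_hom (scl A) (*) (cou A)"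
    and coassoc: "tensor3_eq (scl A) [(x, y, z). (w, z) \<leftarrow> cop A a, (x, y) \<leftarrow> cop A w] (cop3 A a)"
    and cou_left: "(\<Sum>(x, y)\<leftarrow>cop A a. scl A (cou A x) y) = a"
    and cou_right: "(\<Sum>(x, y)\<leftarrow>cop A a. scl A (cou A y) x) = a"
    and cop_one: "tensor_eq (scl A) (scl A) (cop A 1) [(1, 1)]"
    and cop_mult: "tensor_eq (scl A) (scl A) (cop A (a * b))
                     [(x * x', y * y'). (x, y) \<leftarrow> cop A a, (x', y') \<leftarrow> cop A b]"
    and cou_one: "cou A 1 = 1"
    and cou_mult: "cou A (a * b) = cou A a * cou A b"
    and ant_linear: "module_hom (scl A) (scl A) (ant A)"
    and ant_left: "(\<Sum>(x, y)\<leftarrow>cop A a. ant A x * y) = scl A (cou A a) 1"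
    and ant_right: "(\<Sum>(x, y)\<leftarrow>cop A a. x * ant A y) = scl A (cou A a) 1"

definition hopf_map ::
  "('k::comm_ring_1, 'a::ring_1) hopf \<Rightarrow> ('k, 'b::ring_1) hopf \<Rightarrow> ('a \<Rightarrow> 'b) \<Rightarrow> bool" where
  "hopf_map A H \<pi> \<longleftrightarrow>
     module_hom (scl A) (scl H) \<pi> \<and> \<pi> 1 = 1 \<and> (\<forall>a b. \<pi> (a * b) = \<pi> a * \<pi> b) \<and>
     (\<forall>a. tensor_eq (scl H) (scl H) (cop H (\<pi> a)) [(\<pi> x, \<pi> y). (x, y) \<leftarrow> cop A a]) \<and>
     (\<forall>a. cou H (\<pi> a) = cou A a)"

definition hopf_pairing ::
  "('k::comm_ring_1, 'u::ring_1) hopf \<Rightarrow> ('k, 'a::ring_1) hopf \<Rightarrow> ('u \<Rightarrow> 'a \<Rightarrow> 'k) \<Rightarrow> bool" where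
  "hopf_pairing U A pair \<longleftrightarrow>
     (\<forall>a. module_hom (scl U) (*) (\<lambda>\<xi>. pair \<xi> a)) \<and> (\<forall>\<xi>. module_hom (scl A) (*) (pair \<xi>)) \<and>
     (\<forall>\<xi> \<eta> a. pair (\<xi> * \<eta>) a = (\<Sum>(x, y)\<leftarrow>cop A a. pair \<xi> x * pair \<eta> y)) \<and>
     (\<forall>\<xi> a b. pair \<xi> (a * b) = (\<Sum>(p, q)\<leftarrow>cop U \<xi>. pair p a * pair q b)) \<and>
     (\<forall>a. pair 1 a = cou A a) \<and> (\<forall>\<xi>. pair \<xi> 1 = cou U \<xi>)"

definition separates :: "('u \<Rightarrow> 'a::zero \<Rightarrow> 'k::zero) \<Rightarrow> bool" where
  "separates pair \<longleftrightarrow> (\<forall>a. (\<forall>\<xi>. pair \<xi> a = 0) \<longrightarrow> a = 0)"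


section \<open>Cotriangular and triangular structures\<close>

definition bilinear_form :: "('k::comm_ring_1, 'a::ring_1) hopf \<Rightarrow> ('a \<Rightarrow> 'a \<Rightarrow> 'k) \<Rightarrow> bool" where
  "bilinear_form A F \<longleftrightarrow>
     (\<forall>a. module_hom (scl A) (*) (F a)) \<and> (\<forall>b. module_hom (scl A) (*) (\<lambda>a. F a b))"

definition conv ::
  "('k::comm_ring_1, 'a) hopf \<Rightarrow> ('a \<Rightarrow> 'a \<Rightarrow> 'k) \<Rightarrow> ('a \<Rightarrow> 'a \<Rightarrow> 'k) \<Rightarrow> 'a \<Rightarrow> 'a \<Rightarrow> 'k" where
  "conv A F G a b = (\<Sum>(x, y)\<leftarrow>cop A a. \<Sum>(x', y')\<leftarrow>cop A b. F x x' * G y y')"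

definition conv_inverse ::
  "('k::comm_ring_1, 'a) hopf \<Rightarrow> ('a \<Rightarrow> 'a \<Rightarrow> 'k) \<Rightarrow> ('a \<Rightarrow> 'a \<Rightarrow> 'k) \<Rightarrow> bool" where
  "conv_inverse A F G \<longleftrightarrow>
     (\<forall>a b. conv A F G a b = cou A a * cou A b) \<and> (\<forall>a b. conv A G F a b = cou A a * cou A b)"

definition cotriangular ::
  "('k::comm_ring_1, 'a::ring_1) hopf \<Rightarrow> ('a \<Rightarrow> 'a \<Rightarrow> 'k) \<Rightarrow> ('a \<Rightarrow> 'a \<Rightarrow> 'k) \<Rightarrow> bool" where
  "cotriangular A R Rbar \<longleftrightarrow>
     bilinear_form A R \<and> bilinear_form A Rbar \<and> conv_inverse A R Rbar \<and>
     (\<forall>a b. b * a = (\<Sum>(x, y, z)\<leftarrow>cop3 A a. \<Sum>(x', y', z')\<leftarrow>cop3 A b.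
                      scl A (R x x' * Rbar z z') (y * y'))) \<and>
     (\<forall>a b c. R (a * b) c = (\<Sum>(x, y)\<leftarrow>cop A c. R a x * R b y)) \<and>
     (\<forall>a b c. R a (b * c) = (\<Sum>(x, y)\<leftarrow>cop A a. R x c * R y b)) \<and>
     (\<forall>a b. Rbar a b = R b a)"

text \<open>For a Hopf algebra U paired with A, the completion of U \<otimes> U is taken in the topology of
  pointwise convergence on A \<otimes> A: its elements are the bilinear forms F on A which are limits of
  elements of U \<otimes> U, and F a b is the pairing of the completed element with a \<otimes> b. The product of
  the completion is convolution.\<close>

definition in_completion ::
  "('k::comm_ring_1, 'a::ring_1) hopf \<Rightarrow> ('u \<Rightarrow> 'a \<Rightarrow> 'k) \<Rightarrow> ('a \<Rightarrow> 'a \<Rightarrow> 'k) \<Rightarrow> bool" where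
  "in_completion A pair F \<longleftrightarrow> bilinear_form A F \<and>
     (\<forall>n P. finite P \<longrightarrow>
        (\<exists>t. \<forall>(a, b)\<in>P. adic_close n (\<Sum>(\<xi>, \<eta>)\<leftarrow>t. pair \<xi> a * pair \<eta> b) (F a b)))"

text \<open>Triangularity of U, with universal matrix \<R> in this completion. Paired with A \<otimes> A \<otimes> A, the
  hexagon identities become the last two identities for \<R>. The antipode is bijective because the
  opposite algebra of U is also required to be a Hopf algebra; its antipode is the inverse of the
  antipode of U.\<close>

definition triangular ::
  "('k::comm_ring_1, 'u::ring_1) hopf \<Rightarrow> ('k, 'a::ring_1) hopf \<Rightarrow> ('u \<Rightarrow> 'a \<Rightarrow> 'k) \<Rightarrow>
   ('a \<Rightarrow> 'a \<Rightarrow> 'k) \<Rightarrow> ('a \<Rightarrow> 'a \<Rightarrow> 'k) \<Rightarrow> bool" where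
  "triangular U A pair \<R> \<R>inv \<longleftrightarrow>
     bij (ant U) \<and>
     in_completion A pair \<R> \<and> in_completion A pair \<R>inv \<and> conv_inverse A \<R> \<R>inv \<and>
     (\<forall>\<xi> a b. conv A (conv A \<R> (\<lambda>a b. \<Sum>(p, q)\<leftarrow>cop U \<xi>. pair p a * pair q b)) \<R>inv a b
               = (\<Sum>(p, q)\<leftarrow>cop U \<xi>. pair q a * pair p b)) \<and>
     (\<forall>a b. \<R>inv a b = \<R> b a) \<and>
     (\<forall>a b c. \<R> (a * b) c = (\<Sum>(x, y)\<leftarrow>cop A c. \<R> a x * \<R> b y)) \<and>
     (\<forall>a b c. \<R> a (b * c) = (\<Sum>(x, y)\<leftarrow>cop A a. \<R> x c * \<R> y b))"

text \<open>(U, \<R>) is dual to (A, R). Since \<R> is encoded by its pairing with A \<otimes> A, the relation between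
  R and \<R> says that \<R> is R.\<close>

definition dual_triangular ::
  "('k::comm_ring_1, 'u::ring_1) hopf \<Rightarrow> ('k, 'a::ring_1) hopf \<Rightarrow> ('u \<Rightarrow> 'a \<Rightarrow> 'k) \<Rightarrow>
   ('a \<Rightarrow> 'a \<Rightarrow> 'k) \<Rightarrow> ('a \<Rightarrow> 'a \<Rightarrow> 'k) \<Rightarrow> bool" where
  "dual_triangular U A pair R Rbar \<longleftrightarrow>
     hopf_algebra U \<and> hopf_pairing U A pair \<and> triangular U A pair R Rbar"

text \<open>The data of a triangular Hopf algebra K entering the braided constructions. The type 'q is K
  itself or a set of generators of K as a module, and 'c the same for the Hopf algebra K is paired
  with; tpair is the pairing and trmat the pairing of the completed universal matrix with C \<otimes> C.\<close>

record ('k, 'q, 'c) triang =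
  tmult :: "'q \<Rightarrow> 'q \<Rightarrow> 'q"
  tone :: 'q
  tcop :: "'q \<Rightarrow> ('q \<times> 'q) list"
  tant :: "'q \<Rightarrow> 'q"
  tpair :: "'q \<Rightarrow> 'c \<Rightarrow> 'k"
  trmat :: "'c \<Rightarrow> 'c \<Rightarrow> 'k"

text \<open>The opposite Hopf algebra of U with universal matrix the inverse of \<R>.\<close>

definition op_triang ::
  "('k::comm_ring_1, 'u::ring_1) hopf \<Rightarrow> ('u \<Rightarrow> 'a \<Rightarrow> 'k) \<Rightarrow> ('a \<Rightarrow> 'a \<Rightarrow> 'k) \<Rightarrow> ('k, 'u, 'a) triang" where
  "op_triang U pair Rbar =
     \<lparr> tmult = (\<lambda>\<xi> \<eta>. \<eta> * \<xi>), tone = 1, tcop = cop U, tant = inv (ant U), tpair = pair, trmat = Rbar \<rparr>"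

text \<open>The tensor product of the opposite of U with U, on pure tensors (a pair (\<zeta>, \<xi>) stands for
  \<zeta> \<otimes> \<xi>), with universal matrix (id \<otimes> flip \<otimes> id) (\<R>inv \<otimes> \<R>). All constructions below are linear in
  the acting element, hence determined by pure tensors.\<close>

definition op_tensor_triang ::
  "('k::comm_ring_1, 'u::ring_1) hopf \<Rightarrow> ('u \<Rightarrow> 'a \<Rightarrow> 'k) \<Rightarrow> ('a \<Rightarrow> 'a \<Rightarrow> 'k) \<Rightarrow> ('a \<Rightarrow> 'a \<Rightarrow> 'k) \<Rightarrow>
   ('k, 'u \<times> 'u, 'a \<times> 'a) triang" where
  "op_tensor_triang U pair R Rbar =
     \<lparr> tmult = (\<lambda>(\<zeta>, \<xi>) (\<zeta>', \<xi>'). (\<zeta>' * \<zeta>, \<xi> * \<xi>')),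
       tone = (1, 1),
       tcop = (\<lambda>(\<zeta>, \<xi>). [((p, x), (q, y)). (p, q) \<leftarrow> cop U \<zeta>, (x, y) \<leftarrow> cop U \<xi>]),
       tant = (\<lambda>(\<zeta>, \<xi>). (inv (ant U) \<zeta>, ant U \<xi>)),
       tpair = (\<lambda>(\<zeta>, \<xi>) (a, b). pair \<zeta> a * pair \<xi> b),
       trmat = (\<lambda>(a, b) (a', b'). Rbar a a' * R b b') \<rparr>"

text \<open>The value of a bilinear map \<Phi> on K \<times> K at the completed universal matrix, i.e. the
  possibly infinite sum of \<Phi> r r' over the terms r \<otimes> r' of that matrix (the first argument of \<Phi> is
  the upper-index leg). The \<Phi> occurring below depend on r, r' through finitely many values of the
  pairing with C \<otimes> C, and such \<Phi> extend to the completion by continuity.\<close>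

definition contract ::
  "('k::comm_ring_1, 'q, 'c) triang \<Rightarrow> ('k \<Rightarrow> 'v::ab_group_add \<Rightarrow> 'v) \<Rightarrow> ('q \<Rightarrow> 'q \<Rightarrow> 'v) \<Rightarrow> 'v" where
  "contract K s \<Phi> =
     (THE v. \<exists>ts :: ('c \<times> 'c \<times> 'v) list.
        (\<forall>r r'. \<Phi> r r' = (\<Sum>(p, q, w)\<leftarrow>ts. s (tpair K r p * tpair K r' q) w)) \<and>
        v = (\<Sum>(p, q, w)\<leftarrow>ts. s (trmat K p q) w))"


section \<open>Braided derivations and braided Lie algebras\<close>

definition hom_act ::
  "('k, 'q, 'c) triang \<Rightarrow> ('q \<Rightarrow> 'a::ab_group_add \<Rightarrow> 'a) \<Rightarrow> 'q \<Rightarrow> ('a \<Rightarrow> 'a) \<Rightarrow> 'a \<Rightarrow> 'a" where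
  "hom_act K act k \<psi> = (\<lambda>a. \<Sum>(p, q)\<leftarrow>tcop K k. act p (\<psi> (act (tant K q) a)))"

definition braided_Der ::
  "('k::comm_ring_1, 'q, 'c) triang \<Rightarrow> ('k \<Rightarrow> 'a::ring_1 \<Rightarrow> 'a) \<Rightarrow> ('q \<Rightarrow> 'a \<Rightarrow> 'a) \<Rightarrow> ('a \<Rightarrow> 'a) set" where
  "braided_Der K s act =
     {\<psi>. module_hom s s \<psi> \<and>
         (\<forall>a a'. \<psi> (a * a') = \<psi> a * a' + contract K s (\<lambda>r r'. act r' a * hom_act K act r \<psi> a'))}"

definition braided_bracket ::
  "('k::comm_ring_1, 'q, 'c) triang \<Rightarrow> ('k \<Rightarrow> 'a::ring_1 \<Rightarrow> 'a) \<Rightarrow> ('q \<Rightarrow> 'a \<Rightarrow> 'a) \<Rightarrow>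
   ('a \<Rightarrow> 'a) \<Rightarrow> ('a \<Rightarrow> 'a) \<Rightarrow> 'a \<Rightarrow> 'a" where
  "braided_bracket K s act \<psi> \<chi> =
     (\<lambda>a. \<psi> (\<chi> a) - contract K s (\<lambda>r r'. hom_act K act r' \<chi> (hom_act K act r \<psi> a)))"

text \<open>Braided Lie algebra structure, with K-action act and bracket br, on a space L of linear maps
  on a module. sK and s are the scalar multiplications of K and of the module; sums over the
  completed universal matrix are taken pointwise.\<close>

definition braided_lie_algebra ::
  "('k::comm_ring_1 \<Rightarrow> 'q::ab_group_add \<Rightarrow> 'q) \<Rightarrow> ('k, 'q, 'c) triang \<Rightarrow> ('k \<Rightarrow> 'a::ab_group_add \<Rightarrow> 'a) \<Rightarrow>
   ('q \<Rightarrow> ('a \<Rightarrow> 'a) \<Rightarrow> 'a \<Rightarrow> 'a) \<Rightarrow> (('a \<Rightarrow> 'a) \<Rightarrow> ('a \<Rightarrow> 'a) \<Rightarrow> 'a \<Rightarrow> 'a) \<Rightarrow> ('a \<Rightarrow> 'a) set \<Rightarrow> bool" where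
  "braided_lie_algebra sK K s act br L \<longleftrightarrow>
     \<comment> \<open>L is a space of linear maps\<close>
     L \<subseteq> {u. module_hom s s u} \<and> (\<lambda>a. 0) \<in> L \<and>
     (\<forall>u\<in>L. \<forall>v\<in>L. (\<lambda>a. u a + v a) \<in> L) \<and> (\<forall>c. \<forall>u\<in>L. (\<lambda>a. s c (u a)) \<in> L) \<and>
     \<comment> \<open>and a K-module\<close>
     (\<forall>k. \<forall>u\<in>L. act k u \<in> L) \<and>
     (\<forall>k. \<forall>u\<in>L. \<forall>v\<in>L. act k (\<lambda>a. u a + v a) = (\<lambda>a. act k u a + act k v a)) \<and>
     (\<forall>k c. \<forall>u\<in>L. act k (\<lambda>a. s c (u a)) = (\<lambda>a. s c (act k u a))) \<and>
     (\<forall>k k'. \<forall>u\<in>L. act (k + k') u = (\<lambda>a. act k u a + act k' u a)) \<and>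
     (\<forall>c k. \<forall>u\<in>L. act (sK c k) u = (\<lambda>a. s c (act k u a))) \<and>
     (\<forall>u\<in>L. act (tone K) u = u) \<and>
     (\<forall>k k'. \<forall>u\<in>L. act (tmult K k k') u = act k (act k' u)) \<and>
     \<comment> \<open>with a bilinear K-equivariant bracket\<close>
     (\<forall>u\<in>L. \<forall>v\<in>L. br u v \<in> L) \<and>
     (\<forall>u\<in>L. \<forall>v\<in>L. \<forall>w\<in>L. br (\<lambda>a. u a + v a) w = (\<lambda>a. br u w a + br v w a)) \<and>
     (\<forall>u\<in>L. \<forall>v\<in>L. \<forall>w\<in>L. br w (\<lambda>a. u a + v a) = (\<lambda>a. br w u a + br w v a)) \<and>
     (\<forall>c. \<forall>u\<in>L. \<forall>v\<in>L. br (\<lambda>a. s c (u a)) v = (\<lambda>a. s c (br u v a))) \<and>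
     (\<forall>c. \<forall>u\<in>L. \<forall>v\<in>L. br u (\<lambda>a. s c (v a)) = (\<lambda>a. s c (br u v a))) \<and>
     (\<forall>k. \<forall>u\<in>L. \<forall>v\<in>L. act k (br u v) = (\<lambda>a. \<Sum>(p, q)\<leftarrow>tcop K k. br (act p u) (act q v) a)) \<and>
     \<comment> \<open>which is braided antisymmetric and satisfies the braided Jacobi identity\<close>
     (\<forall>u\<in>L. \<forall>v\<in>L. br u v = (\<lambda>a. - contract K s (\<lambda>r r'. br (act r' v) (act r u) a))) \<and>
     (\<forall>u\<in>L. \<forall>v\<in>L. \<forall>w\<in>L. br u (br v w) =
        (\<lambda>a. br (br u v) w a + contract K s (\<lambda>r r'. br (act r' v) (br (act r u) w) a)))"

definition braided_lie_iso ::
  "('k::comm_ring_1 \<Rightarrow> 'q::ab_group_add \<Rightarrow> 'q) \<Rightarrow> ('k, 'q, 'c) triang \<Rightarrow> ('k \<Rightarrow> 'a::ab_group_add \<Rightarrow> 'a) \<Rightarrow>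
   ('q \<Rightarrow> ('a \<Rightarrow> 'a) \<Rightarrow> 'a \<Rightarrow> 'a) \<Rightarrow> (('a \<Rightarrow> 'a) \<Rightarrow> ('a \<Rightarrow> 'a) \<Rightarrow> 'a \<Rightarrow> 'a) \<Rightarrow> ('a \<Rightarrow> 'a) set \<Rightarrow>
   ('q \<Rightarrow> ('a \<Rightarrow> 'a) \<Rightarrow> 'a \<Rightarrow> 'a) \<Rightarrow> (('a \<Rightarrow> 'a) \<Rightarrow> ('a \<Rightarrow> 'a) \<Rightarrow> 'a \<Rightarrow> 'a) \<Rightarrow> ('a \<Rightarrow> 'a) set \<Rightarrow>
   (('a \<Rightarrow> 'a) \<Rightarrow> 'a \<Rightarrow> 'a) \<Rightarrow> bool" where
  "braided_lie_iso sK K s act br L act' br' L' f \<longleftrightarrow>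
     braided_lie_algebra sK K s act br L \<and> braided_lie_algebra sK K s act' br' L' \<and>
     bij_betw f L L' \<and>
     (\<forall>u\<in>L. \<forall>v\<in>L. f (\<lambda>a. u a + v a) = (\<lambda>a. f u a + f v a)) \<and>
     (\<forall>c. \<forall>u\<in>L. f (\<lambda>a. s c (u a)) = (\<lambda>a. s c (f u a))) \<and>
     (\<forall>k. \<forall>u\<in>L. f (act k u) = act' k (f u)) \<and>
     (\<forall>u\<in>L. \<forall>v\<in>L. f (br u v) = br' (f u) (f v))"


section \<open>Quantum homogeneous spaces\<close>

definition coaction :: "('k, 'a) hopf \<Rightarrow> ('a \<Rightarrow> 'h) \<Rightarrow> 'a \<Rightarrow> ('a \<times> 'h) list" where
  "coaction A \<pi> a = [(x, \<pi> y). (x, y) \<leftarrow> cop A a]"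

definition coinvariants ::
  "('k::comm_ring_1, 'a::ring_1) hopf \<Rightarrow> ('k, 'h::ring_1) hopf \<Rightarrow> ('a \<Rightarrow> 'h) \<Rightarrow> 'a set" where
  "coinvariants A H \<pi> = {b. tensor_eq (scl A) (scl H) (coaction A \<pi> b) [(b, 1)]}"

definition canonical_map ::
  "('k, 'a::ring_1) hopf \<Rightarrow> ('a \<Rightarrow> 'h) \<Rightarrow> ('a \<times> 'a) list \<Rightarrow> ('a \<times> 'h) list" where
  "canonical_map A \<pi> t = [(a * x, h). (a, a') \<leftarrow> t, (x, h) \<leftarrow> coaction A \<pi> a']"

definition hopf_galois ::
  "('k::comm_ring_1, 'a::ring_1) hopf \<Rightarrow> ('k, 'h::ring_1) hopf \<Rightarrow> ('a \<Rightarrow> 'h) \<Rightarrow> bool" where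
  "hopf_galois A H \<pi> \<longleftrightarrow>
     (\<forall>t t'. tensor_eq (scl A) (scl H) (canonical_map A \<pi> t) (canonical_map A \<pi> t') \<longrightarrow>
        tens_eq {(\<lambda>x. x * b, \<lambda>y. b * y) | b. b \<in> coinvariants A H \<pi>} t t') \<and>
     (\<forall>w. \<exists>t. tensor_eq (scl A) (scl H) (canonical_map A \<pi> t) w)"

definition left_act :: "('k, 'a::ab_group_add) hopf \<Rightarrow> ('u \<Rightarrow> 'a \<Rightarrow> 'k) \<Rightarrow> 'u \<Rightarrow> 'a \<Rightarrow> 'a" where
  "left_act A pair \<zeta> a = (\<Sum>(x, y)\<leftarrow>cop A a. scl A (pair \<zeta> x) y)"

definition bi_act ::
  "('k::comm_ring_1, 'a::ab_group_add) hopf \<Rightarrow> ('u \<Rightarrow> 'a \<Rightarrow> 'k) \<Rightarrow> 'u \<times> 'u \<Rightarrow> 'a \<Rightarrow> 'a" where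
  "bi_act A pair = (\<lambda>(\<zeta>, \<xi>) a. \<Sum>(x, y, z)\<leftarrow>cop3 A a. scl A (pair \<zeta> x * pair \<xi> z) y)"

definition aut_braided ::
  "('k::comm_ring_1, 'a::ring_1) hopf \<Rightarrow> ('k, 'h::ring_1) hopf \<Rightarrow> ('a \<Rightarrow> 'h) \<Rightarrow>
   ('k, 'u::ring_1) hopf \<Rightarrow> ('u \<Rightarrow> 'a \<Rightarrow> 'k) \<Rightarrow> ('a \<Rightarrow> 'a \<Rightarrow> 'k) \<Rightarrow> ('a \<Rightarrow> 'a) set" where
  "aut_braided A H \<pi> U pair Rbar =
     {u \<in> braided_Der (op_triang U pair Rbar) (scl A) (left_act A pair).
        (\<forall>a. tensor_eq (scl A) (scl H) (coaction A \<pi> (u a)) [(u x, h). (x, h) \<leftarrow> coaction A \<pi> a]) \<and>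
        (\<forall>b\<in>coinvariants A H \<pi>. u b = 0)}"

definition Der_bicov ::
  "('k::comm_ring_1, 'a::ring_1) hopf \<Rightarrow> ('k, 'u::ring_1) hopf \<Rightarrow> ('u \<Rightarrow> 'a \<Rightarrow> 'k) \<Rightarrow>
   ('a \<Rightarrow> 'a \<Rightarrow> 'k) \<Rightarrow> ('a \<Rightarrow> 'a \<Rightarrow> 'k) \<Rightarrow> ('a \<Rightarrow> 'a) set" where
  "Der_bicov A U pair R Rbar = braided_Der (op_tensor_triang U pair R Rbar) (scl A) (bi_act A pair)"

definition Der_inv ::
  "('k::comm_ring_1, 'a::ring_1) hopf \<Rightarrow> ('k, 'u::ring_1) hopf \<Rightarrow> ('u \<Rightarrow> 'a \<Rightarrow> 'k) \<Rightarrow>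
   ('a \<Rightarrow> 'a \<Rightarrow> 'k) \<Rightarrow> ('a \<Rightarrow> 'a \<Rightarrow> 'k) \<Rightarrow> ('a \<Rightarrow> 'a) set" where
  "Der_inv A U pair R Rbar =
     {u \<in> Der_bicov A U pair R Rbar.
        \<forall>a. tensor_eq (scl A) (scl A) (cop A (u a)) [(u x, y). (x, y) \<leftarrow> cop A a]}"

text \<open>B \<otimes> D as a space of maps: b \<otimes> u is identified with the map taking a to b * u a, and a general
  element is a finite sum of such.\<close>

definition tensor_maps :: "'a::ring_1 set \<Rightarrow> ('a \<Rightarrow> 'a) set \<Rightarrow> ('a \<Rightarrow> 'a) set" where
  "tensor_maps B D = {(\<lambda>a. \<Sum>(b, u)\<leftarrow>t. b * u a) | t. set t \<subseteq> B \<times> D}"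

end

theory Submission
  imports Defs
begin

text \<open>
  \<^bold>\<open>Both Leibniz rules made explicit.\<close> Write \<open>R\<close> for the cotriangular structure and \<open>Rbar\<close> for its
  inverse, so \<open>Rbar(x, y) = R(y, x)\<close>. A contraction with the universal matrix can be evaluated in \<open>A\<close>: the
  hexagon identities split it and braided commutativity moves it across products. For the two-sided
  action of \<open>U\<^sup>o\<^sup>p \<otimes> U\<close> a linear map \<open>u\<close> is a braided derivation iff

    \<open>u(a a') = u(a) a' + R(a'\<^sub>1, a\<^sub>1) u(a'\<^sub>2) a\<^sub>2 Rbar(a'\<^sub>3, a\<^sub>3)\<close>

  (\<open>twisted_derivation\<close>, \<open>braided_Der_op_tensor\<close>). For the left action alone the last term reads
  \<open>R(a'\<^sub>1, a\<^sub>1) u(a'\<^sub>2)\<^sub>1 a\<^sub>2 Rbar(u(a'\<^sub>2)\<^sub>2, a\<^sub>3)\<close>; since \<open>R\<close> factors through \<open>\<pi>\<close>, the two terms agree as soon as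
  \<open>u\<close> is colinear for the coaction of \<open>H\<close> (\<open>braided_iff_twisted\<close>). Gauge transformations are therefore
  the colinear elements of \<open>A \<otimes> Der\<^sub>i\<^sub>n\<^sub>v\<close> that vanish on \<open>B\<close>.

  \<^bold>\<open>Colinear means coefficients in B.\<close> A right-invariant \<open>u\<close> is determined by the functional \<open>\<epsilon> \<circ> u\<close>, as
  \<open>u(a) = \<epsilon>(u(a\<^sub>1)) a\<^sub>2\<close>. For a sum of maps \<open>c\<^sub>i u\<^sub>i\<close> the convolution product with the antipode is
  \<open>a \<mapsto> \<Sum> \<epsilon>(u\<^sub>i(a)) c\<^sub>i\<close>. If the sum is colinear, this function has values in \<open>B\<close> (\<open>symbol_base\<close>), and
  Gaussian elimination over the ground ring rewrites the sum with coefficients in \<open>B\<close>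
  (\<open>base_valued_sum_in_tensor_maps\<close>). Conversely \<open>b u\<close> is colinear for \<open>b\<close> in \<open>B\<close> and \<open>u\<close> right-invariant.

  \<^bold>\<open>The Lie algebra.\<close> The action of \<open>k\<close> on \<open>u\<close> is \<open>a \<mapsto> \<langle>k, u(a\<^sub>2)\<^sub>1 S\<inverse>(a\<^sub>1)\<rangle> u(a\<^sub>2)\<^sub>2\<close>. It comes from a
  coaction on linear maps which is finite at each \<open>a\<close> (\<open>adj\<close>), so each axiom of a braided Lie algebra
  becomes a scalar identity for \<open>Rbar\<close>; the Jacobi identity amounts to the Yang-Baxter equation
  (\<open>contracts_jacobi\<close>). Here \<open>S\<inverse>\<close> exists because \<open>S\<close> is injective by duality with \<open>U\<close>, and surjective
  because its square is coinner (\<open>surj_ant\<close>). On colinear maps the second factor of \<open>U\<^sub>H\<^sup>o\<^sup>p \<otimes> U\<^sub>H\<close> acts by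
  the counit, so the one-sided and the two-sided actions and brackets coincide and the identity map
  is the isomorphism (\<open>hom_act_tensor\<close>, \<open>bracket_tensor\<close>).

  \<^bold>\<open>Contractions.\<close> A contraction with an element of the completed tensor square does not depend on
  the chosen presentation, because the pairing separates \<open>A\<close> and no nonzero scalar is divisible by
  all powers of the maximal ideal (\<open>completion_determined\<close>).
\<close>

section \<open>Linear maps and Sweedler sums\<close>

text \<open>The module axioms are left out, so that linearity of a compound expression in one of its
  variables can be decided by rewriting; almost every step with a Sweedler sum has such side
  conditions.\<close>

definition lin :: "('k \<Rightarrow> 'a::ab_group_add \<Rightarrow> 'a) \<Rightarrow> ('k \<Rightarrow> 'b::ab_group_add \<Rightarrow> 'b) \<Rightarrow> ('a \<Rightarrow> 'b) \<Rightarrow> bool" where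
  "lin s s' f \<longleftrightarrow> (\<forall>x y. f (x + y) = f x + f y) \<and> (\<forall>c x. f (s c x) = s' c (f x))"

lemma lin_add: "lin s s' f \<Longrightarrow> f (x + y) = f x + f y"
  and lin_scale: "lin s s' f \<Longrightarrow> f (s c x) = s' c (f x)"
  by (simp_all add: lin_def)

lemma lin_zero: "lin s s' f \<Longrightarrow> f 0 = 0"
  using lin_add[of s s' f 0 0] by simp

lemma lin_minus: "lin s s' f \<Longrightarrow> f (- x) = - f x"
  using lin_add[of s s' f x "- x"] lin_zero[of s s' f] by (simp add: add_eq_0_iff)

lemma lin_diff: "lin s s' f \<Longrightarrow> f (x - y) = f x - f y"
  using lin_add[of s s' f x "- y"] lin_minus[of s s' f y] by simp

lemma lin_sum_list: "lin s s' f \<Longrightarrow> f (\<Sum>x\<leftarrow>xs. g x) = (\<Sum>x\<leftarrow>xs. f (g x))"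
  by (induction xs) (simp_all add: lin_zero lin_add)

lemma lin_id [simp]: "lin s s (\<lambda>x. x)"
  by (simp add: lin_def)

lemma lin_comp: "lin s' s'' f \<Longrightarrow> lin s s' g \<Longrightarrow> lin s s'' (\<lambda>x. f (g x))"
  by (simp add: lin_def)

lemma lin_plus [simp]:
  "module s' \<Longrightarrow> lin s s' f \<Longrightarrow> lin s s' g \<Longrightarrow> lin s s' (\<lambda>x. f x + g x)"
  by (simp add: lin_def module.scale_right_distrib algebra_simps)

lemma lin_sub [simp]:
  "module s' \<Longrightarrow> lin s s' f \<Longrightarrow> lin s s' g \<Longrightarrow> lin s s' (\<lambda>x. f x - g x)"
  by (simp add: lin_def module.scale_right_diff_distrib algebra_simps)

lemma lin_const0 [simp]: "module s' \<Longrightarrow> lin s s' (\<lambda>x. 0)"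
  by (simp add: lin_def module.scale_zero_right)

lemma lin_list [simp]:
  "module s' \<Longrightarrow> (\<And>z. lin s s' (\<lambda>x. F x z)) \<Longrightarrow> lin s s' (\<lambda>x. \<Sum>z\<leftarrow>zs. F x z)"
  by (induction zs) simp_all

lemma lin_mult_k [simp]:
  "lin s (*) f \<Longrightarrow> lin s (*) (\<lambda>x. f x * (c::'k::comm_ring_1))"
  "lin s (*) f \<Longrightarrow> lin s (*) (\<lambda>x. (c::'k::comm_ring_1) * f x)"
  by (simp_all add: lin_def algebra_simps)

lemma module_mult [simp]: "module ((*) :: 'k::comm_ring_1 \<Rightarrow> 'k \<Rightarrow> 'k)"
  by unfold_locales (simp_all add: algebra_simps)

lemma lin_scaleI: "module s \<Longrightarrow> lin s s (s (c::'k::comm_ring_1))"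
  by (simp add: lin_def module.scale_right_distrib module.scale_left_commute)

lemma lin_iff_module_hom: "module s \<Longrightarrow> module s' \<Longrightarrow> module_hom s s' f \<longleftrightarrow> lin s s' f"
  unfolding module_hom_def module_hom_axioms_def lin_def by auto

lemma sum_list_swap:
  fixes F :: "'a \<Rightarrow> 'b \<Rightarrow> 'c::ab_group_add"
  shows "(\<Sum>x\<leftarrow>xs. \<Sum>y\<leftarrow>ys. F x y) = (\<Sum>y\<leftarrow>ys. \<Sum>x\<leftarrow>xs. F x y)"
  by (induction xs) (simp_all add: sum_list_addf)

lemma sum_list_concat_map:
  "sum_list (map f (concat (map g xs))) = (\<Sum>x\<leftarrow>xs. \<Sum>y\<leftarrow>g x. f y)"
  by (induction xs) simp_all

lemma tens_eq_sum:
  fixes f :: "'a::ab_group_add \<Rightarrow> 'b::ab_group_add \<Rightarrow> 'v::ab_group_add"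
  assumes "tens_eq bal t t'"
    and "\<And>x x' y. f (x + x') y = f x y + f x' y" "\<And>x y y'. f x (y + y') = f x y + f x y'"
    and "\<And>g h x y. (g, h) \<in> bal \<Longrightarrow> f (g x) y = f x (h y)"
  shows "(\<Sum>(x, y)\<leftarrow>t. f x y) = (\<Sum>(x, y)\<leftarrow>t'. f x y)"
  using assms(1)
proof induction
  case (tens_zero b)
  have "f 0 b = 0" using assms(2)[of 0 0 b] by simp
  then show ?case by simp
qed (simp_all add: assms(2-4) add.commute)

lemma tensor_eq_sum:
  assumes "tensor_eq s s' t t'" "\<And>y. lin s sv (\<lambda>x. f x y)" "\<And>x. lin s' sv (\<lambda>y. f x y)"
  shows "(\<Sum>(x, y)\<leftarrow>t. f x y) = (\<Sum>(x, y)\<leftarrow>t'. f x y)"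
  using assms(1) unfolding tensor_eq_def
proof (rule tens_eq_sum)
  show "f (x + x') y = f x y + f x' y" for x x' y using lin_add[OF assms(2)] .
  show "f x (y + y') = f x y + f x y'" for x y y' using lin_add[OF assms(3)] .
  show "f (g x) y = f x (h y)" if "(g, h) \<in> range (\<lambda>c. (s c, s' c))" for g h x y
    using that lin_scale[OF assms(2)] lin_scale[OF assms(3)] by auto
qed

lemma tensor3_eq_sum:
  fixes f :: "'a::ab_group_add \<Rightarrow> 'a \<Rightarrow> 'a \<Rightarrow> 'v::ab_group_add"
  assumes "tensor3_eq s t t'" "\<And>y z. lin s sv (\<lambda>x. f x y z)" "\<And>x z. lin s sv (\<lambda>y. f x y z)"
    "\<And>x y. lin s sv (\<lambda>z. f x y z)"
  shows "(\<Sum>(x, y, z)\<leftarrow>t. f x y z) = (\<Sum>(x, y, z)\<leftarrow>t'. f x y z)"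
  using assms(1)
proof induction
  case (tens3_zero y z)
  show ?case using lin_zero[OF assms(2)] by simp
qed (simp_all add: lin_add[OF assms(2)] lin_add[OF assms(3)] lin_add[OF assms(4)] 
   lin_scale[OF assms(2)] lin_scale[OF assms(3)] lin_scale[OF assms(4)] add.commute)

text \<open>Sweedler sum: \<open>sw A a F\<close> is \<open>F(a\<^sub>1, a\<^sub>2)\<close>.\<close>

definition sw :: "('k, 'a) hopf \<Rightarrow> 'a \<Rightarrow> ('a \<Rightarrow> 'a \<Rightarrow> 'v::ab_group_add) \<Rightarrow> 'v" where
  "sw A a F = (\<Sum>(x, y)\<leftarrow>cop A a. F x y)"

lemma lin_sw_right [simp]:
  "module s' \<Longrightarrow> (\<And>p q. lin s s' (\<lambda>x. F x p q)) \<Longrightarrow> lin s s' (\<lambda>x. sw A a (\<lambda>p q. F x p q))"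
  unfolding sw_def by (rule lin_list) (auto simp: case_prod_unfold)

lemma sw_out: "lin s s' f \<Longrightarrow> f (sw A a F) = sw A a (\<lambda>x y. f (F x y))"
  unfolding sw_def by (subst lin_sum_list) (auto simp: case_prod_unfold)

lemma sw_add: "sw A a (\<lambda>x y. F x y + G x y) = sw A a F + sw A a G"
  unfolding sw_def by (simp add: case_prod_unfold sum_list_addf)

lemma sw_uminus: "sw A a (\<lambda>x y. - F x y) = - sw A a F"
  using sw_add[of A a F "\<lambda>x y. - F x y"] by (simp add: sw_def case_prod_unfold minus_unique)

lemma sw_diff: "sw A a (\<lambda>x y. F x y - G x y) = sw A a F - sw A a G"
  using sw_add[of A a F "\<lambda>x y. - G x y"] by (simp add: sw_uminus)

lemma sw_swap: "sw A a (\<lambda>x y. sw B b (\<lambda>x' y'. F x y x' y')) = sw B b (\<lambda>x' y'. sw A a (\<lambda>x y. F x y x' y'))"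
  unfolding sw_def case_prod_unfold by (rule sum_list_swap)

lemma sw_list_swap: "sw A a (\<lambda>x y. \<Sum>z\<leftarrow>zs. F x y z) = (\<Sum>z\<leftarrow>zs. sw A a (\<lambda>x y. F x y z))"
  unfolding sw_def case_prod_unfold by (rule sum_list_swap)

section \<open>Hopf algebras in Sweedler notation\<close>

context hopf_algebra
begin

abbreviation linV :: "('k \<Rightarrow> 'v::ab_group_add \<Rightarrow> 'v) \<Rightarrow> ('a \<Rightarrow> 'v) \<Rightarrow> bool" where
  "linV \<equiv> lin (scl A)"

lemma mod_A [simp]: "module (scl A)" by unfold_locales

lemma lin_scl [simp]:
  "lin s (*) f \<Longrightarrow> lin s (scl A) (\<lambda>x. scl A (f x) w)"
  "lin s (scl A) g \<Longrightarrow> lin s (scl A) (\<lambda>x. scl A c (g x))"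
  by (simp_all add: lin_def scale_left_distrib scale_right_distrib mult.commute)

lemma lin_mult [simp]:
  "lin s (scl A) f \<Longrightarrow> lin s (scl A) (\<lambda>x. f x * c)"
  "lin s (scl A) f \<Longrightarrow> lin s (scl A) (\<lambda>x. c * f x)"
  by (simp_all add: lin_def distrib_left distrib_right scl_mult_left scl_mult_right)

lemma lin_ant0: "linV (scl A) (ant A)"
  using ant_linear by (simp add: lin_iff_module_hom)

lemma lin_ant [simp]: "lin s (scl A) f \<Longrightarrow> lin s (scl A) (\<lambda>x. ant A (f x))"
  by (rule lin_comp[OF lin_ant0])

lemma lin_cou0: "linV (*) (cou A)"
  using cou_linear by (simp add: lin_iff_module_hom)

lemma lin_cou [simp]: "lin s (scl A) f \<Longrightarrow> lin s (*) (\<lambda>x. cou A (f x))"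
  by (rule lin_comp[OF lin_cou0])

text \<open>The chosen lists \<open>cop A a\<close> are additive in \<open>a\<close> only up to equality of
  tensors, which a bilinear summand does not see.\<close>

lemma lin_sw [simp]:
  assumes "lin s (scl A) f" "module sv" "\<And>y. linV sv (\<lambda>x. F x y)" "\<And>x. linV sv (\<lambda>y. F x y)"
  shows "lin s sv (\<lambda>x. sw A (f x) F)"
proof -
  have "linV sv (\<lambda>x. sw A x F)"
    unfolding lin_def
  proof (intro conjI allI)
    show "sw A (x + y) F = sw A x F + sw A y F" for x y
      unfolding sw_def by (subst tensor_eq_sum[OF cop_add assms(3,4)]) simp
    show "sw A (scl A c x) F = sv c (sw A x F)" for c x
    proof -
      have *: "lin sv sv (sv c)"
        using assms(2) unfolding lin_def module_def by (auto simp: algebra_simps)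
      have "sw A (scl A c x) F = (\<Sum>(p, q)\<leftarrow>[(scl A c p, q). (p, q) \<leftarrow> cop A x]. F p q)"
        unfolding sw_def by (rule tensor_eq_sum[OF cop_scl assms(3,4)])
      also have "\<dots> = (\<Sum>(p, q)\<leftarrow>cop A x. sv c (F p q))"
        using lin_scale[OF assms(3)] by (simp add: sum_list_concat_map case_prod_unfold comp_def)
      finally show ?thesis using sw_out[OF *, of A x F] by (simp add: sw_def)
    qed
  qed
  from lin_comp[OF this assms(1)] show ?thesis .
qed

lemma sw_coassoc:
  assumes "\<And>y z. linV sv (\<lambda>x. F x y z)" "\<And>x z. linV sv (\<lambda>y. F x y z)" "\<And>x y. linV sv (\<lambda>z. F x y z)"
  shows "sw A a (\<lambda>w z. sw A w (\<lambda>x y. F x y z)) = sw A a (\<lambda>x w. sw A w (\<lambda>y z. F x y z))"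
proof -
  have "(\<Sum>(x, y, z)\<leftarrow>[(x, y, z). (w, z) \<leftarrow> cop A a, (x, y) \<leftarrow> cop A w]. F x y z)
     = (\<Sum>(x, y, z)\<leftarrow>cop3 A a. F x y z)"
    by (rule tensor3_eq_sum[OF coassoc assms])
  then show ?thesis
    unfolding sw_def cop3_def by (simp add: sum_list_concat_map case_prod_unfold comp_def)
qed

lemma sw3_eq: "(\<Sum>(x, y, z)\<leftarrow>cop3 A a. F x y z) = sw A a (\<lambda>x w. sw A w (\<lambda>y z. F x y z))"
  unfolding sw_def cop3_def by (simp add: sum_list_concat_map case_prod_unfold comp_def)

lemma sw_cou_left:
  assumes "linV sv f" shows "sw A a (\<lambda>x y. sv (cou A x) (f y)) = f a"
proof -
  have "f a = f (sw A a (\<lambda>x y. scl A (cou A x) y))" using cou_left by (simp add: sw_def)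
  then show ?thesis by (simp add: sw_out[OF assms] lin_scale[OF assms])
qed

lemma sw_cou_right:
  assumes "linV sv f" shows "sw A a (\<lambda>x y. sv (cou A y) (f x)) = f a"
proof -
  have "f a = f (sw A a (\<lambda>x y. scl A (cou A y) x))" using cou_right by (simp add: sw_def)
  then show ?thesis by (simp add: sw_out[OF assms] lin_scale[OF assms])
qed

lemma sw_mult:
  assumes "\<And>y. linV sv (\<lambda>x. F x y)" "\<And>x. linV sv (\<lambda>y. F x y)"
  shows "sw A (a * b) F = sw A a (\<lambda>x y. sw A b (\<lambda>x' y'. F (x * x') (y * y')))"
  unfolding sw_def 
  by (subst tensor_eq_sum[OF cop_mult assms]) (simp add: sum_list_concat_map case_prod_unfold comp_def)

lemma sw_one:
  assumes "\<And>y. linV sv (\<lambda>x. F x y)" "\<And>x. linV sv (\<lambda>y. F x y)"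
  shows "sw A 1 F = F 1 1"
  unfolding sw_def by (subst tensor_eq_sum[OF cop_one assms]) simp

lemma sw_ant_left:
  assumes "linV sv f" shows "sw A a (\<lambda>x y. f (ant A x * y)) = sv (cou A a) (f 1)"
proof -
  have "f (sw A a (\<lambda>x y. ant A x * y)) = sv (cou A a) (f 1)" 
    using ant_left lin_scale[OF assms] by (simp add: sw_def)
  then show ?thesis by (simp add: sw_out[OF assms])
qed

lemma sw_ant_right:
  assumes "linV sv f" shows "sw A a (\<lambda>x y. f (x * ant A y)) = sv (cou A a) (f 1)"
proof -
  have "f (sw A a (\<lambda>x y. x * ant A y)) = sv (cou A a) (f 1)" 
    using ant_right lin_scale[OF assms] by (simp add: sw_def)
  then show ?thesis by (simp add: sw_out[OF assms])
qed

lemmas coassoc_A = sw_coassoc[where sv="scl A"]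

lemma scl_sw: "scl A c (sw B a F) = sw B a (\<lambda>x y. scl A c (F x y))"
  by (rule sw_out[where s="scl A" and s'="scl A"]) simp

lemma mult_sw: "(c::'a) * sw B a F = sw B a (\<lambda>x y. c * F x y)"
  by (rule sw_out[where s="scl A" and s'="scl A"]) simp

lemma sw_mult_out: "sw B a F * (c::'a) = sw B a (\<lambda>x y. F x y * c)"
  by (rule sw_out[where s="scl A" and s'="scl A" and f="\<lambda>x. x * c"]) simp

lemma ant_sw: "ant A (sw B a F) = sw B a (\<lambda>x y. ant A (F x y))"
  by (rule sw_out[where s="scl A" and s'="scl A"]) (rule lin_ant0)

lemma scl_comm: "scl A c (scl A d v) = scl A d (scl A c v)"
  by (simp add: mult.commute)

lemma ant_scl: "ant A (scl A c x) = scl A c (ant A x)"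
  using lin_scale[OF lin_ant0] .

text \<open>Both sides are convolution inverses of the multiplication map on \<open>A \<otimes> A\<close>:
  collapse \<open>S(a\<^sub>1 b\<^sub>1) a\<^sub>2 b\<^sub>2 S(b\<^sub>3) S(a\<^sub>3)\<close>
  from the right and from the left.\<close>

lemma ant_mult: "ant A (a * b) = ant A b * ant A a"
proof -
  let ?S = "ant A"
  define E where "E = sw A a (\<lambda>x t. sw A t (\<lambda>y z. sw A b (\<lambda>x' t'. sw A t' (\<lambda>y' z'. ?S (x * x') * (y * (y' * ?S z')) * ?S z))))"
  have "E = sw A a (\<lambda>x t. sw A t (\<lambda>y z. sw A b (\<lambda>x' t'. scl A (cou A t') (?S (x * x') * (y * 1) * ?S z))))"
    unfolding E_def by (subst sw_ant_right[where sv="scl A" and f="\<lambda>v. ?S (_ * _) * (_ * v) * ?S _"]) simp_all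
  also have "\<dots> = sw A a (\<lambda>x t. sw A t (\<lambda>y z. ?S (x * b) * (y * ?S z)))"
    by (subst sw_cou_right[where sv="scl A"]) (simp_all add: mult.assoc)
  also have "\<dots> = sw A a (\<lambda>x t. scl A (cou A t) (?S (x * b) * 1))"
    by (subst sw_ant_right[where sv="scl A"]) simp_all
  also have "\<dots> = ?S (a * b)"
    by (subst sw_cou_right[where sv="scl A"]) simp_all
  finally have 1: "E = ?S (a * b)" .
  have "E = sw A a (\<lambda>w z. sw A w (\<lambda>x y. sw A b (\<lambda>w' z'. sw A w' (\<lambda>x' y'. ?S (x * x') * (y * y') * ?S z' * ?S z))))"
    unfolding E_def by (simp add: coassoc_A mult.assoc)
  also have "\<dots> = sw A a (\<lambda>w z. sw A b (\<lambda>w' z'. sw A w (\<lambda>x y. sw A w' (\<lambda>x' y'. ?S (x * x') * (y * y') * ?S z' * ?S z))))"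
    by (subst sw_swap) simp
  also have "\<dots> = sw A a (\<lambda>w z. sw A b (\<lambda>w' z'. sw A (w * w') (\<lambda>x y. ?S x * y * ?S z' * ?S z)))"
    by (subst sw_mult[where sv="scl A"]) simp_all
  also have "\<dots> = sw A a (\<lambda>w z. sw A b (\<lambda>w' z'. scl A (cou A w) (scl A (cou A w') (?S z' * ?S z))))"
    by (subst sw_ant_left[where sv="scl A"]) (simp_all add: cou_mult)
  also have "\<dots> = sw A a (\<lambda>w z. scl A (cou A w) (?S b * ?S z))"
    by (subst scl_comm, subst sw_cou_left[where sv="scl A"]) simp_all
  also have "\<dots> = ?S b * ?S a"
    by (subst sw_cou_left[where sv="scl A"]) simp_all
  finally show ?thesis using 1 by simp
qed

lemma ant_one: "ant A 1 = 1"
  using sw_ant_left[OF lin_id, where a=1] 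
  by (subst (asm) sw_one[where sv="scl A"]) (simp_all add: cou_one)

text \<open>Multiply the coproduct of \<open>S(a\<^sub>1)\<close> by \<open>a\<^sub>2 S(a\<^sub>5) \<otimes>
  a\<^sub>3 S(a\<^sub>4)\<close>, which is trivial, and collapse \<open>S(a\<^sub>1)
  a\<^sub>2\<close> first.\<close>

lemma ant_comult:
  assumes [simp]: "\<And>y. linV (scl A) (\<lambda>x. F x y)" "\<And>x. linV (scl A) (F x)"
  shows "sw A (ant A a) F = sw A a (\<lambda>x y. F (ant A y) (ant A x))"
proof -
  let ?S = "ant A"
  have [simp]: "lin s (scl A) f \<Longrightarrow> lin s (scl A) (\<lambda>x. F (f x) y)" 
    "lin s (scl A) f \<Longrightarrow> lin s (scl A) (\<lambda>x. F y (f x))" for s f y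
    using lin_comp[of "scl A" "scl A" "\<lambda>x. F x y" s f] lin_comp[of "scl A" "scl A" "F y" s f] by auto
  have e1: "sw A t (\<lambda>y z. sw A z (\<lambda>z1 z2. sw A z1 (\<lambda>c d. F (p * (y * ?S z2)) (q * (c * ?S d)))))
    = scl A (cou A t) (F p q)" for t p q
  proof -
    have "sw A t (\<lambda>y z. sw A z (\<lambda>z1 z2. sw A z1 (\<lambda>c d. F (p * (y * ?S z2)) (q * (c * ?S d)))))
      = sw A t (\<lambda>y z. sw A z (\<lambda>z1 z2. scl A (cou A z1) (F (p * (y * ?S z2)) (q * 1))))"
      by (subst sw_ant_right[where sv="scl A"]) simp_all
    also have "\<dots> = sw A t (\<lambda>y z. F (p * (y * ?S z)) q)"
      by (subst sw_cou_left[where sv="scl A"]) simp_all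
    also have "\<dots> = scl A (cou A t) (F p q)"
      by (subst sw_ant_right[where sv="scl A"]) simp_all
    finally show ?thesis .
  qed
  have "sw A (?S a) F = sw A a (\<lambda>x t. scl A (cou A t) (sw A (?S x) F))"
    by (subst sw_cou_right[where sv="scl A"]) simp_all
  also have "\<dots> = sw A a (\<lambda>x t. sw A (?S x) (\<lambda>p q. sw A t (\<lambda>y z. sw A z (\<lambda>z1 z2. sw A z1 (\<lambda>c d. F (p * (y * ?S z2)) (q * (c * ?S d)))))))"
    by (simp add: e1 scl_sw)
  also have "\<dots> = sw A a (\<lambda>x t. sw A t (\<lambda>y z. sw A (?S x) (\<lambda>p q. sw A z (\<lambda>z1 z2. sw A z1 (\<lambda>c d. F (p * y * ?S z2) (q * c * ?S d))))))"
    by (simp only: sw_swap[where a="ant A u" for u] mult.assoc)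
  also have "\<dots> = sw A a (\<lambda>x t. sw A t (\<lambda>y z. sw A (?S x) (\<lambda>p q. sw A z (\<lambda>c z1. sw A z1 (\<lambda>d z2. F (p * y * ?S z2) (q * c * ?S d))))))"
    by (simp add: coassoc_A)
  also have "\<dots> = sw A a (\<lambda>x t. sw A t (\<lambda>y z. sw A z (\<lambda>c z1. sw A (?S x) (\<lambda>p q. sw A z1 (\<lambda>d z2. F (p * y * ?S z2) (q * c * ?S d))))))"
    by (simp only: sw_swap[where a="ant A u" for u])
  also have "\<dots> = sw A a (\<lambda>x t. sw A t (\<lambda>y z. sw A y (\<lambda>y c. sw A (?S x) (\<lambda>p q. sw A z (\<lambda>d z2. F (p * y * ?S z2) (q * c * ?S d))))))"
    by (subst coassoc_A[symmetric]) simp_all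
  also have "\<dots> = sw A a (\<lambda>x t. sw A t (\<lambda>y z. sw A (?S x) (\<lambda>p q. sw A y (\<lambda>y c. sw A z (\<lambda>d z2. F (p * y * ?S z2) (q * c * ?S d))))))"
    by (simp only: sw_swap[where a="ant A u" for u])
  also have "\<dots> = sw A a (\<lambda>x t. sw A t (\<lambda>y z. sw A (?S x * y) (\<lambda>p q. sw A z (\<lambda>d z2. F (p * ?S z2) (q * ?S d)))))"
    by (subst sw_mult[where sv="scl A"]) simp_all
  also have "\<dots> = sw A a (\<lambda>x t. sw A x (\<lambda>x y. sw A (?S x * y) (\<lambda>p q. sw A t (\<lambda>d z2. F (p * ?S z2) (q * ?S d)))))"
    by (subst coassoc_A) simp_all
  also have "\<dots> = sw A a (\<lambda>x t. scl A (cou A x) (sw A 1 (\<lambda>p q. sw A t (\<lambda>d z2. F (p * ?S z2) (q * ?S d)))))"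
    by (subst sw_ant_left[where sv="scl A"]) simp_all
  also have "\<dots> = sw A 1 (\<lambda>p q. sw A a (\<lambda>d z2. F (p * ?S z2) (q * ?S d)))"
    by (subst sw_cou_left[where sv="scl A"]) simp_all
  also have "\<dots> = sw A a (\<lambda>d z2. F (?S z2) (?S d))"
    by (subst sw_one[where sv="scl A"]) simp_all
  finally show ?thesis .
qed

lemma cou_ant: "cou A (ant A a) = cou A a"
proof -
  have "cou A a = sw A a (\<lambda>x y. cou A (ant A x * y))"
    by (subst sw_ant_left[where sv="(*)"]) (simp_all add: cou_one)
  also have "\<dots> = sw A a (\<lambda>x y. cou A y * cou A (ant A x))"
    by (simp add: cou_mult mult.commute)
  also have "\<dots> = cou A (ant A a)"
    by (subst sw_cou_right[where sv="(*)"]) simp_all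
  finally show ?thesis by simp
qed

text \<open>Sweedler sum \<open>F(a\<^sub>1, b\<^sub>1, a\<^sub>2, b\<^sub>2)\<close> of the coalgebra
  \<open>A \<otimes> A\<close>, in which bilinear forms on \<open>A\<close> multiply by
  convolution.\<close>

definition sw2 :: "'a \<Rightarrow> 'a \<Rightarrow> ('a \<Rightarrow> 'a \<Rightarrow> 'a \<Rightarrow> 'a \<Rightarrow> 'v::ab_group_add) \<Rightarrow> 'v" where
  "sw2 a b F = sw A a (\<lambda>x y. sw A b (\<lambda>x' y'. F x x' y y'))"

lemma lin_sw2_right [simp]:
  "module s' \<Longrightarrow> (\<And>p q r t. lin s s' (\<lambda>x. F x p q r t)) \<Longrightarrow> lin s s' (\<lambda>x. sw2 a b (\<lambda>p q r t. F x p q r t))"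
  by (simp add: sw2_def)

lemma lin_sw2_1 [simp]:
  "lin s (scl A) f \<Longrightarrow> module s' \<Longrightarrow> (\<And>q r t. linV s' (\<lambda>p. F p q r t)) \<Longrightarrow> 
     (\<And>p q t. linV s' (\<lambda>r. F p q r t)) \<Longrightarrow> lin s s' (\<lambda>x. sw2 (f x) b F)"
  unfolding sw2_def by simp

lemma lin_sw2_2 [simp]:
  "lin s (scl A) f \<Longrightarrow> module s' \<Longrightarrow> (\<And>p r t. linV s' (\<lambda>q. F p q r t)) \<Longrightarrow> 
     (\<And>p q r. linV s' (\<lambda>t. F p q r t)) \<Longrightarrow> lin s s' (\<lambda>x. sw2 b (f x) F)"
  unfolding sw2_def by simp

lemma sw2_coassoc:
  assumes [simp]: "\<And>x' y y' z z'. linV (scl A) (\<lambda>x. F x x' y y' z z')"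
    "\<And>x y y' z z'. linV (scl A) (\<lambda>x'. F x x' y y' z z')"
    "\<And>x x' y' z z'. linV (scl A) (\<lambda>y. F x x' y y' z z')"
    "\<And>x x' y z z'. linV (scl A) (\<lambda>y'. F x x' y y' z z')"
    "\<And>x x' y y' z'. linV (scl A) (\<lambda>z. F x x' y y' z z')"
    "\<And>x x' y y' z. linV (scl A) (\<lambda>z'. F x x' y y' z z')"
  shows "sw2 a b (\<lambda>w w' z z'. sw2 w w' (\<lambda>x x' y y'. F x x' y y' z z')) 
       = sw2 a b (\<lambda>x x' t t'. sw2 t t' (\<lambda>y y' z z'. F x x' y y' z z'))"
proof -
  have "sw2 a b (\<lambda>w w' z z'. sw2 w w' (\<lambda>x x' y y'. F x x' y y' z z'))
     = sw A a (\<lambda>w z. sw A w (\<lambda>x y. sw A b (\<lambda>w' z'. sw A w' (\<lambda>x' y'. F x x' y y' z z'))))"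
    unfolding sw2_def by (subst (2) sw_swap) simp
  also have "\<dots> = sw A a (\<lambda>x t. sw A t (\<lambda>y z. sw A b (\<lambda>x' t'. sw A t' (\<lambda>y' z'. F x x' y y' z z'))))"
    by (simp add: coassoc_A)
  also have "\<dots> = sw2 a b (\<lambda>x x' t t'. sw2 t t' (\<lambda>y y' z z'. F x x' y y' z z'))"
    unfolding sw2_def by (subst (2) sw_swap) simp
  finally show ?thesis .
qed

lemma scl_sw2: "scl A c (sw2 a b F) = sw2 a b (\<lambda>x x' y y'. scl A c (F x x' y y'))"
  by (simp add: sw2_def scl_sw)

lemma sw2_cou_left:
  assumes [simp]: "\<And>y. linV (scl A) (\<lambda>x. F x y)" "\<And>x. linV (scl A) (F x)"
  shows "sw2 a b (\<lambda>x x' y y'. scl A (cou A x) (scl A (cou A x') (F y y'))) = F a b"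
  unfolding sw2_def
  by (subst scl_comm, subst sw_cou_left[where sv="scl A"], simp, subst sw_cou_left[where sv="scl A"]) simp_all

lemma sw2_cou_right:
  assumes [simp]: "\<And>y. linV (scl A) (\<lambda>x. F x y)" "\<And>x. linV (scl A) (F x)"
  shows "sw2 a b (\<lambda>x x' y y'. scl A (cou A y) (scl A (cou A y') (F x x'))) = F a b"
  unfolding sw2_def
  by (subst scl_comm, subst sw_cou_right[where sv="scl A"], simp, subst sw_cou_right[where sv="scl A"]) simp_all

end

section \<open>Cotriangular structures\<close>

locale cotriangular_hopf = hopf_algebra A for A :: "('k::comm_ring_1, 'a::ring_1) hopf" +
  fixes R Rbar :: "'a \<Rightarrow> 'a \<Rightarrow> 'k"
  assumes cotri: "cotriangular A R Rbar"
begin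

abbreviation scale_A (infixr "**" 69) where "c ** v \<equiv> scl A c v"

abbreviation "linA \<equiv> lin (scl A) (scl A)"

abbreviation "linK \<equiv> lin (scl A) (*)"

text \<open>Scalars stay iterated, as in \<open>r ** s ** v\<close>: a hexagon identity then rewrites a
  single scalar into a Sweedler sum, whatever stands to the right of it.\<close>

declare scale_scale [simp del]

lemma
  shows bilinear_R: "bilinear_form A R"
    and conv_R_Rbar: "conv A R Rbar a b = cou A a * cou A b"
    and conv_Rbar_R: "conv A Rbar R a b = cou A a * cou A b"
    and braided_commutativity: "b * a = (\<Sum>(x, y, z)\<leftarrow>cop3 A a. \<Sum>(x', y', z')\<leftarrow>cop3 A b. (R x x' * Rbar z z') ** y * y')"
    and hexagon_left: "R (a * b) c = (\<Sum>(x, y)\<leftarrow>cop A c. R a x * R b y)"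
    and hexagon_right: "R a (b * c) = (\<Sum>(x, y)\<leftarrow>cop A a. R x c * R y b)"
    and Rbar_flip: "Rbar a b = R b a"
  using cotri unfolding cotriangular_def conv_inverse_def by blast+

lemma lin_R0: "linK (R a)" "linK (\<lambda>a. R a b)"
  using bilinear_R by (simp_all add: bilinear_form_def lin_iff_module_hom)

lemma lin_R [simp]:
  "lin s (scl A) f \<Longrightarrow> lin s (*) (\<lambda>x. R c (f x))"
  "lin s (scl A) f \<Longrightarrow> lin s (*) (\<lambda>x. R (f x) c)"
  by (erule lin_comp[OF lin_R0(1)], erule lin_comp[OF lin_R0(2)])

lemma lin_Rbar [simp]:
  "lin s (scl A) f \<Longrightarrow> lin s (*) (\<lambda>x. Rbar c (f x))"
  "lin s (scl A) f \<Longrightarrow> lin s (*) (\<lambda>x. Rbar (f x) c)"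
  by (simp_all add: Rbar_flip)

lemma conv_sw: "conv A F G a b = sw A a (\<lambda>x y. sw A b (\<lambda>x' y'. F x x' * G y y'))"
  by (simp add: conv_def sw_def)

lemma scl_sum_sw: "sw A a F ** v = sw A a (\<lambda>x y. F x y ** v)"
  by (rule sw_out[where s="(*)" and s'="scl A" and f="\<lambda>x. x ** v"]) simp

lemma R_Rbar: "sw2 a b (\<lambda>x x' y y'. R x x' ** Rbar y y' ** v) = cou A a ** cou A b ** v"
  and Rbar_R: "sw2 a b (\<lambda>x x' y y'. Rbar x x' ** R y y' ** v) = cou A a ** cou A b ** v"
proof -
  have "conv A R Rbar a b ** v = (cou A a * cou A b) ** v"
    "conv A Rbar R a b ** v = (cou A a * cou A b) ** v"
    by (simp_all only: conv_R_Rbar conv_Rbar_R)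
  then show "sw2 a b (\<lambda>x x' y y'. R x x' ** Rbar y y' ** v) = cou A a ** cou A b ** v"
    "sw2 a b (\<lambda>x x' y y'. Rbar x x' ** R y y' ** v) = cou A a ** cou A b ** v"
    by (simp_all add: conv_sw scl_sum_sw sw2_def scale_scale[symmetric])
qed

lemma R_mult_left: "R (a * b) c ** v = sw A c (\<lambda>x y. R a x ** R b y ** v)"
proof -
  have "R (a * b) c = sw A c (\<lambda>x y. R a x * R b y)"
    using hexagon_left by (simp add: sw_def)
  then show ?thesis by (simp add: scl_sum_sw scale_scale[symmetric])
qed

lemma R_mult_right: "R a (b * c) ** v = sw A a (\<lambda>x y. R x c ** R y b ** v)"
proof -
  have "R a (b * c) = sw A a (\<lambda>x y. R x c * R y b)"
    using hexagon_right by (simp add: sw_def)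
  then show ?thesis by (simp add: scl_sum_sw scale_scale[symmetric])
qed

lemma Rbar_mult_left: "Rbar (a * b) c ** v = sw A c (\<lambda>x y. Rbar b x ** Rbar a y ** v)"
  by (simp add: Rbar_flip R_mult_right)

lemma Rbar_mult_right: "Rbar a (b * c) ** v = sw A a (\<lambda>x y. Rbar x b ** Rbar y c ** v)"
  by (simp add: Rbar_flip R_mult_left)

lemma mult_axiom:
  "b * a = sw2 a b (\<lambda>x x' t t'. sw2 t t' (\<lambda>y y' z z'. R x x' ** Rbar z z' ** y * y'))"
proof -
  have "b * a = sw A a (\<lambda>x t. sw A t (\<lambda>y z. sw A b (\<lambda>x' t'. sw A t' (\<lambda>y' z'. R x x' ** Rbar z z' ** y * y'))))"
    unfolding sw3_eq[symmetric] unfolding scale_scale by (rule braided_commutativity)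
  also have "\<dots> = sw2 a b (\<lambda>x x' t t'. sw2 t t' (\<lambda>y y' z z'. R x x' ** Rbar z z' ** y * y'))"
    unfolding sw2_def by (subst (2) sw_swap) simp
  finally show ?thesis .
qed

lemma R_Rbar_cancel:
  assumes [simp]: "\<And>y. linA (\<lambda>x. F x y)" "\<And>x. linA (F x)"
  shows "sw2 a b (\<lambda>x x' t t'. sw2 t t' (\<lambda>y y' z z'. R x x' ** Rbar y y' ** F z z')) = F a b"
    and "sw2 a b (\<lambda>x x' t t'. sw2 t t' (\<lambda>y y' z z'. Rbar x x' ** R y y' ** F z z')) = F a b"
    and "sw2 a b (\<lambda>x x' t t'. sw2 t t' (\<lambda>y y' z z'. Rbar y y' ** R z z' ** F x x')) = F a b"
    and "sw2 a b (\<lambda>x x' t t'. sw2 t t' (\<lambda>y y' z z'. R y y' ** Rbar z z' ** F x x')) = F a b"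
proof -
  show "sw2 a b (\<lambda>x x' t t'. sw2 t t' (\<lambda>y y' z z'. R x x' ** Rbar y y' ** F z z')) = F a b"
    by (subst sw2_coassoc[symmetric]) (simp_all add: R_Rbar sw2_cou_left)
  show "sw2 a b (\<lambda>x x' t t'. sw2 t t' (\<lambda>y y' z z'. Rbar x x' ** R y y' ** F z z')) = F a b"
    by (subst sw2_coassoc[symmetric]) (simp_all add: Rbar_R sw2_cou_left)
  show "sw2 a b (\<lambda>x x' t t'. sw2 t t' (\<lambda>y y' z z'. Rbar y y' ** R z z' ** F x x')) = F a b"
    by (simp add: Rbar_R sw2_cou_right)
  show "sw2 a b (\<lambda>x x' t t'. sw2 t t' (\<lambda>y y' z z'. R y y' ** Rbar z z' ** F x x')) = F a b"
    by (simp add: R_Rbar sw2_cou_right)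
qed

text \<open>Insert braided commutativity for \<open>b\<^sub>1 a\<^sub>1\<close> and cancel
  \<open>Rbar\<close> against the remaining \<open>R\<close>.\<close>

lemma R_comm:
  assumes [simp]: "linA f"
  shows "sw2 a b (\<lambda>x x' y y'. R x x' ** f (y * y')) = sw2 a b (\<lambda>x x' y y'. R y y' ** f (x' * x))"
proof -
  have [simp]: "lin s (scl A) g \<Longrightarrow> lin s (scl A) (\<lambda>x. f (g x))" for s g
    by (rule lin_comp[OF assms])
  have fsw: "f (sw2 a b F) = sw2 a b (\<lambda>x x' y y'. f (F x x' y y'))" for a b F
    unfolding sw2_def by (simp add: sw_out[OF assms])
  have fs: "f (c ** x) = c ** f x" for c x by (rule lin_scale[OF assms])
  have "sw2 a b (\<lambda>x x' y y'. R y y' ** f (x' * x))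
     = sw2 a b (\<lambda>w w' u u'. sw2 w w' (\<lambda>x x' t t'. sw2 t t' (\<lambda>y y' z z'. 
         R u u' ** R x x' ** Rbar z z' ** f (y * y'))))"
    by (subst mult_axiom) (simp add: fsw fs scl_sw2)
  also have "\<dots> = sw2 a b (\<lambda>x x' w w'. sw2 w w' (\<lambda>t t' u u'. sw2 t t' (\<lambda>y y' z z'. 
         R u u' ** R x x' ** Rbar z z' ** f (y * y'))))"
    by (subst sw2_coassoc) simp_all
  also have "\<dots> = sw2 a b (\<lambda>x x' w w'. sw2 w w' (\<lambda>y y' t t'. sw2 t t' (\<lambda>z z' u u'. 
         R u u' ** R x x' ** Rbar z z' ** f (y * y'))))"
    by (subst sw2_coassoc) simp_all
  also have "\<dots> = sw2 a b (\<lambda>x x' w w'. R x x' ** sw2 w w' (\<lambda>y y' t t'. sw2 t t' (\<lambda>z z' u u'. 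
         Rbar z z' ** R u u' ** f (y * y'))))"
    by (simp add: scl_sw2 scl_comm)
  also have "\<dots> = sw2 a b (\<lambda>x x' w w'. R x x' ** f (w * w'))"
    by (subst R_Rbar_cancel(3)) simp_all
  finally show ?thesis by simp
qed

lemma sw2_flip: "sw2 a b F = sw2 b a (\<lambda>x' x y' y. F x x' y y')"
  unfolding sw2_def by (rule sw_swap)

lemma Rbar_comm:
  assumes [simp]: "linA f"
  shows "sw2 a b (\<lambda>x x' y y'. Rbar x x' ** f (y' * y)) = sw2 a b (\<lambda>x x' y y'. Rbar y y' ** f (x * x'))"
  unfolding Rbar_flip using R_comm[OF assms, of b a] by (subst (1 2) sw2_flip) simp

lemma scl_one_inj: "c ** 1 = d ** 1 \<Longrightarrow> c = d"
  by (metis lin_scale[OF lin_cou0] cou_one mult.right_neutral)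

text \<open>By the hexagon identity \<open>R(1, -)\<close> is idempotent for convolution, and it is
  invertible.\<close>

lemma R_one_left: "R 1 c = cou A c"
proof (rule scl_one_inj)
  have e: "sw A b (\<lambda>x y. R 1 x ** Rbar 1 y ** v) = cou A b ** v" for b v
    using R_Rbar[of 1 b v] unfolding sw2_def
    by (subst (asm) sw_one[where sv="scl A"]) (simp_all add: cou_one)
  have "cou A c ** 1 = sw A c (\<lambda>x y. R (1 * 1) x ** Rbar 1 y ** 1)"
    by (simp add: e[symmetric])
  also have "\<dots> = sw A c (\<lambda>x y. sw A x (\<lambda>x1 x2. R 1 x1 ** R 1 x2 ** Rbar 1 y ** 1))"
    by (simp only: R_mult_left)
  also have "\<dots> = sw A c (\<lambda>x y. R 1 x ** sw A y (\<lambda>x1 x2. R 1 x1 ** Rbar 1 x2 ** 1))"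
    by (subst coassoc_A) (simp_all add: scl_sw)
  also have "\<dots> = sw A c (\<lambda>x y. cou A y ** R 1 x ** 1)"
    by (simp only: e) (simp add: scl_comm)
  also have "\<dots> = R 1 c ** 1" 
    by (subst sw_cou_right[where sv="scl A"]) simp_all
  finally show "R 1 c ** 1 = cou A c ** 1" by simp
qed

text \<open>Both sides are convolution inverses of \<open>R\<close>: collapse \<open>R(S x\<^sub>1,
  y\<^sub>1) R(x\<^sub>2, y\<^sub>2) Rbar(x\<^sub>3, y\<^sub>3)\<close> in two ways.\<close>

lemma R_ant_left: "R (ant A x) y = Rbar x y"
proof (rule scl_one_inj)
  let ?S = "ant A"
  define E where "E = sw A x (\<lambda>p t. sw2 t y (\<lambda>u u' t t'. sw2 t t' (\<lambda>v v' w w'. 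
     R (?S p) u' ** R u v' ** Rbar v w' ** cou A w ** 1)))"
  have "E = sw A x (\<lambda>p t. sw A t (\<lambda>u t. sw A t (\<lambda>v w. cou A w ** sw A y (\<lambda>u' t'. sw A t' (\<lambda>v' w'. 
     R (?S p) u' ** R u v' ** Rbar v w' ** 1)))))"
    unfolding E_def sw2_def by (simp add: scl_sw scl_comm sw_swap[where a=y])
  also have "\<dots> = sw A x (\<lambda>p t. sw A t (\<lambda>u v. sw A y (\<lambda>u' t'. sw A t' (\<lambda>v' w'. 
     R (?S p) u' ** R u v' ** Rbar v w' ** 1))))"
    by (subst sw_cou_right[where sv="scl A"]) simp_all
  finally have E1: "E = sw A x (\<lambda>p t. sw A t (\<lambda>u v. sw A y (\<lambda>u' t'. sw A t' (\<lambda>v' w'. 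
     R (?S p) u' ** R u v' ** Rbar v w' ** 1))))" .
  have "E = sw A x (\<lambda>t v. sw A t (\<lambda>p u. sw A y (\<lambda>t' w'. sw A t' (\<lambda>u' v'. 
     R (?S p) u' ** R u v' ** Rbar v w' ** 1))))"
    by (simp add: E1 coassoc_A)
  also have "\<dots> = sw A x (\<lambda>t v. sw A y (\<lambda>t' w'. sw A t (\<lambda>p u. 
      R (?S p * u) t' ** Rbar v w' ** 1)))"
    by (subst (2) sw_swap) (simp add: R_mult_left)
  also have "\<dots> = sw A x (\<lambda>t v. sw A y (\<lambda>t' w'. cou A t ** R 1 t' ** Rbar v w' ** 1))"
    by (subst sw_ant_left[where sv="scl A" and f="\<lambda>z. R z _ ** Rbar _ _ ** 1"]) simp_all
  also have "\<dots> = sw2 x y (\<lambda>t t' v w'. cou A t ** cou A t' ** Rbar v w' ** 1)"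
    by (simp add: R_one_left sw2_def)
  also have "\<dots> = Rbar x y ** 1"
    by (subst sw2_cou_left) simp_all
  finally have E2: "E = Rbar x y ** 1" .
  have "E = sw A x (\<lambda>p t. sw A y (\<lambda>u' t'. R (?S p) u' ** sw2 t t' (\<lambda>u v' v w'. 
     R u v' ** Rbar v w' ** 1)))"
    unfolding E1 sw2_def by (simp add: scl_sw sw_swap[where a=y])
  also have "\<dots> = sw2 x y (\<lambda>p u' t t'. cou A t ** cou A t' ** R (?S p) u' ** 1)"
    by (simp add: R_Rbar sw2_def scl_comm)
  also have "\<dots> = R (?S x) y ** 1"
    by (subst sw2_cou_right) simp_all
  finally show "R (?S x) y ** 1 = Rbar x y ** 1" using E2 by simp
qed

lemma R_one_right: "R c 1 = cou A c"
  using R_ant_left[of 1 c] by (simp add: ant_one R_one_left Rbar_flip)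

text \<open>With \<open>w(a) = R(a\<^sub>1, S a\<^sub>2)\<close> this is \<open>a\<^sub>1 w(a\<^sub>2) =
  w(a\<^sub>1) S\<^sup>2(a\<^sub>2)\<close>: the square of the antipode is conjugation by
  \<open>w\<close>. The commutation rule \<open>R_comm\<close> for the arguments
  \<open>a\<^sub>1\<close> and \<open>S a\<^sub>2\<close> gives \<open>S(a\<^sub>4) a\<^sub>1
  R(a\<^sub>2, S a\<^sub>3) = w(a)\<close>, and multiplying by \<open>S\<^sup>2\<close> from the
  left removes \<open>S(a\<^sub>4)\<close>.\<close>

lemma ant_square_twist:
  assumes "linA f"
  shows "sw A a (\<lambda>b t. sw A t (\<lambda>x y. R x (ant A y) ** f b))
    = sw A a (\<lambda>t b. sw A t (\<lambda>x y. R x (ant A y) ** f (ant A (ant A b))))"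
proof -
  note [simp] = lin_comp[OF assms]
  let ?S = "ant A"
  \<comment> \<open>\<open>S(a\<^sub>4) a\<^sub>1 R(a\<^sub>2, S a\<^sub>3) = w(a)\<close>\<close>
  have 1: "sw A a (\<lambda>x t. sw A t (\<lambda>x2 t. sw A t (\<lambda>y1 y2. R x2 (?S y1) ** ?S y2 * x)))
     = sw A a (\<lambda>x y. R x (?S y) ** 1)" for a
  proof -
    have "sw A a (\<lambda>x y. sw2 x (?S y) (\<lambda>x1 p x2 q. R x1 p ** x2 * q))
      = sw A a (\<lambda>x y. sw2 x (?S y) (\<lambda>x1 p x2 q. R x2 q ** p * x1))"
      by (subst R_comm) simp_all
    then have "sw A a (\<lambda>x y. sw A x (\<lambda>x1 x2. sw A y (\<lambda>y1 y2. R x1 (?S y2) ** x2 * ?S y1)))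
      = sw A a (\<lambda>x y. sw A x (\<lambda>x1 x2. sw A y (\<lambda>y1 y2. R x2 (?S y1) ** ?S y2 * x1)))"
      unfolding sw2_def by (simp add: ant_comult)
    then have "sw A a (\<lambda>x1 t. sw A t (\<lambda>x2 y. sw A y (\<lambda>y1 y2. R x1 (?S y2) ** x2 * ?S y1)))
      = sw A a (\<lambda>x1 t. sw A t (\<lambda>x2 y. sw A y (\<lambda>y1 y2. R x2 (?S y1) ** ?S y2 * x1)))"
      by (simp add: coassoc_A)
    moreover have "sw A a (\<lambda>x1 t. sw A t (\<lambda>x2 y. sw A y (\<lambda>y1 y2. R x1 (?S y2) ** x2 * ?S y1)))
      = sw A a (\<lambda>x1 t. sw A t (\<lambda>w y2. sw A w (\<lambda>x2 y1. R x1 (?S y2) ** x2 * ?S y1)))"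
      by (simp add: coassoc_A)
    moreover have "\<dots> = sw A a (\<lambda>x1 t. sw A t (\<lambda>w y2. cou A w ** R x1 (?S y2) ** 1))"
      by (subst sw_ant_right[where sv="scl A" and f="\<lambda>z. R _ (?S _) ** z"]) simp_all
    moreover have "\<dots> = sw A a (\<lambda>x1 y2. R x1 (?S y2) ** 1)"
      by (subst sw_cou_left[where sv="scl A"]) simp_all
    ultimately show ?thesis by simp
  qed
  have "sw A a (\<lambda>t b. sw A t (\<lambda>x y. R x (?S y) ** ?S (?S b)))
     = sw A a (\<lambda>t b. ?S (?S b) * sw A t (\<lambda>x y. R x (?S y) ** 1))"
    by (simp add: mult_sw scl_mult_right)
  also have "\<dots> = sw A a (\<lambda>t b. sw A t (\<lambda>x t. sw A t (\<lambda>x2 t. sw A t (\<lambda>y1 y2. R x2 (?S y1) ** ?S (?S b) * ?S y2 * x))))"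
    by (simp add: 1[symmetric] mult_sw scl_mult_right mult.assoc)
  also have "\<dots> = sw A a (\<lambda>x t. sw A t (\<lambda>x2 t. sw A t (\<lambda>y1 t. sw A t (\<lambda>y2 b. R x2 (?S y1) ** ?S (y2 * ?S b) * x))))"
    by (simp add: coassoc_A ant_mult)
  also have "\<dots> = sw A a (\<lambda>x t. sw A t (\<lambda>x2 t. sw A t (\<lambda>y1 t. cou A t ** R x2 (?S y1) ** x)))"
    by (subst sw_ant_right[where sv="scl A" and f="\<lambda>z. R _ (?S _) ** ?S z * _"]) (simp_all add: ant_one)
  also have "\<dots> = sw A a (\<lambda>x t. sw A t (\<lambda>x2 y1. R x2 (?S y1) ** x))"
    by (subst sw_cou_right[where sv="scl A"]) simp_all
  finally have "f (sw A a (\<lambda>t b. sw A t (\<lambda>x y. R x (?S y) ** ?S (?S b))))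
     = f (sw A a (\<lambda>x t. sw A t (\<lambda>x2 y1. R x2 (?S y1) ** x)))" by simp
  then show ?thesis by (simp add: sw_out[OF assms] lin_scale[OF assms])
qed

text \<open>Since \<open>w\<close> has the convolution inverse \<open>a \<mapsto> R(S a\<^sub>2, S\<^sup>2
  a\<^sub>1)\<close> on its right, \<open>ant_square_twist\<close> writes every element as a value
  of \<open>S\<^sup>2\<close>.\<close>

lemma surj_ant: "surj (ant A)"
proof -
  let ?S = "ant A"
  \<comment> \<open>\<open>w(t\<^sub>1) R(S t\<^sub>3, S\<^sup>2 t\<^sub>2) = \<epsilon>(t)\<close>\<close>
  have wu: "sw A t (\<lambda>s c. sw A s (\<lambda>x y. sw A c (\<lambda>c1 c2. R x (?S y) ** R (?S c2) (?S (?S c1)) ** v)))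
     = cou A t ** v" for t v
  proof -
    have "sw A t (\<lambda>s c. sw A s (\<lambda>x y. sw A c (\<lambda>c1 c2. R x (?S y) ** R (?S c2) (?S (?S c1)) ** v)))
      = sw A t (\<lambda>s c. sw A c (\<lambda>c1 c2. sw A s (\<lambda>x y. R x (?S y) ** R (?S c2) (?S (?S c1)) ** v)))"
      by (subst (2) sw_swap) simp
    also have "\<dots> = sw A t (\<lambda>q c2. sw A q (\<lambda>s c1. sw A s (\<lambda>x y. R x (?S y) ** R (?S c2) (?S (?S c1)) ** v)))"
      by (subst coassoc_A) simp_all
    also have "\<dots> = sw A t (\<lambda>q c2. sw A q (\<lambda>b s. sw A s (\<lambda>x y. R x (?S y) ** R (?S c2) b ** v)))"
      by (subst ant_square_twist[symmetric]) simp_all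
    also have "\<dots> = sw A t (\<lambda>b t. sw A t (\<lambda>x t. sw A t (\<lambda>y c2. R b c2 ** R x (?S y) ** v)))"
      by (simp add: coassoc_A R_ant_left Rbar_flip scl_comm)
    also have "\<dots> = sw A t (\<lambda>e t. sw A e (\<lambda>b x. sw A t (\<lambda>y c2. R b c2 ** R x (?S y) ** v)))"
      by (subst coassoc_A) simp_all
    also have "\<dots> = sw A t (\<lambda>e t. sw A t (\<lambda>y c2. sw A e (\<lambda>b x. R b c2 ** R x (?S y) ** v)))"
      by (subst (2) sw_swap) simp
    also have "\<dots> = sw A t (\<lambda>e t. sw A t (\<lambda>y c2. R e (?S y * c2) ** v))"
      by (simp only: R_mult_right)
    also have "\<dots> = sw A t (\<lambda>e t. cou A t ** R e 1 ** v)"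
      by (subst sw_ant_left[where sv="scl A" and f="\<lambda>z. R _ z ** v"]) simp_all
    also have "\<dots> = cou A t ** v"
      by (subst sw_cou_right[where sv="scl A"]) (simp_all add: R_one_right)
    finally show ?thesis .
  qed
  have "\<exists>x. a = ?S x" for a
  proof
    have "?S (?S (sw A a (\<lambda>t c. sw A t (\<lambda>s b. sw A s (\<lambda>x y. sw A c (\<lambda>c1 c2. 
        R x (?S y) ** R (?S c2) (?S (?S c1)) ** b))))))
      = sw A a (\<lambda>t c. sw A t (\<lambda>s b. sw A s (\<lambda>x y. sw A c (\<lambda>c1 c2. 
        R x (?S y) ** R (?S c2) (?S (?S c1)) ** ?S (?S b)))))"
      by (simp only: ant_sw ant_scl)
    also have "\<dots> = sw A a (\<lambda>t c. sw A t (\<lambda>s b. sw A s (\<lambda>x y. R x (?S y) ** sw A c (\<lambda>c1 c2. 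
        R (?S c2) (?S (?S c1)) ** ?S (?S b)))))"
      by (simp only: scl_sw)
    also have "\<dots> = sw A a (\<lambda>t c. sw A t (\<lambda>b s. sw A s (\<lambda>x y. R x (?S y) ** sw A c (\<lambda>c1 c2. 
        R (?S c2) (?S (?S c1)) ** b))))"
      by (subst ant_square_twist[symmetric]) simp_all
    also have "\<dots> = sw A a (\<lambda>b t. sw A t (\<lambda>s c. sw A s (\<lambda>x y. R x (?S y) ** sw A c (\<lambda>c1 c2. 
        R (?S c2) (?S (?S c1)) ** b))))"
      by (subst coassoc_A) simp_all
    also have "\<dots> = sw A a (\<lambda>b t. cou A t ** b)"
      by (simp only: scl_sw wu)
    also have "\<dots> = a" by (subst sw_cou_right[where sv="scl A"]) simp_all
    finally show "a = ?S (?S (sw A a (\<lambda>t c. sw A t (\<lambda>s b. sw A s (\<lambda>x y. sw A c (\<lambda>c1 c2. 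
        R x (?S y) ** R (?S c2) (?S (?S c1)) ** b))))))" by simp
  qed
  then show ?thesis unfolding surj_def by blast
qed

end

section \<open>The adjoint coaction on linear maps\<close>

locale cotriangular_bij = cotriangular_hopf A R Rbar
  for A :: "('k::comm_ring_1, 'a::ring_1) hopf" and R Rbar +
  assumes inj_ant: "inj (ant A)"
begin

definition Sinv :: "'a \<Rightarrow> 'a" where "Sinv = inv (ant A)"

lemma ant_Sinv [simp]: "ant A (Sinv x) = x"
  unfolding Sinv_def by (simp add: surj_f_inv_f surj_ant)

lemma Sinv_ant [simp]: "Sinv (ant A x) = x"
  unfolding Sinv_def by (simp add: inj_ant)

lemma lin_Sinv0: "linA Sinv"
  unfolding lin_def
proof (intro conjI allI)
  fix x y c
  have "ant A (Sinv x + Sinv y) = x + y" using lin_add[OF lin_ant0] by (simp only: ant_Sinv)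
  then show "Sinv (x + y) = Sinv x + Sinv y" using Sinv_ant[of "Sinv x + Sinv y"] by (simp only:)
  have "ant A (c ** Sinv x) = c ** x" by (simp only: ant_scl ant_Sinv)
  then show "Sinv (c ** x) = c ** Sinv x" using Sinv_ant[of "c ** Sinv x"] by (simp only:)
qed

lemma lin_Sinv [simp]: "lin s (scl A) f \<Longrightarrow> lin s (scl A) (\<lambda>x. Sinv (f x))"
  by (rule lin_comp[OF lin_Sinv0])

lemma Sinv_mult: "Sinv (a * b) = Sinv b * Sinv a"
proof -
  have "ant A (Sinv b * Sinv a) = a * b" by (simp only: ant_mult ant_Sinv)
  then have "Sinv (a * b) = Sinv (ant A (Sinv b * Sinv a))" by (simp only:)
  then show ?thesis by (simp only: Sinv_ant)
qed

lemma Sinv_one [simp]: "Sinv 1 = 1"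
  using Sinv_ant[of 1] by (simp add: ant_one del: Sinv_ant)

lemma cou_Sinv [simp]: "cou A (Sinv a) = cou A a"
  using cou_ant[of "Sinv a", symmetric] by simp

lemma sw_Sinv_right:
  assumes "linA f" shows "sw A a (\<lambda>x y. f (y * Sinv x)) = cou A a ** f 1"
proof -
  have "sw A a (\<lambda>x y. f (Sinv (x * ant A y))) = cou A a ** f (Sinv 1)"
    by (rule sw_ant_right) (simp add: lin_comp[OF assms])
  then show ?thesis by (simp add: Sinv_mult)
qed

lemma sw_Sinv_left:
  assumes "linA f" shows "sw A a (\<lambda>x y. f (Sinv y * x)) = cou A a ** f 1"
proof -
  have "sw A a (\<lambda>x y. f (Sinv (ant A x * y))) = cou A a ** f (Sinv 1)"
    by (rule sw_ant_left) (simp add: lin_comp[OF assms])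
  then show ?thesis by (simp add: Sinv_mult)
qed

lemma Sinv_comult:
  assumes "\<And>y. linA (\<lambda>x. F x y)" "\<And>x. linA (F x)"
  shows "sw A (Sinv a) F = sw A a (\<lambda>x y. F (Sinv y) (Sinv x))"
proof -
  have "sw A (ant A (Sinv a)) (\<lambda>x y. F (Sinv y) (Sinv x)) = sw A (Sinv a) F"
    by (subst ant_comult) (simp_all add: lin_comp[OF assms(1)] lin_comp[OF assms(2)])
  then show ?thesis by simp
qed

lemma Rbar_Sinv_left: "Rbar (Sinv x) y = R x y"
  using R_ant_left[of "Sinv x" y] by simp

text \<open>The adjoint coaction \<open>\<psi>(a\<^sub>2)\<^sub>1 S\<inverse>(a\<^sub>1) \<otimes>
  \<psi>(a\<^sub>2)\<^sub>2\<close> of \<open>\<psi>\<close> at the point \<open>a\<close>,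
  inserted into \<open>F\<close>. In general \<open>Hom(A, A)\<close> is not a
  comodule, but at each point the coaction is a finite sum. Below it is written
  \<open>\<psi>\<^sub>-\<^sub>1 \<otimes> \<psi>\<^sub>0\<close>.\<close>

definition adj :: "('a \<Rightarrow> 'a) \<Rightarrow> 'a \<Rightarrow> ('a \<Rightarrow> 'a \<Rightarrow> 'a) \<Rightarrow> 'a" where
  "adj \<psi> a F = sw A a (\<lambda>x y. sw A (\<psi> y) (\<lambda>p w. F (p * Sinv x) w))"

lemma lin_adj [simp]:
  assumes "lin s (scl A) f" "linA \<psi>"
   and [simp]: "\<And>w. linA (\<lambda>p. F p w)" "\<And>p. linA (F p)"
  shows "lin s (scl A) (\<lambda>x. adj \<psi> (f x) F)"
proof -
  have [simp]: "lin s (scl A) f \<Longrightarrow> lin s (scl A) (\<lambda>x. F (f x) y)" for s f y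
    using lin_comp[of "scl A" "scl A" "\<lambda>x. F x y" s f] by auto
  show ?thesis unfolding adj_def by (simp add: assms(1) lin_comp[OF assms(2)])
qed

lemma lin_adj_right [simp]:
  "(\<And>p w. lin s (scl A) (\<lambda>x. F x p w)) \<Longrightarrow> lin s (scl A) (\<lambda>x. adj \<psi> a (\<lambda>p w. F x p w))"
  unfolding adj_def by simp

lemma lin_adj_op:
  assumes "\<And>y. lin s (scl A) (\<lambda>x. G x y)" 
   and [simp]: "\<And>w. linA (\<lambda>p. F p w)" "\<And>p. linA (F p)"
  shows "lin s (scl A) (\<lambda>x. adj (G x) a F)"
proof -
  have [simp]: "lin s (scl A) f \<Longrightarrow> lin s (scl A) (\<lambda>x. F (f x) y)" for s f y
    using lin_comp[of "scl A" "scl A" "\<lambda>x. F x y" s f] by auto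
  show ?thesis unfolding adj_def by (simp add: assms(1))
qed

lemma adj_out: "linA f \<Longrightarrow> f (adj \<psi> a F) = adj \<psi> a (\<lambda>p w. f (F p w))"
  unfolding adj_def by (simp add: sw_out)

lemma scl_adj: "c ** adj \<psi> a F = adj \<psi> a (\<lambda>p w. c ** F p w)"
  by (rule adj_out) simp

lemma adj_sw: "adj \<psi> a (\<lambda>p w. sw B b (\<lambda>x y. F p w x y)) = sw B b (\<lambda>x y. adj \<psi> a (\<lambda>p w. F p w x y))"
  unfolding adj_def by (simp only: sw_swap[where b=b])

lemma adj_add: "adj \<psi> a (\<lambda>p w. F p w + G p w) = adj \<psi> a F + adj \<psi> a G"
  unfolding adj_def by (simp add: sw_add)

lemma adj_diff: "adj \<psi> a (\<lambda>p w. F p w - G p w) = adj \<psi> a F - adj \<psi> a G"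
  unfolding adj_def by (simp add: sw_diff)

lemma adj_op_scl:
  assumes "\<And>w. linA (\<lambda>p. F p w)" and [simp]: "\<And>p. linA (F p)"
  shows "adj (\<lambda>v. c ** \<psi> v) a F = c ** adj \<psi> a F"
proof -
  note [simp] = lin_comp[OF assms(1)]
  have *: "linA (\<lambda>v. sw A v (\<lambda>p w. F (p * x) w))" for x
    by simp
  show ?thesis unfolding adj_def by (simp add: lin_scale[OF *] scl_sw)
qed

lemma adj_op_diff:
  assumes "\<And>w. linA (\<lambda>p. F p w)" and [simp]: "\<And>p. linA (F p)"
  shows "adj (\<lambda>v. \<psi> v - \<chi> v) a F = adj \<psi> a F - adj \<chi> a F"
proof -
  note [simp] = lin_comp[OF assms(1)]
  have *: "linA (\<lambda>v. sw A v (\<lambda>p w. F (p * x) w))" for x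
    by simp
  show ?thesis unfolding adj_def by (simp add: lin_diff[OF *] sw_diff)
qed

lemma adj_op_add:
  assumes "\<And>w. linA (\<lambda>p. F p w)" and [simp]: "\<And>p. linA (F p)"
  shows "adj (\<lambda>v. \<psi> v + \<chi> v) a F = adj \<psi> a F + adj \<chi> a F"
proof -
  note [simp] = lin_comp[OF assms(1)]
  have *: "linA (\<lambda>v. sw A v (\<lambda>p w. F (p * x) w))" for x
    by simp
  show ?thesis unfolding adj_def by (simp add: lin_add[OF *] sw_add)
qed

lemma adj_id: 
  assumes "\<And>w. linA (\<lambda>p. F p w)" and [simp]: "\<And>p. linA (F p)"
  shows "adj (\<lambda>v. v) a F = F 1 a"
proof -
  note [simp] = lin_comp[OF assms(1)]
  have "adj (\<lambda>v. v) a F = sw A a (\<lambda>e w. sw A e (\<lambda>x p. F (p * Sinv x) w))"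
    unfolding adj_def by (subst coassoc_A) simp_all
  also have "\<dots> = sw A a (\<lambda>e w. cou A e ** F 1 w)"
    by (subst sw_Sinv_right) simp_all
  also have "\<dots> = F 1 a" by (subst sw_cou_left[where sv="scl A"]) simp_all
  finally show ?thesis .
qed

text \<open>Evaluation of linear maps is colinear: the coaction of \<open>\<psi>\<^sub>0(a)\<close> starts
  with \<open>\<psi>\<^sub>-\<^sub>1 a\<^sub>1\<close>, the factor
  \<open>S\<inverse>(a\<^sub>1)\<close> of the coaction of \<open>\<psi>\<close> being cancelled
  by \<open>a\<^sub>1\<close>.\<close>

lemma adj_coaction:
  assumes "\<And>y w. linA (\<lambda>x. F x y w)" "\<And>x w. linA (\<lambda>y. F x y w)" 
     "\<And>x y. linA (F x y)" and \<psi>: "linA \<psi>"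
  shows "adj \<psi> a (\<lambda>p w. sw A w (\<lambda>w1 w2. F p w1 w2)) 
     = sw A a (\<lambda>x y. adj \<psi> y (\<lambda>p w. sw A p (\<lambda>p1 p2. F p1 (p2 * x) w)))"
proof -
  note [simp] = lin_comp[OF assms(1)] lin_comp[OF assms(2)] lin_comp[OF assms(3)] lin_comp[OF \<psi>]
  have pull: "sw A (\<psi> y) (\<lambda>p q. sw A p (\<lambda>p1 p2. sw A x' (\<lambda>x1 x2. F (p1 * Sinv x2) (p2 * (Sinv x1 * x)) q)))
     = sw A x' (\<lambda>x1 x2. sw A (\<psi> y) (\<lambda>p q. sw A p (\<lambda>p1 p2. F (p1 * Sinv x2) (p2 * (Sinv x1 * x)) q)))" for x x' y
    by (simp only: sw_swap[where b=x'])
  have "sw A a (\<lambda>x y. adj \<psi> y (\<lambda>p w. sw A p (\<lambda>p1 p2. F p1 (p2 * x) w)))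
    = sw A a (\<lambda>x t. sw A t (\<lambda>x' y. sw A (\<psi> y) (\<lambda>p q. sw A p (\<lambda>p1 p2. sw A x' (\<lambda>x1 x2. 
       F (p1 * Sinv x2) (p2 * (Sinv x1 * x)) q)))))"
    unfolding adj_def by (simp add: sw_mult[where sv="scl A"] Sinv_comult mult.assoc)
  also have "\<dots> = sw A a (\<lambda>x t. sw A t (\<lambda>x' y. sw A x' (\<lambda>x1 x2. sw A (\<psi> y) (\<lambda>p q. sw A p (\<lambda>p1 p2. 
       F (p1 * Sinv x2) (p2 * (Sinv x1 * x)) q)))))"
    by (simp only: pull)
  also have "\<dots> = sw A a (\<lambda>e t. sw A e (\<lambda>x x1. sw A t (\<lambda>x2 y. sw A (\<psi> y) (\<lambda>p q. sw A p (\<lambda>p1 p2. 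
       F (p1 * Sinv x2) (p2 * (Sinv x1 * x)) q)))))"
    by (simp add: coassoc_A)
  also have "\<dots> = sw A a (\<lambda>e t. cou A e ** sw A t (\<lambda>x2 y. sw A (\<psi> y) (\<lambda>p q. sw A p (\<lambda>p1 p2. 
       F (p1 * Sinv x2) (p2 * 1) q))))"
    by (subst sw_Sinv_left[where f="\<lambda>z. sw A _ (\<lambda>x2 y. sw A (\<psi> y) (\<lambda>p q. sw A p (\<lambda>p1 p2. 
       F (p1 * Sinv x2) (p2 * z) q)))"]) simp_all
  also have "\<dots> = sw A a (\<lambda>x2 y. sw A (\<psi> y) (\<lambda>p q. sw A p (\<lambda>p1 p2. F (p1 * Sinv x2) p2 q)))"
    by (subst sw_cou_left[where sv="scl A"]) simp_all
  also have "\<dots> = adj \<psi> a (\<lambda>p w. sw A w (\<lambda>w1 w2. F p w1 w2))"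
    unfolding adj_def by (simp add: coassoc_A)
  finally show ?thesis by simp
qed

text \<open>This is \<open>adj_coaction\<close> with the first leg removed by the counit.\<close>

lemma sw_apply:
  assumes "\<And>w. linA (\<lambda>p. F p w)" "\<And>p. linA (F p)" and \<psi>: "linA \<psi>"
  shows "sw A (\<psi> a) F = sw A a (\<lambda>x y. adj \<psi> y (\<lambda>p w. F (p * x) w))"
proof -
  note [simp] = lin_comp[OF assms(1)] lin_comp[OF assms(2)] lin_comp[OF \<psi>]
  have "sw A a (\<lambda>x y. adj \<psi> y (\<lambda>p w. F (p * x) w))
    = sw A a (\<lambda>e y. sw A e (\<lambda>x x'. sw A (\<psi> y) (\<lambda>p q. F (p * (Sinv x' * x)) q)))"
    unfolding adj_def by (simp add: coassoc_A mult.assoc)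
  also have "\<dots> = sw A a (\<lambda>e y. cou A e ** sw A (\<psi> y) (\<lambda>p q. F (p * 1) q))"
    by (subst sw_Sinv_left[where f="\<lambda>z. sw A _ (\<lambda>p q. F (p * z) q)"]) simp_all
  also have "\<dots> = sw A (\<psi> a) F" by (subst sw_cou_left[where sv="scl A"]) simp_all
  finally show ?thesis by simp
qed

lemma adj_cou:
  assumes "linA f" and \<psi>: "linA \<psi>"
  shows "adj \<psi> a (\<lambda>p w. cou A p ** f w) = f (\<psi> a)"
proof -
  note [simp] = lin_comp[OF assms(1)] lin_comp[OF assms(2)]
  have "adj \<psi> a (\<lambda>p w. cou A p ** f w) 
      = sw A a (\<lambda>x y. cou A x ** sw A (\<psi> y) (\<lambda>p w. cou A p ** f w))"
    by (simp add: adj_def cou_mult scl_sw scale_scale[symmetric] scl_comm)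
  also have "\<dots> = sw A (\<psi> a) (\<lambda>p w. cou A p ** f w)"
    by (subst sw_cou_left[where sv="scl A"]) simp_all
  also have "\<dots> = f (\<psi> a)"
    by (subst sw_cou_left[where sv="scl A"]) simp_all
  finally show ?thesis .
qed

text \<open>The coaction of \<open>G(\<psi>\<^sub>-\<^sub>1) \<circ> \<psi>\<^sub>0\<close> is the product
  of the coactions of \<open>G\<close> and of \<open>\<psi>\<^sub>0\<close>. Composition, the
  action of a functional and the crossed composition below are special cases.\<close>

lemma adj_family:
  assumes G1: "\<And>w. linA (\<lambda>p. G p w)" and G2: "\<And>p. linA (G p)" 
    and F: "\<And>w. linA (\<lambda>p. F p w)" "\<And>p. linA (F p)" and \<psi>: "linA \<psi>"
  shows "adj (\<lambda>a. adj \<psi> a G) a F = adj \<psi> a (\<lambda>p w. sw A p (\<lambda>p1 p2. adj (G p1) w (\<lambda>q v. F (q * p2) v)))"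
proof -
  note [simp] = lin_comp[OF F(1)] lin_comp[OF F(2)] lin_comp[OF \<psi>] lin_comp[OF G1] lin_comp[OF G2] F G1 G2 lin_adj_op
  have "adj (\<lambda>a. adj \<psi> a G) a F = sw A a (\<lambda>x y. adj \<psi> y (\<lambda>p w. sw A (G p w) (\<lambda>q v. F (q * Sinv x) v)))"
    unfolding adj_def[of _ a] 
    by (subst adj_out[where f="\<lambda>z. sw A z (\<lambda>q v. F (q * Sinv _) v)"]) simp_all
  also have "\<dots> = sw A a (\<lambda>x y. adj \<psi> y (\<lambda>p w. sw A w (\<lambda>w1 w2. adj (G p) w2 (\<lambda>q v. F (q * w1 * Sinv x) v))))"
    by (subst sw_apply[OF _ _ G2]) simp_all
  also have "\<dots> = sw A a (\<lambda>x t. sw A t (\<lambda>x' y. adj \<psi> y (\<lambda>p w. sw A p (\<lambda>p1 p2. adj (G p1) w (\<lambda>q v. F (q * (p2 * (x' * Sinv x))) v)))))"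
    by (subst adj_coaction[OF _ _ _ \<psi>]) (simp_all add: mult.assoc)
  also have "\<dots> = sw A a (\<lambda>e y. sw A e (\<lambda>x x'. adj \<psi> y (\<lambda>p w. sw A p (\<lambda>p1 p2. adj (G p1) w (\<lambda>q v. F (q * (p2 * (x' * Sinv x))) v)))))"
    by (subst coassoc_A) simp_all
  also have "\<dots> = sw A a (\<lambda>e y. cou A e ** adj \<psi> y (\<lambda>p w. sw A p (\<lambda>p1 p2. adj (G p1) w (\<lambda>q v. F (q * (p2 * 1)) v))))"
    by (subst sw_Sinv_right[where f="\<lambda>z. adj \<psi> _ (\<lambda>p w. sw A p (\<lambda>p1 p2. adj (G p1) w (\<lambda>q v. F (q * (p2 * z)) v)))"]) simp_all
  also have "\<dots> = adj \<psi> a (\<lambda>p w. sw A p (\<lambda>p1 p2. adj (G p1) w (\<lambda>q v. F (q * p2) v)))"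
    by (subst sw_cou_left[where sv="scl A"]) simp_all
  finally show ?thesis .
qed

lemma adj_comp:
  assumes F: "\<And>w. linA (\<lambda>p. F p w)" "\<And>p. linA (F p)" 
    and \<psi>: "linA \<psi>" and \<chi>: "linA \<chi>"
  shows "adj (\<lambda>a. \<psi> (\<chi> a)) a F = adj \<chi> a (\<lambda>q v. adj \<psi> v (\<lambda>p w. F (p * q) w))"
proof -
  note [simp] = lin_comp[OF F(1)] lin_comp[OF F(2)] lin_comp[OF \<psi>] lin_comp[OF \<chi>] \<psi> \<chi>
  have "adj (\<lambda>a. \<psi> (\<chi> a)) a F = adj (\<lambda>a. adj \<chi> a (\<lambda>q v. cou A q ** \<psi> v)) a F"
    by (simp add: adj_cou)
  also have "\<dots> = adj \<chi> a (\<lambda>q v. sw A q (\<lambda>q1 q2. cou A q1 ** adj \<psi> v (\<lambda>p w. F (p * q2) w)))"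
    by (subst adj_family) (simp_all add: F adj_op_scl)
  also have "\<dots> = adj \<chi> a (\<lambda>q v. adj \<psi> v (\<lambda>p w. F (p * q) w))"
    by (subst sw_cou_left[where sv="scl A"]) simp_all
  finally show ?thesis .
qed

text \<open>For \<open>f = pair k\<close> this is the action of \<open>k\<close> on \<open>\<psi>\<close>
  (see \<open>hom_act_left\<close>); arbitrary functionals occur after contraction with
  \<open>Rbar\<close>.\<close>

definition hact :: "('a \<Rightarrow> 'k) \<Rightarrow> ('a \<Rightarrow> 'a) \<Rightarrow> 'a \<Rightarrow> 'a" where
  "hact f \<psi> a = adj \<psi> a (\<lambda>p w. f p ** w)"

lemma lin_hact [simp]: "linK f \<Longrightarrow> linA \<psi> \<Longrightarrow> lin s (scl A) g \<Longrightarrow> lin s (scl A) (\<lambda>x. hact f \<psi> (g x))"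
  unfolding hact_def by simp

lemma lin_hact' [simp]: "linK f \<Longrightarrow> linA \<psi> \<Longrightarrow> linA (hact f \<psi>)"
  using lin_hact[where g="\<lambda>x. x"] by simp

lemma adj_hact:
  assumes F: "\<And>w. linA (\<lambda>p. F p w)" "\<And>p. linA (F p)" 
    and \<psi>: "linA \<psi>" and f: "linK f"
  shows "adj (hact f \<psi>) a F = adj \<psi> a (\<lambda>p w. sw A p (\<lambda>p1 p2. f p1 ** F p2 w))"
proof -
  note [simp] = lin_comp[OF F(1)] lin_comp[OF F(2)] lin_comp[OF \<psi>] \<psi> lin_comp[OF f] f
  have "adj (hact f \<psi>) a F = adj (\<lambda>a. adj \<psi> a (\<lambda>p w. f p ** w)) a F"
    by (simp add: hact_def[abs_def])
  also have "\<dots> = adj \<psi> a (\<lambda>p w. sw A p (\<lambda>p1 p2. f p1 ** F p2 w))"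
    by (subst adj_family) (simp_all add: F adj_op_scl adj_id)
  finally show ?thesis .
qed

text \<open>The composition of \<open>\<chi>\<close> after \<open>\<psi>\<close> in which the two have been
  interchanged by the braiding, i.e. the term subtracted in the bracket of \<open>\<psi>\<close>
  and \<open>\<chi>\<close> (see \<open>contracts_cross\<close>).\<close>

definition cross :: "('a \<Rightarrow> 'a) \<Rightarrow> ('a \<Rightarrow> 'a) \<Rightarrow> 'a \<Rightarrow> 'a" where
  "cross \<chi> \<psi> a = adj \<psi> a (\<lambda>p w. adj \<chi> w (\<lambda>q v. Rbar p q ** v))"

lemma lin_cross [simp]: 
  assumes "linA \<psi>" "linA \<chi>" "lin s (scl A) g" 
  shows "lin s (scl A) (\<lambda>x. cross \<chi> \<psi> (g x))"
  unfolding cross_def using assms by simp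

lemma adj_cross:
  assumes F: "\<And>w. linA (\<lambda>p. F p w)" "\<And>p. linA (F p)" 
    and \<psi>: "linA \<psi>" and \<chi>: "linA \<chi>"
  shows "adj (cross \<chi> \<psi>) a F = adj \<psi> a (\<lambda>p w. adj \<chi> w (\<lambda>q v. sw2 p q (\<lambda>p1 q1 p2 q2. Rbar p1 q1 ** F (q2 * p2) v)))"
proof -
  note [simp] = lin_comp[OF F(1)] lin_comp[OF F(2)] \<psi> \<chi>
  have "adj (cross \<chi> \<psi>) a F = adj (\<lambda>a. adj \<psi> a (\<lambda>p w. hact (Rbar p) \<chi> w)) a F"
    by (simp add: hact_def[abs_def] cross_def[abs_def])
  also have "\<dots> = adj \<psi> a (\<lambda>p w. sw A p (\<lambda>p1 p2. adj (hact (Rbar p1) \<chi>) w (\<lambda>q v. F (q * p2) v)))"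
    by (subst adj_family) (simp_all add: F hact_def)
  also have "\<dots> = adj \<psi> a (\<lambda>p w. sw A p (\<lambda>p1 p2. adj \<chi> w (\<lambda>q v. sw A q (\<lambda>q1 q2. Rbar p1 q1 ** F (q2 * p2) v))))"
    by (subst adj_hact) simp_all
  also have "\<dots> = adj \<psi> a (\<lambda>p w. adj \<chi> w (\<lambda>q v. sw2 p q (\<lambda>p1 q1 p2 q2. Rbar p1 q1 ** F (q2 * p2) v)))"
    by (simp add: adj_sw sw2_def)
  finally show ?thesis .
qed

section \<open>Braided derivations and their bracket\<close>

text \<open>The Leibniz rule for the left action with the contraction carried out (see
  \<open>braided_Der_op\<close>).\<close>

definition braided_derivation :: "('a \<Rightarrow> 'a) \<Rightarrow> bool" where
  "braided_derivation \<psi> \<longleftrightarrow> linA \<psi> \<and> 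
     (\<forall>a a'. \<psi> (a * a') = \<psi> a * a' + adj \<psi> a' (\<lambda>p w. sw A a (\<lambda>x y. Rbar p x ** y * w)))"

lemma derivation_lin: "braided_derivation \<psi> \<Longrightarrow> linA \<psi>"
  by (simp add: braided_derivation_def)

lemma derivation_mult: 
  "braided_derivation \<psi> \<Longrightarrow> \<psi> (a * a') = \<psi> a * a' + adj \<psi> a' (\<lambda>p w. sw A a (\<lambda>x y. Rbar p x ** y * w))"
  by (simp add: braided_derivation_def)

lemma adj_swap: "adj \<psi> a (\<lambda>p w. adj \<chi> b (\<lambda>q v. F p w q v)) = adj \<chi> b (\<lambda>q v. adj \<psi> a (\<lambda>p w. F p w q v))"
  by (subst (2) adj_def, subst (2) adj_def) (simp only: adj_sw)

text \<open>The coaction of a derivation, evaluated at a product. In the first summand of the Leibniz rule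
  the factor \<open>a'\<^sub>2\<close> cancels \<open>S\<inverse>(a'\<^sub>1)\<close>; in the
  second one \<open>a\<^sub>2\<close> cancels \<open>S\<inverse>(a\<^sub>1)\<close> after
  \<open>Rbar\<close> has been moved across.\<close>

lemma adj_mult:
  assumes F: "\<And>w. linA (\<lambda>p. F p w)" "\<And>p. linA (F p)" and D: "braided_derivation \<psi>"
  shows "adj \<psi> (a * a') F = adj \<psi> a (\<lambda>p w. F p (w * a')) 
    + adj \<psi> a' (\<lambda>p w. sw2 p a (\<lambda>p1 x p2 y. Rbar p2 x ** F p1 (y * w)))"
proof -
  note \<psi> = derivation_lin[OF D]
  note [simp] = lin_comp[OF F(1)] lin_comp[OF F(2)] lin_comp[OF \<psi>] \<psi> F
  define K where "K x x' z = sw A z (\<lambda>p w. F (p * (Sinv x' * Sinv x)) w)" for x x' z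
  have K [simp]: "linA (K x x')" for x x' unfolding K_def by simp
  have "adj \<psi> (a * a') F = sw A a (\<lambda>x y. sw A a' (\<lambda>x' y'. K x x' (\<psi> (y * y'))))"
    unfolding adj_def K_def by (subst sw_mult[where sv="scl A"]) (simp_all add: Sinv_mult)
  also have "\<dots> = sw A a (\<lambda>x y. sw A a' (\<lambda>x' y'. K x x' (\<psi> y * y')))
     + sw A a (\<lambda>x y. sw A a' (\<lambda>x' y'. K x x' (adj \<psi> y' (\<lambda>q v. sw A y (\<lambda>y1 y2. Rbar q y1 ** y2 * v)))))"
    by (simp add: derivation_mult[OF D] lin_add[OF K] sw_add)
  also have "sw A a (\<lambda>x y. sw A a' (\<lambda>x' y'. K x x' (\<psi> y * y'))) = adj \<psi> a (\<lambda>p w. F p (w * a'))"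
  proof -
    have "sw A a' (\<lambda>x' y'. K x x' (z * y')) = sw A z (\<lambda>p w. F (p * Sinv x) (w * a'))" for x z
    proof -
      have "sw A a' (\<lambda>x' y'. K x x' (z * y')) 
         = sw A a' (\<lambda>x' y'. sw A y' (\<lambda>p' w'. sw A z (\<lambda>p w. F (p * (p' * Sinv x') * Sinv x) (w * w'))))"
        unfolding K_def by (simp add: sw_mult[where sv="scl A"] mult.assoc sw_swap[where a=z])
      also have "\<dots> = sw A a' (\<lambda>e w'. sw A e (\<lambda>x' p'. sw A z (\<lambda>p w. F (p * (p' * Sinv x') * Sinv x) (w * w'))))"
        by (subst coassoc_A) simp_all
      also have "\<dots> = sw A a' (\<lambda>e w'. cou A e ** sw A z (\<lambda>p w. F (p * 1 * Sinv x) (w * w')))"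
        by (subst sw_Sinv_right[where f="\<lambda>u. sw A z (\<lambda>p w. F (p * u * Sinv x) (w * _))"]) simp_all
      also have "\<dots> = sw A z (\<lambda>p w. F (p * Sinv x) (w * a'))"
        by (subst sw_cou_left[where sv="scl A"]) simp_all
      finally show ?thesis .
    qed
    then show ?thesis by (simp add: adj_def)
  qed
  also have "sw A a (\<lambda>x y. sw A a' (\<lambda>x' y'. K x x' (adj \<psi> y' (\<lambda>q v. sw A y (\<lambda>y1 y2. Rbar q y1 ** y2 * v)))))
     = adj \<psi> a' (\<lambda>p w. sw2 p a (\<lambda>p1 x p2 y. Rbar p2 x ** F p1 (y * w)))"
  proof -
    define L where "L x y q s w = sw A q (\<lambda>q1 q2. sw A y (\<lambda>y1 y2. sw A y2 (\<lambda>c d. Rbar q1 y1 ** F (c * (q2 * s) * Sinv x) (d * w))))" 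
      for x y q s w
    have 1: "sw A a' (\<lambda>x' y'. K x x' (adj \<psi> y' (\<lambda>q v. sw A y (\<lambda>y1 y2. Rbar q y1 ** y2 * v))))
      = adj \<psi> a' (\<lambda>q w. L x y q 1 w)" for x y
    proof -
      have pull: "sw A y (\<lambda>y1 y2. Rbar q y1 ** K x x' (y2 * v)) = sw A v (\<lambda>v1 v2. sw A y (\<lambda>y1 y2. sw A y2 (\<lambda>c d. 
             Rbar q y1 ** F (c * v1 * (Sinv x' * Sinv x)) (d * v2))))" for q v x'
        by (simp add: K_def sw_mult[where sv="scl A"] scl_sw sw_swap[where b=v])
      have "sw A a' (\<lambda>x' y'. K x x' (adj \<psi> y' (\<lambda>q v. sw A y (\<lambda>y1 y2. Rbar q y1 ** y2 * v))))
         = sw A a' (\<lambda>x' y'. adj \<psi> y' (\<lambda>q v. sw A v (\<lambda>v1 v2. sw A y (\<lambda>y1 y2. sw A y2 (\<lambda>c d. 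
             Rbar q y1 ** F (c * v1 * (Sinv x' * Sinv x)) (d * v2))))))"
        by (simp add: adj_out[OF K] sw_out[OF K] lin_scale[OF K] pull)
      also have "\<dots> = sw A a' (\<lambda>x' y'. sw A y' (\<lambda>s t. adj \<psi> t (\<lambda>q w. L x y q (s * Sinv x') w)))"
        unfolding L_def by (subst adj_coaction) (simp_all add: mult.assoc)
      also have "\<dots> = sw A a' (\<lambda>e t. sw A e (\<lambda>x' s. adj \<psi> t (\<lambda>q w. L x y q (s * Sinv x') w)))"
        unfolding L_def by (subst coassoc_A) simp_all
      also have "\<dots> = sw A a' (\<lambda>e t. cou A e ** adj \<psi> t (\<lambda>q w. L x y q 1 w))"
        unfolding L_def 
        by (subst sw_Sinv_right[where f="\<lambda>z. adj \<psi> _ (\<lambda>q w. sw A q (\<lambda>q1 q2. sw A y (\<lambda>y1 y2. sw A y2 (\<lambda>c d. Rbar q1 y1 ** F (c * (q2 * z) * Sinv x) (d * w)))))"]) simp_all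
      also have "\<dots> = adj \<psi> a' (\<lambda>q w. L x y q 1 w)"
        unfolding L_def by (subst sw_cou_left[where sv="scl A"]) simp_all
      finally show ?thesis .
    qed
    have 2: "sw A a (\<lambda>x y. L x y q 1 w) = sw2 q a (\<lambda>p1 x p2 y. Rbar p2 x ** F p1 (y * w))" for q w
    proof -
      have "sw A a (\<lambda>x y. L x y q 1 w) 
        = sw A a (\<lambda>x y. sw A y (\<lambda>e d. sw2 q e (\<lambda>q1 y1 q2 c. Rbar q1 y1 ** F (c * q2 * Sinv x) (d * w))))"
        unfolding L_def sw2_def by (simp add: coassoc_A sw_swap[where a=q])
      also have "\<dots> = sw A a (\<lambda>x y. sw A y (\<lambda>e d. sw2 q e (\<lambda>q1 y1 q2 c. Rbar q2 c ** F (q1 * y1 * Sinv x) (d * w))))"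
        by (subst Rbar_comm) simp_all
      also have "\<dots> = sw A a (\<lambda>x y. sw A y (\<lambda>y1 t. sw A t (\<lambda>c d. sw A q (\<lambda>q1 q2. Rbar q2 c ** F (q1 * (y1 * Sinv x)) (d * w)))))"
        unfolding sw2_def by (simp add: coassoc_A sw_swap[where a=q] mult.assoc)
      also have "\<dots> = sw A a (\<lambda>e t. sw A e (\<lambda>x y1. sw A t (\<lambda>c d. sw A q (\<lambda>q1 q2. Rbar q2 c ** F (q1 * (y1 * Sinv x)) (d * w)))))"
        by (subst coassoc_A) simp_all
      also have "\<dots> = sw A a (\<lambda>e t. cou A e ** sw A t (\<lambda>c d. sw A q (\<lambda>q1 q2. Rbar q2 c ** F (q1 * 1) (d * w))))"
        by (subst sw_Sinv_right[where f="\<lambda>z. sw A _ (\<lambda>c d. sw A q (\<lambda>q1 q2. Rbar q2 c ** F (q1 * z) (d * w)))"]) simp_all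
      also have "\<dots> = sw2 q a (\<lambda>p1 x p2 y. Rbar p2 x ** F p1 (y * w))"
        unfolding sw2_def by (subst sw_cou_left[where sv="scl A"]) (simp_all add: sw_swap[where a=q])
      finally show ?thesis .
    qed
    show ?thesis by (simp only: 1 adj_sw[symmetric] 2)
  qed
  finally show ?thesis .
qed

lemma derivation_hact:
  assumes D: "braided_derivation \<psi>" and f: "linK f"
  shows "braided_derivation (hact f \<psi>)"
  unfolding braided_derivation_def
proof (intro conjI allI)
  note [simp] = lin_comp[OF f] f derivation_lin[OF D]
  show "linA (hact f \<psi>)" by simp
  fix a a'
  have "hact f \<psi> (a * a') = hact f \<psi> a * a' 
     + adj \<psi> a' (\<lambda>p w. sw2 p a (\<lambda>p1 x p2 y. Rbar p2 x ** f p1 ** y * w))"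
    unfolding hact_def 
    by (subst adj_mult[OF _ _ D]) (simp_all add: adj_out[where f="\<lambda>z. z * a'"] scl_mult_left)
  also have "adj \<psi> a' (\<lambda>p w. sw2 p a (\<lambda>p1 x p2 y. Rbar p2 x ** f p1 ** y * w))
    = adj (hact f \<psi>) a' (\<lambda>p w. sw A a (\<lambda>x y. Rbar p x ** y * w))"
    by (subst adj_hact) (simp_all add: sw2_def scl_sw scl_comm)
  finally show "hact f \<psi> (a * a') = hact f \<psi> a * a' + adj (hact f \<psi>) a' (\<lambda>p w. sw A a (\<lambda>x y. Rbar p x ** y * w))" .
qed

definition bracket :: "('a \<Rightarrow> 'a) \<Rightarrow> ('a \<Rightarrow> 'a) \<Rightarrow> 'a \<Rightarrow> 'a" where
  "bracket u v a = u (v a) - cross v u a"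

lemma lin_bracket: "linA u \<Longrightarrow> linA v \<Longrightarrow> linA (bracket u v)"
  unfolding bracket_def[abs_def] by (simp add: lin_comp)

text \<open>The terms \<open>B0\<close> and \<open>B1\<close>, in which \<open>u\<close> and
  \<open>v\<close> act on different factors, occur in the composition and in the crossed
  composition alike, by colinearity of evaluation and \<open>Rbar(x, y) = R(y, x)\<close>. They
  cancel in the bracket, and the other terms are the Leibniz rule of the bracket.\<close>

lemma derivation_bracket:
  assumes U: "braided_derivation u" and V: "braided_derivation v"
  shows "braided_derivation (bracket u v)"
  unfolding braided_derivation_def
proof (intro conjI allI)
  note u = derivation_lin[OF U] and v = derivation_lin[OF V]
  note [simp] = u v lin_comp[OF u] lin_comp[OF v]
  show "linA (bracket u v)" by (rule lin_bracket[OF u v])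
  fix a a'
  define L where "L p w = sw A a (\<lambda>x y. Rbar p x ** y * w)" for p w
  define B0 where "B0 = adj u a' (\<lambda>p w. sw A (v a) (\<lambda>x y. Rbar p x ** y * w))"
  define B1 where "B1 = adj v a' (\<lambda>q w. sw A a (\<lambda>x y. Rbar q x ** u y * w))"
  have uv: "u (v (a * a')) = u (v a) * a' + B0 + B1 + adj (\<lambda>x. u (v x)) a' L"
  proof -
    have "u (v (a * a')) = u (v a) * a' + B0 + adj v a' (\<lambda>q w. sw A a (\<lambda>x y. Rbar q x ** u (y * w)))"
      by (simp add: derivation_mult[OF V] lin_add[OF u] derivation_mult[OF U, of "v a"] B0_def adj_out[OF u] sw_out[OF u] lin_scale[OF u])
    also have "adj v a' (\<lambda>q w. sw A a (\<lambda>x y. Rbar q x ** u (y * w))) = B1 + 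
      adj v a' (\<lambda>q w. sw A a (\<lambda>x y. Rbar q x ** adj u w (\<lambda>p z. sw A y (\<lambda>y1 y2. Rbar p y1 ** y2 * z))))"
      by (simp add: derivation_mult[OF U] scale_right_distrib sw_add adj_add B1_def)
    also have "adj v a' (\<lambda>q w. sw A a (\<lambda>x y. Rbar q x ** adj u w (\<lambda>p z. sw A y (\<lambda>y1 y2. Rbar p y1 ** y2 * z))))
      = adj v a' (\<lambda>q w. adj u w (\<lambda>p z. sw A a (\<lambda>x y. sw A y (\<lambda>y1 y2. Rbar q x ** Rbar p y1 ** y2 * z))))"
      by (simp add: scl_adj adj_sw[symmetric] scl_sw)
    also have "\<dots> = adj (\<lambda>x. u (v x)) a' L"
      unfolding L_def by (subst adj_comp) (simp_all add: Rbar_mult_left coassoc_A)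
    finally show ?thesis by (simp add: add.assoc)
  qed
  have dV: "hact (Rbar p) v (b * b') = hact (Rbar p) v b * b' 
     + adj v b' (\<lambda>q z. sw A q (\<lambda>q1 q2. Rbar p q1 ** sw A b (\<lambda>x y. Rbar q2 x ** y * z)))" for p b b'
    by (subst derivation_mult[OF derivation_hact[OF V]], simp)
       (subst adj_hact, simp_all)
  have "cross v u (a * a') = adj u (a * a') (\<lambda>p w. hact (Rbar p) v w)"
    by (simp add: cross_def hact_def)
  also have "\<dots> = adj u a (\<lambda>p w. hact (Rbar p) v (w * a')) 
     + adj u a' (\<lambda>p w. sw2 p a (\<lambda>p1 x p2 y. Rbar p2 x ** hact (Rbar p1) v (y * w)))"
    by (subst adj_mult[OF _ _ U]) (simp_all add: hact_def)
  also have "adj u a (\<lambda>p w. hact (Rbar p) v (w * a')) = cross v u a * a' + B1"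
  proof -
    have "adj u a (\<lambda>p w. hact (Rbar p) v (w * a')) = adj u a (\<lambda>p w. hact (Rbar p) v w * a')
       + adj u a (\<lambda>p w. adj v a' (\<lambda>q z. sw A q (\<lambda>q1 q2. Rbar p q1 ** sw A w (\<lambda>x y. Rbar q2 x ** y * z))))"
      by (simp add: dV adj_add)
    also have "adj u a (\<lambda>p w. hact (Rbar p) v w * a') = cross v u a * a'"
      by (simp add: cross_def hact_def adj_out[where f="\<lambda>z. z * a'"])
    also have "adj u a (\<lambda>p w. adj v a' (\<lambda>q z. sw A q (\<lambda>q1 q2. Rbar p q1 ** sw A w (\<lambda>x y. Rbar q2 x ** y * z)))) = B1"
    proof -
      have "adj u a (\<lambda>p w. sw A q (\<lambda>q1 q2. Rbar p q1 ** sw A w (\<lambda>x y. Rbar q2 x ** y * z)))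
        = sw A a (\<lambda>x y. Rbar q x ** u y * z)" for q z
      proof -
        have pq: "sw A p (\<lambda>p1 p2. sw A q (\<lambda>q1 q2. sw A q2 (\<lambda>q2 q3. Rbar p1 q1 ** Rbar q2 p2 ** f q3)))
          = sw A q (\<lambda>e q3. sw2 p e (\<lambda>p1 q1 p2 q2. Rbar p1 q1 ** R p2 q2 ** f q3))" 
          if [simp]: "linA f" for p f
          unfolding sw2_def by (simp add: coassoc_A sw_swap[where b=p] Rbar_flip)
        have "adj u a (\<lambda>p w. sw A q (\<lambda>q1 q2. Rbar p q1 ** sw A w (\<lambda>x y. Rbar q2 x ** y * z)))
          = adj u a (\<lambda>p w. sw A w (\<lambda>x y. sw A q (\<lambda>q1 q2. Rbar p q1 ** Rbar q2 x ** y * z)))"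
          by (simp add: scl_sw sw_swap[where a=q])
        also have "\<dots> = sw A a (\<lambda>s t. adj u t (\<lambda>p w. sw A p (\<lambda>p1 p2. sw A q (\<lambda>q1 q2. Rbar p1 q1 ** Rbar q2 (p2 * s) ** w * z))))"
          by (subst adj_coaction) simp_all
        also have "\<dots> = sw A a (\<lambda>s t. adj u t (\<lambda>p w. sw A p (\<lambda>p1 p2. sw A q (\<lambda>q1 q2. sw A q2 (\<lambda>q2 q3. Rbar p1 q1 ** Rbar q2 p2 ** Rbar q3 s ** w * z)))))"
          by (simp add: Rbar_mult_right scl_sw)
        also have "\<dots> = sw A a (\<lambda>s t. adj u t (\<lambda>p w. sw A q (\<lambda>e q3. sw2 p e (\<lambda>p1 q1 p2 q2. Rbar p1 q1 ** R p2 q2 ** Rbar q3 s ** w * z))))"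
          by (subst pq) simp_all
        also have "\<dots> = sw A a (\<lambda>s t. adj u t (\<lambda>p w. cou A p ** sw A q (\<lambda>e q3. cou A e ** Rbar q3 s ** w * z)))"
          by (simp add: Rbar_R scl_sw)
        also have "\<dots> = sw A a (\<lambda>s t. adj u t (\<lambda>p w. cou A p ** Rbar q s ** w * z))"
          by (subst sw_cou_left[where sv="scl A"]) simp_all
        also have "\<dots> = sw A a (\<lambda>x y. Rbar q x ** u y * z)"
          by (subst adj_cou) simp_all
        finally show ?thesis .
      qed
      then show ?thesis by (subst adj_swap) (simp add: B1_def)
    qed
    finally show ?thesis .
  qed
  also have "adj u a' (\<lambda>p w. sw2 p a (\<lambda>p1 x p2 y. Rbar p2 x ** hact (Rbar p1) v (y * w)))
     = B0 + adj (cross v u) a' L"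
  proof -
    have "adj u a' (\<lambda>p w. sw2 p a (\<lambda>p1 x p2 y. Rbar p2 x ** hact (Rbar p1) v (y * w)))
      = adj u a' (\<lambda>p w. sw2 p a (\<lambda>p1 x p2 y. Rbar p2 x ** hact (Rbar p1) v y * w))
      + adj u a' (\<lambda>p w. sw2 p a (\<lambda>p1 x p2 y. Rbar p2 x ** adj v w (\<lambda>q z. sw A q (\<lambda>q1 q2. Rbar p1 q1 ** sw A y (\<lambda>x y. Rbar q2 x ** y * z)))))"
      by (simp add: dV adj_add sw2_def sw_add scale_right_distrib)
    also have "adj u a' (\<lambda>p w. sw2 p a (\<lambda>p1 x p2 y. Rbar p2 x ** hact (Rbar p1) v y * w)) = B0"
    proof -
      have "sw A (v a) (\<lambda>x y. Rbar p x ** y * w) = sw2 p a (\<lambda>p1 x p2 y. Rbar p2 x ** hact (Rbar p1) v y * w)" for p w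
      proof -
        have "sw A (v a) (\<lambda>x y. Rbar p x ** y * w) = sw A a (\<lambda>s t. adj v t (\<lambda>q z. Rbar p (q * s) ** z * w))"
          by (subst sw_apply) simp_all
        also have "\<dots> = sw A p (\<lambda>p1 p2. sw A a (\<lambda>s t. adj v t (\<lambda>q z. Rbar p2 s ** (Rbar p1 q ** z) * w)))"
          by (simp add: Rbar_mult_right adj_sw sw_swap[where b=p] scl_comm scl_mult_left)
        also have "\<dots> = sw2 p a (\<lambda>p1 x p2 y. Rbar p2 x ** hact (Rbar p1) v y * w)"
          by (simp add: sw2_def hact_def adj_out[where f="\<lambda>z. z * w"] scl_adj)
        finally show ?thesis .
      qed
      then show ?thesis by (simp add: B0_def)
    qed
    also have "adj u a' (\<lambda>p w. sw2 p a (\<lambda>p1 x p2 y. Rbar p2 x ** adj v w (\<lambda>q z. sw A q (\<lambda>q1 q2. Rbar p1 q1 ** sw A y (\<lambda>x y. Rbar q2 x ** y * z)))))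
      = adj u a' (\<lambda>p w. adj v w (\<lambda>q z. sw A p (\<lambda>p1 p2. sw A q (\<lambda>q1 q2. sw A a (\<lambda>x y. sw A y (\<lambda>x' y. Rbar p1 q1 ** Rbar p2 x ** Rbar q2 x' ** y * z))))))"
      by (simp add: sw2_def scl_adj scl_sw adj_sw sw_swap[where b=a] scl_comm)
    also have "\<dots> = adj (cross v u) a' L"
      unfolding L_def by (subst adj_cross) (simp_all add: Rbar_mult_left coassoc_A sw2_def scl_sw)
    finally show ?thesis .
  qed
  finally have cr: "cross v u (a * a') = cross v u a * a' + B1 + (B0 + adj (cross v u) a' L)" .
  have "bracket u v (a * a') = bracket u v a * a' + (adj (\<lambda>x. u (v x)) a' L - adj (cross v u) a' L)"
    unfolding bracket_def uv cr by (simp add: algebra_simps)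
  also have "adj (\<lambda>x. u (v x)) a' L - adj (cross v u) a' L = adj (bracket u v) a' L"
    unfolding bracket_def[abs_def] L_def by (subst adj_op_diff) simp_all
  finally show "bracket u v (a * a') = bracket u v a * a' + adj (bracket u v) a' (\<lambda>p w. sw A a (\<lambda>x y. Rbar p x ** y * w))"
    by (simp add: L_def[abs_def])
qed

section \<open>Contractions and the braided Lie identities\<close>

text \<open>The algebraic content of a contraction: \<open>\<Phi> f g\<close> depends on two linear
  functionals through finitely many values, and \<open>v\<close> results from putting
  \<open>Rbar(p, q)\<close> for \<open>f(p) g(q)\<close>. The functionals need not come from a
  dual Hopf algebra; thus one computation serves both the dual of \<open>A\<close> and the dual of
  \<open>H\<close>.\<close>

definition contracts :: "(('a \<Rightarrow> 'k) \<Rightarrow> ('a \<Rightarrow> 'k) \<Rightarrow> 'a) \<Rightarrow> 'a \<Rightarrow> bool" where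
  "contracts \<Phi> v \<longleftrightarrow> (\<exists>ts. (\<forall>f g. linK f \<longrightarrow> linK g \<longrightarrow> \<Phi> f g = (\<Sum>(p, q, w)\<leftarrow>ts. (f p * g q) ** w)) \<and>
      v = (\<Sum>(p, q, w)\<leftarrow>ts. Rbar p q ** w))"

lemma contracts_cong:
  assumes "contracts \<Psi> v" "\<And>f g. linK f \<Longrightarrow> linK g \<Longrightarrow> \<Phi> f g = \<Psi> f g"
  shows "contracts \<Phi> v"
  using assms unfolding contracts_def by metis

lemma contracts_base: "contracts (\<lambda>f g. f p ** g q ** w) (Rbar p q ** w)"
  unfolding contracts_def by (rule exI[of _ "[(p, q, w)]"]) (simp add: scale_scale)

lemma contracts_zero: "contracts (\<lambda>f g. 0) 0"
  unfolding contracts_def by (rule exI[of _ "[]"]) simp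

lemma contracts_add: 
  assumes "contracts \<Phi> v" "contracts \<Psi> w" shows "contracts (\<lambda>f g. \<Phi> f g + \<Psi> f g) (v + w)"
proof -
  from assms obtain s t where
   "\<forall>f g. linK f \<longrightarrow> linK g \<longrightarrow> \<Phi> f g = (\<Sum>(p, q, w)\<leftarrow>s. (f p * g q) ** w)" 
   "v = (\<Sum>(p, q, w)\<leftarrow>s. Rbar p q ** w)"
   "\<forall>f g. linK f \<longrightarrow> linK g \<longrightarrow> \<Psi> f g = (\<Sum>(p, q, w)\<leftarrow>t. (f p * g q) ** w)" 
   "w = (\<Sum>(p, q, w)\<leftarrow>t. Rbar p q ** w)"
   unfolding contracts_def by blast
  then show ?thesis unfolding contracts_def by (intro exI[of _ "s @ t"]) simp
qed

lemma contracts_list: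
  "(\<And>x. contracts (\<lambda>f g. \<Phi> f g x) (v x)) \<Longrightarrow> contracts (\<lambda>f g. \<Sum>x\<leftarrow>xs. \<Phi> f g x) (\<Sum>x\<leftarrow>xs. v x)"
  by (induction xs) (simp_all add: contracts_zero contracts_add)

lemma contracts_sw:
  "(\<And>x y. contracts (\<lambda>f g. \<Phi> f g x y) (v x y)) \<Longrightarrow> contracts (\<lambda>f g. sw B a (\<lambda>x y. \<Phi> f g x y)) (sw B a v)"
  unfolding sw_def case_prod_unfold by (rule contracts_list)

lemma contracts_adj:
  "(\<And>x y. contracts (\<lambda>f g. \<Phi> f g x y) (v x y)) \<Longrightarrow> contracts (\<lambda>f g. adj \<psi> a (\<lambda>x y. \<Phi> f g x y)) (adj \<psi> a v)"
  unfolding adj_def by (intro contracts_sw)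

lemma contracts_scl:
  assumes "contracts \<Phi> v" shows "contracts (\<lambda>f g. c ** \<Phi> f g) (c ** v)"
proof -
  from assms obtain s where s:
   "\<forall>f g. linK f \<longrightarrow> linK g \<longrightarrow> \<Phi> f g = (\<Sum>(p, q, w)\<leftarrow>s. (f p * g q) ** w)" 
   "v = (\<Sum>(p, q, w)\<leftarrow>s. Rbar p q ** w)"
   unfolding contracts_def by blast
  have l: "linA (scl A c)" by (simp add: lin_scaleI)
  have e: "c ** (\<Sum>(p, q, w)\<leftarrow>s. h p q ** w) = (\<Sum>(p, q, w)\<leftarrow>map (\<lambda>(p, q, w). (p, q, c ** w)) s. h p q ** w)" for h
    by (simp add: case_prod_unfold comp_def lin_sum_list[OF l] scl_comm[of c])
  show ?thesis unfolding contracts_def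
    by (rule exI[of _ "map (\<lambda>(p, q, w). (p, q, c ** w)) s"]) (use s e in auto)
qed

lemma contracts_uminus: "contracts \<Phi> v \<Longrightarrow> contracts (\<lambda>f g. - \<Phi> f g) (- v)"
  using contracts_scl[of \<Phi> v "-1"] by simp

lemma contracts_diff: "contracts \<Phi> v \<Longrightarrow> contracts \<Psi> w \<Longrightarrow> contracts (\<lambda>f g. \<Phi> f g - \<Psi> f g) (v - w)"
  using contracts_add[of \<Phi> v "\<lambda>f g. - \<Psi> f g" "- w"] contracts_uminus by simp

lemmas contracts_intros = contracts_sw contracts_adj contracts_scl contracts_base

lemma contractsI:
  assumes "\<And>f g. linK f \<Longrightarrow> linK g \<Longrightarrow> \<Phi> f g = \<Psi> f g" "contracts \<Psi> v" "v = w"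
  shows "contracts \<Phi> w"
  using contracts_cong assms by blast

lemma hact_hact_comp:
  assumes [simp]: "linA u" "linA v" "linK f" "linK g"
  shows "hact g v (hact f u a) = adj u a (\<lambda>p w. adj v w (\<lambda>q z. f p ** g q ** z))"
proof -
  have "hact g v (hact f u a) = adj u a (\<lambda>p w. f p ** hact g v w)"
    unfolding hact_def[of f] by (subst adj_out[where f="hact g v"]) (simp_all add: lin_scale[OF lin_hact'])
  then show ?thesis by (simp add: hact_def scl_adj)
qed

lemma contracts_cross:
  assumes [simp]: "linA u" "linA v"
  shows "contracts (\<lambda>f g. hact g v (hact f u a)) (cross v u a)"
  by (rule contracts_cong[where \<Psi>="\<lambda>f g. adj u a (\<lambda>p w. adj v w (\<lambda>q z. f p ** g q ** z))"])
     (simp_all add: cross_def contracts_intros hact_hact_comp)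

lemma adj_cou':
  assumes "linA \<psi>"
  shows "adj \<psi> a (\<lambda>p w. cou A p ** w) = \<psi> a"
  using adj_cou[OF lin_id assms] .

lemma cross_hact:
  assumes u: "linA u" and v: "linA v" and f: "linK f" and g: "linK g"
  shows "cross (hact f u) (hact g v) a = adj v a (\<lambda>p w. adj u w (\<lambda>q z. sw2 p q (\<lambda>p1 q1 p2 q2. 
     f q1 ** g p1 ** Rbar p2 q2 ** z)))"
proof -
  note [simp] = u v f g lin_comp[OF f] lin_comp[OF g] lin_comp[OF u] lin_comp[OF v]
  show ?thesis
    unfolding cross_def by (simp add: adj_hact scl_adj adj_sw scl_sw sw2_def scl_comm)
qed

text \<open>Interchanging twice is the identity: contracting the crossed composition once more produces
  \<open>R\<close> times \<open>Rbar\<close> on the coactions, hence \<open>u \<circ> v\<close>.\<close>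

lemma contracts_bracket_flip:
  assumes [simp]: "linA u" "linA v"
  shows "contracts (\<lambda>f g. bracket (hact g v) (hact f u) a) (- bracket u v a)"
proof -
  have "contracts (\<lambda>f g. cross (hact f u) (hact g v) a) (adj v a (\<lambda>p w. adj u w (\<lambda>q z. sw2 p q (\<lambda>p1 q1 p2 q2. 
      Rbar q1 p1 ** Rbar p2 q2 ** z))))"
    by (rule contracts_cong[OF _ cross_hact]) (simp_all add: sw2_def contracts_intros)
  moreover have "adj v a (\<lambda>p w. adj u w (\<lambda>q z. sw2 p q (\<lambda>p1 q1 p2 q2. 
      Rbar q1 p1 ** Rbar p2 q2 ** z))) = u (v a)"
  proof -
    have "sw2 p q (\<lambda>p1 q1 p2 q2. Rbar q1 p1 ** Rbar p2 q2 ** z) = cou A p ** cou A q ** z" for p q z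
      by (subst Rbar_flip) (rule R_Rbar)
    then show ?thesis by (simp add: scl_adj[symmetric] adj_cou adj_cou')
  qed
  ultimately have "contracts (\<lambda>f g. cross (hact f u) (hact g v) a) (u (v a))" by simp
  from contracts_diff[OF contracts_cross this, of u v a] show ?thesis
    by (simp add: bracket_def)
qed

text \<open>Equivariance of the bracket, with the pairs in \<open>fs\<close> in the role of the coproduct of
  \<open>f\<close>. The composition is equivariant because coactions multiply, the crossed one
  because of \<open>Rbar_comm\<close>.\<close>

lemma hact_bracket:
  assumes u: "linA u" and v: "linA v" and f: "linK f" 
   and fs: "\<And>x y. (\<Sum>(g, h)\<leftarrow>fs. g x * h y) = f (x * y)" 
   and l: "\<And>g h. (g, h) \<in> set fs \<Longrightarrow> linK g \<and> linK h"
  shows "hact f (bracket u v) a = (\<Sum>(g, h)\<leftarrow>fs. bracket (hact g u) (hact h v) a)"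
proof -
  note [simp] = u v f lin_comp[OF f] lin_comp[OF u] lin_comp[OF v]
  have fsv: "(\<Sum>(g, h)\<leftarrow>fs. g x ** h y ** z) = f (x * y) ** z" for x y z
  proof -
    have "linA (\<lambda>x. x)" by simp
    have ls: "lin (*) (scl A) (\<lambda>c. c ** z)" by simp
    show ?thesis unfolding fs[symmetric] case_prod_unfold lin_sum_list[OF ls] by (simp add: scale_scale)
  qed
  have fsv': "(\<Sum>(g, h)\<leftarrow>fs. h y ** g x ** z) = f (x * y) ** z" for x y z
    by (subst scl_comm) (rule fsv)
  have sl: "adj \<psi> b (\<lambda>p w. \<Sum>x\<leftarrow>xs. F p w x) = (\<Sum>x\<leftarrow>xs. adj \<psi> b (\<lambda>p w. F p w x))" for \<psi> b and xs :: "'z list" and F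
    by (simp add: adj_def sw_list_swap)
  have 1: "hact f (\<lambda>x. u (v x)) a = (\<Sum>(g, h)\<leftarrow>fs. hact g u (hact h v a))"
  proof -
    have "hact f (\<lambda>x. u (v x)) a = adj v a (\<lambda>q w. adj u w (\<lambda>p z. \<Sum>(g, h)\<leftarrow>fs. g p ** h q ** z))"
      unfolding hact_def fsv by (subst adj_comp) simp_all
    also have "\<dots> = (\<Sum>(g, h)\<leftarrow>fs. adj v a (\<lambda>q w. adj u w (\<lambda>p z. h q ** g p ** z)))"
      unfolding case_prod_unfold sl by (simp add: scl_comm)
    also have "\<dots> = (\<Sum>(g, h)\<leftarrow>fs. hact g u (hact h v a))"
      by (rule arg_cong[where f=sum_list], rule map_cong[OF refl]) (auto simp: hact_hact_comp l)
    finally show ?thesis .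
  qed
  have 2: "hact f (cross v u) a = (\<Sum>(g, h)\<leftarrow>fs. cross (hact h v) (hact g u) a)"
  proof -
    have "hact f (cross v u) a = adj u a (\<lambda>p w. adj v w (\<lambda>q z. sw2 p q (\<lambda>p1 q1 p2 q2. Rbar p1 q1 ** f (q2 * p2) ** z)))"
      unfolding hact_def by (subst adj_cross) simp_all
    also have "\<dots> = adj u a (\<lambda>p w. adj v w (\<lambda>q z. sw2 p q (\<lambda>p1 q1 p2 q2. Rbar p2 q2 ** f (p1 * q1) ** z)))"
      by (subst Rbar_comm) simp_all
    also have "\<dots> = adj u a (\<lambda>p w. adj v w (\<lambda>q z. sw2 p q (\<lambda>p1 q1 p2 q2. \<Sum>(g, h)\<leftarrow>fs. h q1 ** g p1 ** Rbar p2 q2 ** z)))"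
      unfolding fsv' by (subst scl_comm) rule
    also have "\<dots> = (\<Sum>(g, h)\<leftarrow>fs. adj u a (\<lambda>p w. adj v w (\<lambda>q z. sw2 p q (\<lambda>p1 q1 p2 q2. h q1 ** g p1 ** Rbar p2 q2 ** z))))"
      unfolding case_prod_unfold sl sw2_def sw_list_swap ..
    also have "\<dots> = (\<Sum>(g, h)\<leftarrow>fs. cross (hact h v) (hact g u) a)"
      by (rule arg_cong[where f=sum_list], rule map_cong[OF refl]) (auto simp: cross_hact l)
    finally show ?thesis .
  qed
  have "hact f (bracket u v) a = hact f (\<lambda>x. u (v x)) a - hact f (cross v u) a"
    unfolding hact_def bracket_def[abs_def] by (subst adj_op_diff) simp_all
  then show ?thesis unfolding 1 2 bracket_def 
    by (simp add: case_prod_unfold sum_list_subtractf)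
qed

text \<open>Both sides are \<open>Rbar(p\<^sub>1, q\<^sub>1) Rbar(p\<^sub>2, s\<^sub>1) Rbar(q\<^sub>2,
  s\<^sub>2)\<close>.\<close>

lemma yang_baxter:
  "sw2 q s (\<lambda>q1 s1 q2 s2. Rbar q1 s1 ** Rbar p (s2 * q2) ** z)
   = sw2 p q (\<lambda>p1 q1 p2 q2. Rbar p1 q1 ** Rbar (q2 * p2) s ** z)"
proof -
  have "sw2 q s (\<lambda>q1 s1 q2 s2. Rbar q1 s1 ** Rbar p (s2 * q2) ** z)
    = sw2 q s (\<lambda>q1 s1 q2 s2. Rbar q2 s2 ** Rbar p (q1 * s1) ** z)"
    by (subst Rbar_comm) simp_all
  also have "\<dots> = sw A p (\<lambda>p1 p2. sw A q (\<lambda>q1 q2. sw A s (\<lambda>s1 s2. Rbar p1 q1 ** Rbar p2 s1 ** Rbar q2 s2 ** z)))"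
    by (simp add: sw2_def Rbar_mult_right scl_sw sw_swap[where b=p] scl_comm)
  also have "\<dots> = sw2 p q (\<lambda>p1 q1 p2 q2. Rbar p1 q1 ** Rbar (q2 * p2) s ** z)"
    by (simp add: sw2_def Rbar_mult_left scl_sw)
  finally show ?thesis .
qed

lemma cross_yang_baxter:
  assumes [simp]: "linA u" "linA v" "linA w"
  shows "cross (cross w v) u a = cross w (cross v u) a"
proof -
  have "cross (cross w v) u a = adj u a (\<lambda>p x. adj v x (\<lambda>q y. adj w y (\<lambda>s z. 
     sw2 q s (\<lambda>q1 s1 q2 s2. Rbar q1 s1 ** Rbar p (s2 * q2) ** z))))"
    unfolding cross_def[of _ u] by (subst adj_cross) simp_all
  moreover have "cross w (cross v u) a = adj u a (\<lambda>p x. adj v x (\<lambda>q y. adj w y (\<lambda>s z. 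
     sw2 p q (\<lambda>p1 q1 p2 q2. Rbar p1 q1 ** Rbar (q2 * p2) s ** z))))"
    unfolding cross_def[of w] by (subst adj_cross) (simp_all add: scl_adj adj_sw sw2_def)
  ultimately show ?thesis by (simp only: yang_baxter)
qed

text \<open>Expanding the brackets composes \<open>u\<close>, \<open>v\<close>, \<open>w\<close> in all six
  orders. Facts 1 to 4 evaluate the contracted terms, each by an identity between scalars
  \<open>Rbar\<close> on the coactions of \<open>u\<close>, \<open>v\<close>, \<open>w\<close>;
  the two remaining terms, of order \<open>w v u\<close>, agree by
  \<open>cross_yang_baxter\<close>.\<close>

lemma contracts_jacobi:
  assumes u: "linA u" and v: "linA v" and w: "linA w"
  shows "contracts (\<lambda>f g. bracket (hact g v) (bracket (hact f u) w) a) (bracket u (bracket v w) a - bracket (bracket u v) w a)"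
proof -
  note [simp] = u v w lin_comp[OF u] lin_comp[OF v] lin_comp[OF w]
  have 1: "contracts (\<lambda>f g. hact g v (hact f u (w a))) (cross v u (w a))"
    by (rule contracts_cross) simp_all
  have 2: "contracts (\<lambda>f g. hact g v (cross w (hact f u) a)) (cross (\<lambda>x. v (w x)) u a)"
  proof -
    let ?N = "\<lambda>m. adj u a (\<lambda>p x. sw A p (\<lambda>p1 p2. adj w x (\<lambda>s y. adj v y (\<lambda>q z. Rbar p2 s ** m p1 q z))))"
    show ?thesis
    proof (rule contractsI)
      fix f g assume fg: "linK f" "linK g"
      note [simp] = fg lin_comp[OF fg(1)] lin_comp[OF fg(2)]
      have l: "linA (hact g v)" by simp
      show "hact g v (cross w (hact f u) a) = ?N (\<lambda>p q z. f p ** g q ** z)"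
        unfolding cross_def
        by (simp add: adj_hact adj_out[OF l] sw_out[OF l] lin_scale[OF l])
           (simp add: hact_def scl_adj scl_comm)
    next
      show "contracts (\<lambda>f g. ?N (\<lambda>p q z. f p ** g q ** z)) (?N (\<lambda>p q z. Rbar p q ** z))"
        by (intro contracts_intros)
      show "?N (\<lambda>p q z. Rbar p q ** z) = cross (\<lambda>x. v (w x)) u a"
        unfolding cross_def by (simp add: adj_comp Rbar_mult_right adj_sw scl_comm)
    qed
  qed
  have 3: "contracts (\<lambda>f g. cross (\<lambda>x. hact f u (w x)) (hact g v) a) (u (cross w v a))"
  proof -
    let ?N = "\<lambda>m. adj v a (\<lambda>q x. adj w x (\<lambda>s y. adj u y (\<lambda>p z. sw2 q p (\<lambda>q1 p1 q2 p2. Rbar q2 (p2 * s) ** m p1 q1 z))))"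
    have c: "sw2 q p (\<lambda>q1 p1 q2 p2. Rbar q2 (p2 * s) ** Rbar p1 q1 ** z) = cou A p ** Rbar q s ** z" for q p s z
    proof -
      have "sw2 q p (\<lambda>q1 p1 q2 p2. Rbar q2 (p2 * s) ** Rbar p1 q1 ** z)
        = sw2 q p (\<lambda>q1 p1 q2 p2. R q1 p1 ** Rbar q2 (p2 * s) ** z)"
        by (subst (2) Rbar_flip) (simp only: scl_comm)
      also have "\<dots> = sw A q (\<lambda>q1 t. sw A t (\<lambda>q2 q3. sw A p (\<lambda>p1 p2. R q1 p1 ** Rbar q2 p2 ** Rbar q3 s ** z)))"
        by (simp add: sw2_def Rbar_mult_right scl_sw sw_swap[where a=p])
      also have "\<dots> = sw A q (\<lambda>e q3. sw2 e p (\<lambda>q1 p1 q2 p2. R q1 p1 ** Rbar q2 p2 ** Rbar q3 s ** z))"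
        by (simp add: sw2_def coassoc_A)
      also have "\<dots> = sw A q (\<lambda>e q3. cou A e ** cou A p ** Rbar q3 s ** z)"
        by (simp add: R_Rbar)
      also have "\<dots> = cou A p ** Rbar q s ** z"
        by (subst sw_cou_left[where sv="scl A"]) simp_all
      finally show ?thesis .
    qed
    show ?thesis
    proof (rule contractsI)
      fix f g assume fg: "linK f" "linK g"
      note [simp] = fg lin_comp[OF fg(1)] lin_comp[OF fg(2)]
      show "cross (\<lambda>x. hact f u (w x)) (hact g v) a = ?N (\<lambda>p q z. f p ** g q ** z)"
        unfolding cross_def
        by (simp add: adj_hact adj_comp lin_comp sw2_def adj_sw scl_sw scl_adj scl_comm)
    next
      show "contracts (\<lambda>f g. ?N (\<lambda>p q z. f p ** g q ** z)) (?N (\<lambda>p q z. Rbar p q ** z))"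
        unfolding sw2_def by (intro contracts_intros)
      show "?N (\<lambda>p q z. Rbar p q ** z) = u (cross w v a)"
        by (simp add: c cross_def adj_out[OF u] lin_scale[OF u] adj_cou)
    qed
  qed
  have 4: "contracts (\<lambda>f g. cross (cross w (hact f u)) (hact g v) a) (cross w (\<lambda>x. u (v x)) a)"
  proof -
    let ?N = "\<lambda>m. adj v a (\<lambda>q x. adj u x (\<lambda>p y. adj w y (\<lambda>s z. sw2 q p (\<lambda>q1 p1 q2 p2. sw2 p2 s (\<lambda>p2 s1 p3 s2. Rbar p2 s1 ** Rbar q2 (s2 * p3) ** m p1 q1 z)))))"
    have c: "sw2 q p (\<lambda>q1 p1 q2 p2. sw2 p2 s (\<lambda>p2 s1 p3 s2. Rbar p2 s1 ** Rbar q2 (s2 * p3) ** Rbar p1 q1 ** z))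
      = Rbar (p * q) s ** z" for q p s z
    proof -
      have e: "sw2 p2 s (\<lambda>p2 s1 p3 s2. Rbar p2 s1 ** Rbar q2 (s2 * p3) ** Rbar p1 q1 ** z)
        = sw2 q2 p2 (\<lambda>q2 p2 q3 p3. Rbar p1 q1 ** Rbar q2 p2 ** Rbar (p3 * q3) s ** z)" for p1 q1 p2 q2
        unfolding yang_baxter by (simp add: scl_comm)
      have "sw2 q p (\<lambda>q1 p1 q2 p2. sw2 p2 s (\<lambda>p2 s1 p3 s2. Rbar p2 s1 ** Rbar q2 (s2 * p3) ** Rbar p1 q1 ** z))
        = sw2 q p (\<lambda>q1 p1 t t'. sw2 t t' (\<lambda>q2 p2 q3 p3. R q1 p1 ** Rbar q2 p2 ** Rbar (p3 * q3) s ** z))"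
        unfolding e by (subst Rbar_flip) rule
      also have "\<dots> = Rbar (p * q) s ** z"
        by (subst R_Rbar_cancel(1)) simp_all
      finally show ?thesis .
    qed
    show ?thesis
    proof (rule contractsI)
      fix f g assume fg: "linK f" "linK g"
      note [simp] = fg lin_comp[OF fg(1)] lin_comp[OF fg(2)]
      show "cross (cross w (hact f u)) (hact g v) a = ?N (\<lambda>p q z. f p ** g q ** z)"
        unfolding cross_def[of _ "hact g v"]
        by (simp add: adj_hact adj_cross sw2_def adj_sw scl_sw scl_adj scl_comm)
    next
      show "contracts (\<lambda>f g. ?N (\<lambda>p q z. f p ** g q ** z)) (?N (\<lambda>p q z. Rbar p q ** z))"
        unfolding sw2_def by (intro contracts_intros)
      show "?N (\<lambda>p q z. Rbar p q ** z) = cross w (\<lambda>x. u (v x)) a"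
        by (simp add: c cross_def adj_comp)
    qed
  qed
  have cd: "cross (\<lambda>x. h x - k x) \<psi> a = cross h \<psi> a - cross k \<psi> a" for h k \<psi> a
    unfolding cross_def by (simp add: adj_op_diff adj_diff)
  have cd': "cross h (\<lambda>x. \<psi> x - k x) a = cross h \<psi> a - cross h k a" if [simp]: "linA h" for h k \<psi> a
    unfolding cross_def by (simp add: adj_op_diff)
  have "contracts (\<lambda>f g. bracket (hact g v) (bracket (hact f u) w) a)
    (cross v u (w a) - cross (\<lambda>x. v (w x)) u a - (u (cross w v a) - cross w (\<lambda>x. u (v x)) a))"
  proof (rule contracts_cong)
    show "contracts (\<lambda>f g. hact g v (hact f u (w a)) - hact g v (cross w (hact f u) a) - 
      (cross (\<lambda>x. hact f u (w x)) (hact g v) a - cross (cross w (hact f u)) (hact g v) a))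
     (cross v u (w a) - cross (\<lambda>x. v (w x)) u a - (u (cross w v a) - cross w (\<lambda>x. u (v x)) a))"
      by (intro contracts_diff 1 2 3 4)
    show "bracket (hact g v) (bracket (hact f u) w) a = hact g v (hact f u (w a)) - hact g v (cross w (hact f u) a) - 
      (cross (\<lambda>x. hact f u (w x)) (hact g v) a - cross (cross w (hact f u)) (hact g v) a)" 
      if "linK f" "linK g" for f g 
      unfolding bracket_def cd using lin_diff[OF lin_hact'[OF that(2) v]] by simp
  qed
  moreover have "cross v u (w a) - cross (\<lambda>x. v (w x)) u a - (u (cross w v a) - cross w (\<lambda>x. u (v x)) a) 
     = bracket u (bracket v w) a - bracket (bracket u v) w a"
    unfolding bracket_def by (simp add: cd cd' lin_diff[OF u] cross_yang_baxter algebra_simps)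
  ultimately show ?thesis by simp
qed

end

section \<open>Well-definedness of contractions\<close>

text \<open>The element \<open>c0\<close> generates the maximal ideal; it is 0 for a field and the variable
  for power series.\<close>

definition adically_separated :: "'k::comm_ring_1 itself \<Rightarrow> bool" where
  "adically_separated _ \<longleftrightarrow> (\<exists>c0::'k. (\<forall>c. \<not> c dvd 1 \<longrightarrow> c0 dvd c) \<and> (\<forall>x. (\<forall>n. c0 ^ n dvd x) \<longrightarrow> x = 0))"

text \<open>Uniqueness of the value in the definition of \<open>contract\<close>.\<close>

definition determined :: "('k::comm_ring_1, 'q, 'c) triang \<Rightarrow> ('k \<Rightarrow> 'v::ab_group_add \<Rightarrow> 'v) \<Rightarrow> bool" where
  "determined K s \<longleftrightarrow> (\<forall>ts. (\<forall>r r'. (\<Sum>(p, q, w)\<leftarrow>ts. s (tpair K r p * tpair K r' q) w) = 0) \<longrightarrow>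
     (\<Sum>(p, q, w)\<leftarrow>ts. s (trmat K p q) w) = 0)"

lemma contract_eqI:
  assumes det: "determined K s" and m: "module s"
    and 1: "\<And>r r'. \<Phi> r r' = (\<Sum>(p, q, w)\<leftarrow>ts. s (tpair K r p * tpair K r' q) w)"
    and 2: "v = (\<Sum>(p, q, w)\<leftarrow>ts. s (trmat K p q) w)"
  shows "contract K s \<Phi> = v"
  unfolding contract_def
proof (rule the_equality)
  show "\<exists>ts. (\<forall>r r'. \<Phi> r r' = (\<Sum>(p, q, w)\<leftarrow>ts. s (tpair K r p * tpair K r' q) w)) \<and>
        v = (\<Sum>(p, q, w)\<leftarrow>ts. s (trmat K p q) w)"
    using 1 2 by blast
next
  fix v' assume "\<exists>ts. (\<forall>r r'. \<Phi> r r' = (\<Sum>(p, q, w)\<leftarrow>ts. s (tpair K r p * tpair K r' q) w)) \<and>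
        v' = (\<Sum>(p, q, w)\<leftarrow>ts. s (trmat K p q) w)"
  then obtain ts' where 3: "\<And>r r'. \<Phi> r r' = (\<Sum>(p, q, w)\<leftarrow>ts'. s (tpair K r p * tpair K r' q) w)"
    and 4: "v' = (\<Sum>(p, q, w)\<leftarrow>ts'. s (trmat K p q) w)" by blast
  have neg: "(\<Sum>(p, q, w)\<leftarrow>ts' @ map (\<lambda>(p, q, w). (p, q, - w)) ts. s (h p q) w)
     = (\<Sum>(p, q, w)\<leftarrow>ts'. s (h p q) w) - (\<Sum>(p, q, w)\<leftarrow>ts. s (h p q) w)" for h
    by (simp add: case_prod_unfold comp_def module.scale_minus_right[OF m] uminus_sum_list_map[unfolded comp_def, symmetric])
  have "(\<Sum>(p, q, w)\<leftarrow>ts' @ map (\<lambda>(p, q, w). (p, q, - w)) ts. s (trmat K p q) w) = 0"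
    using det unfolding determined_def by (rule allE) (erule mp, simp only: neg 1[symmetric] 3[symmetric], simp)
  then show "v' = v" unfolding neg 2 4 by simp
qed

lemma dvd_sum_list: "(\<And>x. x \<in> set xs \<Longrightarrow> d dvd f x) \<Longrightarrow> d dvd (\<Sum>x\<leftarrow>xs. f x :: 'k::comm_ring_1)"
  by (induction xs) auto

text \<open>Apply the separating pairing: replacing \<open>F\<close> by an approximation gives 0, with an
  error divisible by the n-th power of the maximal ideal.\<close>

lemma completion_determined:
  fixes s :: "'k::comm_ring_1 \<Rightarrow> 'v::ab_group_add \<Rightarrow> 'v"
  assumes sep: "adically_separated TYPE('k)" and compl: "in_completion C tp F"
    and lin: "\<And>\<zeta>. lin s (*) (pr \<zeta>)" and pr: "separates pr"
    and z: "\<And>r r'. (\<Sum>(p, q, w)\<leftarrow>ts. s (tp r p * tp r' q) w) = 0"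
  shows "(\<Sum>(p, q, w)\<leftarrow>ts. s (F p q) w) = 0"
proof -
  obtain c0 :: 'k where c0: "\<And>c. \<not> c dvd 1 \<Longrightarrow> c0 dvd c" "\<And>x. (\<forall>n. c0 ^ n dvd x) \<Longrightarrow> x = 0"
    using sep unfolding adically_separated_def by blast
  have e: "pr \<zeta> (\<Sum>(p, q, w)\<leftarrow>ts. s (h p q) w) = (\<Sum>(p, q, w)\<leftarrow>ts. h p q * pr \<zeta> w)" for \<zeta> h
    unfolding case_prod_unfold lin_sum_list[OF lin] by (simp add: lin_scale[OF lin])
  have "pr \<zeta> (\<Sum>(p, q, w)\<leftarrow>ts. s (F p q) w) = 0" for \<zeta>
  proof (rule c0(2), rule allI)
    fix n
    have "\<exists>t. \<forall>(a, b)\<in>(\<lambda>(p, q, w). (p, q)) ` set ts. adic_close n (\<Sum>(\<xi>, \<eta>)\<leftarrow>t. tp \<xi> a * tp \<eta> b) (F a b)"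
      using compl unfolding in_completion_def by (elim conjE allE[of _ n] allE[of _ "(\<lambda>(p, q, w). (p, q)) ` set ts"]) auto
    then obtain t where t: "\<And>a b. (a, b) \<in> (\<lambda>(p, q, w). (p, q)) ` set ts \<Longrightarrow> adic_close n (\<Sum>(\<xi>, \<eta>)\<leftarrow>t. tp \<xi> a * tp \<eta> b) (F a b)"
      by blast
    have "(\<Sum>(p, q, w)\<leftarrow>ts. (\<Sum>(\<xi>, \<eta>)\<leftarrow>t. tp \<xi> p * tp \<eta> q) * pr \<zeta> w) = (\<Sum>(\<xi>, \<eta>)\<leftarrow>t. \<Sum>(p, q, w)\<leftarrow>ts. (tp \<xi> p * tp \<eta> q) * pr \<zeta> w)"
      unfolding case_prod_unfold sum_list_mult_const[symmetric] by (rule sum_list_swap)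
    also have "\<dots> = (\<Sum>(\<xi>, \<eta>)\<leftarrow>t. pr \<zeta> 0)"
      unfolding e[symmetric] z ..
    finally have 0: "(\<Sum>(p, q, w)\<leftarrow>ts. (\<Sum>(\<xi>, \<eta>)\<leftarrow>t. tp \<xi> p * tp \<eta> q) * pr \<zeta> w) = 0"
      by (simp add: lin_zero[OF lin] case_prod_unfold)
    have "c0 ^ n dvd (\<Sum>(p, q, w)\<leftarrow>ts. ((\<Sum>(\<xi>, \<eta>)\<leftarrow>t. tp \<xi> p * tp \<eta> q) - F p q) * pr \<zeta> w)"
    proof (rule dvd_sum_list)
      fix x assume x: "x \<in> set ts"
      obtain p q w where [simp]: "x = (p, q, w)" by (cases x)
      have "adic_close n (\<Sum>(\<xi>, \<eta>)\<leftarrow>t. tp \<xi> p * tp \<eta> q) (F p q)" using t[of p q] x by force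
      then obtain c where "\<not> c dvd 1" "c ^ n dvd (\<Sum>(\<xi>, \<eta>)\<leftarrow>t. tp \<xi> p * tp \<eta> q) - F p q"
        unfolding adic_close_def by blast
      then have "c0 ^ n dvd (\<Sum>(\<xi>, \<eta>)\<leftarrow>t. tp \<xi> p * tp \<eta> q) - F p q"
        using c0(1) dvd_power_same dvd_trans by blast
      then show "c0 ^ n dvd (case x of (p, q, w) \<Rightarrow> ((\<Sum>(\<xi>, \<eta>)\<leftarrow>t. tp \<xi> p * tp \<eta> q) - F p q) * pr \<zeta> w)"
        by simp
    qed
    also have "(\<Sum>(p, q, w)\<leftarrow>ts. ((\<Sum>(\<xi>, \<eta>)\<leftarrow>t. tp \<xi> p * tp \<eta> q) - F p q) * pr \<zeta> w)
      = - (\<Sum>(p, q, w)\<leftarrow>ts. F p q * pr \<zeta> w)"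
      using 0 by (simp add: left_diff_distrib case_prod_unfold sum_list_subtractf)
    finally show "c0 ^ n dvd pr \<zeta> (\<Sum>(p, q, w)\<leftarrow>ts. s (F p q) w)"
      by (simp add: e)
  qed
  then show ?thesis using pr unfolding separates_def by blast
qed

lemma determined_op_triang:
  fixes s :: "'k::comm_ring_1 \<Rightarrow> 'v::ab_group_add \<Rightarrow> 'v"
  assumes "adically_separated TYPE('k)" "in_completion C tp F" "\<And>\<zeta>. lin s (*) (pr \<zeta>)" "separates pr"
  shows "determined (op_triang U tp F) s"
  unfolding determined_def op_triang_def using completion_determined[OF assms] by simp

text \<open>Contract with one universal matrix after the other.\<close>

lemma determined_op_tensor_triang:
  fixes s :: "'k::comm_ring_1 \<Rightarrow> 'v::ab_group_add \<Rightarrow> 'v" and C :: "('k, 'c::ring_1) hopf"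
  assumes "adically_separated TYPE('k)" "in_completion C tp F" "in_completion C tp G" 
   "\<And>\<zeta>. lin s (*) (pr \<zeta>)" "separates pr" and m: "module s"
  shows "determined (op_tensor_triang U tp G F) s"
  unfolding determined_def
proof (intro allI impI)
  fix ts :: "(('c \<times> 'c) \<times> ('c \<times> 'c) \<times> 'v) list"
  assume z0: "\<forall>r r'. (\<Sum>(p, q, w)\<leftarrow>ts. s (tpair (op_tensor_triang U tp G F) r p * tpair (op_tensor_triang U tp G F) r' q) w) = 0"
  have ss: "s (a * b) w = s a (s b w)" for a b w using module.scale_scale[OF m] by simp
  have z: "(\<Sum>(p, q, w)\<leftarrow>ts. s (tp \<zeta> (fst p) * tp \<zeta>' (fst q)) (s (tp \<xi> (snd p) * tp \<xi>' (snd q)) w)) = 0" for \<zeta> \<zeta>' \<xi> \<xi>'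
    using z0[rule_format, of "(\<zeta>, \<xi>)" "(\<zeta>', \<xi>')"] unfolding op_tensor_triang_def 
    by (simp add: case_prod_unfold ss[symmetric] ac_simps)
  have 1: "(\<Sum>(p, q, w)\<leftarrow>map (\<lambda>(p, q, w). (fst p, fst q, s (tp \<xi> (snd p) * tp \<xi>' (snd q)) w)) ts. s (F p q) w) = 0" for \<xi> \<xi>'
    by (rule completion_determined[OF assms(1,2,4,5)]) (use z in \<open>simp add: case_prod_unfold comp_def\<close>)
  have "(\<Sum>(p, q, w)\<leftarrow>map (\<lambda>(p, q, w). (snd p, snd q, s (F (fst p) (fst q)) w)) ts. s (G p q) w) = 0"
    by (rule completion_determined[OF assms(1,3,4,5)]) 
       (use 1 in \<open>simp add: case_prod_unfold comp_def module.scale_left_commute[OF m, of "F _ _"]\<close>)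
  then show "(\<Sum>(p, q, w)\<leftarrow>ts. s (trmat (op_tensor_triang U tp G F) p q) w) = 0"
    unfolding op_tensor_triang_def by (simp add: case_prod_unfold comp_def ss[symmetric] mult.commute)
qed

context cotriangular_bij
begin

definition lact :: "('a \<Rightarrow> 'k) \<Rightarrow> 'a \<Rightarrow> 'a" where "lact f a = sw A a (\<lambda>x y. f x ** y)"

definition ract :: "('a \<Rightarrow> 'k) \<Rightarrow> 'a \<Rightarrow> 'a" where "ract f a = sw A a (\<lambda>x y. f y ** x)"

lemma lin_lact [simp]: "lin s (scl A) g \<Longrightarrow> linK f \<Longrightarrow> lin s (scl A) (\<lambda>x. lact f (g x))"
  unfolding lact_def by simp

lemma lin_ract [simp]: "lin s (scl A) g \<Longrightarrow> linK f \<Longrightarrow> lin s (scl A) (\<lambda>x. ract f (g x))"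
  unfolding ract_def by simp

text \<open>The map \<open>\<pi>\<close> is the identity for the dual of \<open>A\<close> and the projection
  for the dual of \<open>H\<close>. As the matrix of \<open>A\<close> factors through
  \<open>\<pi>\<close>, both contractions have the same value.\<close>

lemma contract_contracts:
  assumes c: "contracts \<Phi> v" and det: "determined T (scl A)" 
    and pr: "\<And>r. linK (pr r)" "\<And>r p. tpair T r (\<pi> p) = pr r p" and rm: "\<And>p q. trmat T (\<pi> p) (\<pi> q) = Rbar p q"
  shows "contract T (scl A) (\<lambda>r r'. \<Phi> (pr r) (pr r')) = v"
proof -
  from c obtain ts where ts: "\<And>f g. linK f \<Longrightarrow> linK g \<Longrightarrow> \<Phi> f g = (\<Sum>(p, q, w)\<leftarrow>ts. (f p * g q) ** w)"
      "v = (\<Sum>(p, q, w)\<leftarrow>ts. Rbar p q ** w)" unfolding contracts_def by blast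
  show ?thesis
    by (rule contract_eqI[OF det, where ts="map (\<lambda>(p, q, w). (\<pi> p, \<pi> q, w)) ts"])
       (simp_all add: ts pr rm case_prod_unfold comp_def)
qed

end

section \<open>Actions of a dual Hopf algebra\<close>

text \<open>Both sides are convolution inverses of the pairing: collapse \<open>pr (S k\<^sub>1) a\<^sub>1
  pr k\<^sub>2 a\<^sub>2 pr k\<^sub>3 (S a\<^sub>3)\<close> in two ways.\<close>

lemma pairing_ant:
  assumes "hopf_algebra A" "hopf_algebra K" "hopf_pairing K A pr"
  shows "pr (ant K k) a = pr k (ant A a)"
proof -
  interpret A: hopf_algebra A by fact
  interpret K: hopf_algebra K by fact
  have l1: "A.linV (*) (pr k)" and l2: "K.linV (*) (\<lambda>k. pr k a)" for k a
    using assms(3) by (simp_all add: hopf_pairing_def lin_iff_module_hom)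
  note [simp] = lin_comp[OF l1] lin_comp[OF l2] l1 l2
  have m1: "pr (\<xi> * \<eta>) a = sw A a (\<lambda>x y. pr \<xi> x * pr \<eta> y)" and m2: "pr \<xi> (a * b) = sw K \<xi> (\<lambda>x y. pr x a * pr y b)"
    and u: "pr 1 a = cou A a" "pr \<xi> 1 = cou K \<xi>" for \<xi> \<eta> a b
    using assms(3) by (simp_all add: hopf_pairing_def sw_def)
  have sm: "c * sw B b F = sw B b (\<lambda>x y. c * F x y)" "sw B b F * c = sw B b (\<lambda>x y. F x y * c)" for c :: 'a and B :: "('a, 'd) hopf" and b F
    using sw_out[of "(*)" "(*)" "\<lambda>z. c * z" B b F] sw_out[of "(*)" "(*)" "\<lambda>z. z * c" B b F] by (simp_all add: lin_mult_k)
  define X where "X = sw A a (\<lambda>p t'. sw A t' (\<lambda>q r. sw K k (\<lambda>x t. sw K t (\<lambda>y z. pr (ant K x) p * (pr y q * pr z (ant A r))))))"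
  have "X = sw A a (\<lambda>p t'. sw A t' (\<lambda>q r. sw K k (\<lambda>x t. pr (ant K x) p * pr t (q * ant A r))))"
    unfolding X_def m2 sm ..
  also have "\<dots> = sw A a (\<lambda>p t'. cou A t' * (sw K k (\<lambda>x t. pr (ant K x) p * pr t 1)))"
    by (subst A.sw_ant_right[where sv="(*)" and f="\<lambda>z. sw K k (\<lambda>x t. pr (ant K x) _ * pr t z)"]) simp_all
  also have "\<dots> = sw K k (\<lambda>x t. pr (ant K x) a * pr t 1)"
    by (subst A.sw_cou_right[where sv="(*)"]) simp_all
  also have "\<dots> = pr (ant K k) a"
    by (subst mult.commute, unfold u, subst K.sw_cou_right[where sv="(*)"]) simp_all
  finally have 1: "X = pr (ant K k) a" .
  have "X = sw A a (\<lambda>t r. sw A t (\<lambda>p q. sw K k (\<lambda>x t. sw K t (\<lambda>y z. pr (ant K x) p * (pr y q * pr z (ant A r))))))"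
    unfolding X_def by (subst A.sw_coassoc[where sv="(*)"]) simp_all
  also have "\<dots> = sw A a (\<lambda>t r. sw A t (\<lambda>p q. sw K k (\<lambda>t z. sw K t (\<lambda>x y. pr (ant K x) p * (pr y q * pr z (ant A r))))))"
    by (subst K.sw_coassoc[where sv="(*)"]) simp_all
  also have "\<dots> = sw A a (\<lambda>t r. sw K k (\<lambda>s z. sw K s (\<lambda>x y. sw A t (\<lambda>p q. pr (ant K x) p * pr y q * pr z (ant A r)))))"
    by (subst (2) sw_swap, subst (3) sw_swap) (simp add: mult.assoc)
  also have "\<dots> = sw A a (\<lambda>t r. sw K k (\<lambda>s z. sw K s (\<lambda>x y. pr (ant K x * y) t * pr z (ant A r))))"
    by (simp add: m1 sm)
  also have "\<dots> = sw A a (\<lambda>t r. sw K k (\<lambda>s z. cou K s * (pr 1 t * pr z (ant A r))))"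
    by (subst K.sw_ant_left[where sv="(*)" and f="\<lambda>z. pr z _ * pr _ (ant A _)"]) simp_all
  also have "\<dots> = sw A a (\<lambda>t r. cou A t * pr k (ant A r))"
    by (subst K.sw_cou_left[where sv="(*)"]) (simp_all add: u)
  also have "\<dots> = pr k (ant A a)"
    by (subst A.sw_cou_left[where sv="(*)"]) simp_all
  finally show ?thesis using 1 by simp
qed

locale paired_cotriangular = cotriangular_bij A R Rbar + K: hopf_algebra K
  for A :: "('k::comm_ring_1, 'a::ring_1) hopf" and R Rbar and K :: "('k, 'u::ring_1) hopf" +
  fixes pr :: "'u \<Rightarrow> 'a \<Rightarrow> 'k"
  assumes pairing: "hopf_pairing K A pr" and bij_antK: "bij (ant K)"
begin

lemma lin_pr_right [simp]: "linK (pr k)" and lin_pr_left0: "K.linV (*) (\<lambda>k. pr k a)"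
  using pairing by (simp_all add: hopf_pairing_def lin_iff_module_hom)

lemma lin_pr' [simp]: "lin s (scl K) f \<Longrightarrow> lin s (*) (\<lambda>x. pr (f x) a)"
  by (rule lin_comp[OF lin_pr_left0])

lemma pr_mult: "pr (\<xi> * \<eta>) a = sw A a (\<lambda>x y. pr \<xi> x * pr \<eta> y)" 
  and pr_one_left: "pr 1 a = cou A a"
  using pairing by (simp_all add: hopf_pairing_def sw_def)

lemma pr_mult_list: "(\<Sum>(p, q)\<leftarrow>cop K \<xi>. pr p a * pr q b) = pr \<xi> (a * b)"
  using pairing by (simp add: hopf_pairing_def)

lemma pr_mult_right: "sw K \<xi> (\<lambda>x y. scl A (pr x a) (scl A (pr y b) v)) = scl A (pr \<xi> (a * b)) v"
proof -
  have "pr \<xi> (a * b) = sw K \<xi> (\<lambda>x y. pr x a * pr y b)" using pairing by (simp add: hopf_pairing_def sw_def)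
  then show ?thesis by (simp add: sw_out[where s="(*)" and s'="scl A" and f="\<lambda>c. scl A c v"] scale_scale)
qed

lemma pr_mult_left: "sw A a (\<lambda>x y. scl A (pr \<xi> x) (scl A (pr \<eta> y) v)) = scl A (pr (\<xi> * \<eta>) a) v"
  by (simp add: pr_mult sw_out[where s="(*)" and s'="scl A" and f="\<lambda>c. scl A c v"] scale_scale)

lemma pr_ant: "pr (ant K k) a = pr k (ant A a)"
  by (rule pairing_ant[OF _ _ pairing]) unfold_locales

lemma pr_inv_ant: "pr (inv (ant K) k) a = pr k (Sinv a)"
  using pr_ant[of "inv (ant K) k" "Sinv a"] bij_antK by (simp add: bij_is_surj surj_f_inv_f)

lemma left_act_lact: "left_act A pr \<zeta> = lact (pr \<zeta>)"
  by (rule ext) (simp add: left_act_def lact_def sw_def)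

lemma bi_act_lact: "bi_act A pr (\<zeta>, \<xi>) a = lact (pr \<zeta>) (ract (pr \<xi>) a)"
proof -
  have l: "linA (lact (pr \<zeta>))" using lin_lact[OF lin_id] by simp
  have "lact (pr \<zeta>) (ract (pr \<xi>) a) = sw A a (\<lambda>t z. sw A t (\<lambda>x y. pr \<zeta> x ** pr \<xi> z ** y))"
    unfolding ract_def by (simp add: sw_out[OF l] lin_scale[OF l]) (simp add: lact_def scl_sw scl_comm)
  also have "\<dots> = sw A a (\<lambda>x t. sw A t (\<lambda>y z. pr \<zeta> x ** pr \<xi> z ** y))"
    by (subst coassoc_A) simp_all
  also have "\<dots> = bi_act A pr (\<zeta>, \<xi>) a"
    unfolding bi_act_def by (simp add: sw3_eq scale_scale)
  finally show ?thesis by simp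
qed

text \<open>The antipode of the opposite Hopf algebra is the inverse of that of \<open>K\<close> and
  contributes \<open>S\<inverse>(a\<^sub>1)\<close>; the coproduct of \<open>k\<close> fuses both
  pairings into one with the adjoint coaction.\<close>

lemma hom_act_left:
  assumes \<psi>: "linA \<psi>"
  shows "hom_act (op_triang K pr' Q) (left_act A pr) k \<psi> = hact (pr k) \<psi>"
proof
  fix a
  note [simp] = lin_comp[OF \<psi>] \<psi>
  have "hom_act (op_triang K pr' Q) (left_act A pr) k \<psi> a
     = sw K k (\<lambda>p q. lact (pr p) (\<psi> (lact (pr (inv (ant K) q)) a)))"
    by (simp add: hom_act_def op_triang_def sw_def left_act_lact)
  also have "\<dots> = sw A a (\<lambda>x y. sw A (\<psi> y) (\<lambda>c d. sw K k (\<lambda>p q. pr p c ** pr q (Sinv x) ** d)))"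
  proof -
    have l: "linA (\<lambda>z. lact (pr p) (\<psi> z))" for p by simp
    have "lact (pr p) (\<psi> (lact (pr (inv (ant K) q)) a)) 
       = sw A a (\<lambda>x y. sw A (\<psi> y) (\<lambda>c d. pr p c ** pr q (Sinv x) ** d))" for p q
      unfolding lact_def[of "pr (inv _ q)"] 
      by (simp add: sw_out[OF l] lin_scale[OF l] pr_inv_ant) (simp add: lact_def scl_sw scl_comm)
    then show ?thesis by (simp add: sw_swap[where a=k])
  qed
  also have "\<dots> = hact (pr k) \<psi> a"
    by (simp add: pr_mult_right hact_def adj_def)
  finally show "hom_act (op_triang K pr' Q) (left_act A pr) k \<psi> a = hact (pr k) \<psi> a" .
qed

lemma hom_act_bi:
  assumes \<psi>: "linA \<psi>"
  shows "hom_act (op_tensor_triang K pr' Q Q') (bi_act A pr) (\<zeta>, \<xi>) \<psi> a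
    = sw A a (\<lambda>x t. sw A t (\<lambda>y v. sw A (\<psi> y) (\<lambda>c d. sw A d (\<lambda>d1 d2. 
        pr \<zeta> (c * Sinv x) ** pr \<xi> (d2 * ant A v) ** d1))))"
proof -
  note [simp] = lin_comp[OF \<psi>] \<psi>
  have "hom_act (op_tensor_triang K pr' Q Q') (bi_act A pr) (\<zeta>, \<xi>) \<psi> a
     = sw K \<zeta> (\<lambda>p q. sw K \<xi> (\<lambda>r s. bi_act A pr (p, r) (\<psi> (bi_act A pr (inv (ant K) q, ant K s) a))))"
    by (simp add: hom_act_def op_tensor_triang_def sw_def sum_list_concat_map case_prod_unfold comp_def)
  also have "\<dots> = sw K \<zeta> (\<lambda>p q. sw K \<xi> (\<lambda>r s. sw A a (\<lambda>x t. sw A t (\<lambda>y v. sw A (\<psi> y) (\<lambda>c d. sw A d (\<lambda>d1 d2. 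
        pr p c ** pr q (Sinv x) ** pr r d2 ** pr s (ant A v) ** d1))))))"
  proof -
    have b: "bi_act A pr (p, r) z = sw A z (\<lambda>c d. sw A d (\<lambda>d1 d2. (pr p c * pr r d2) ** d1))" for p r z
      by (simp add: bi_act_def sw3_eq)
    have l: "linA (\<lambda>z. sw A (\<psi> z) (\<lambda>c d. sw A d (\<lambda>d1 d2. (pr p c * pr r d2) ** d1)))" for p r
      unfolding scale_scale[symmetric] by simp
    show ?thesis unfolding b[of _ _ a] 
      unfolding b by (simp add: sw_out[OF l] lin_scale[OF l] pr_ant pr_inv_ant)
        (simp add: scl_sw scale_scale[symmetric] scl_comm)
  qed
  also have "\<dots> = sw A a (\<lambda>x t. sw A t (\<lambda>y v. sw A (\<psi> y) (\<lambda>c d. sw A d (\<lambda>d1 d2. 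
        sw K \<zeta> (\<lambda>p q. pr p c ** pr q (Sinv x) ** sw K \<xi> (\<lambda>r s. pr r d2 ** pr s (ant A v) ** d1))))))"
    by (simp only: scl_sw, simp only: sw_swap[where a=\<xi>], simp only: sw_swap[where a=\<zeta>])
  also have "\<dots> = sw A a (\<lambda>x t. sw A t (\<lambda>y v. sw A (\<psi> y) (\<lambda>c d. sw A d (\<lambda>d1 d2. 
        pr \<zeta> (c * Sinv x) ** pr \<xi> (d2 * ant A v) ** d1))))"
    by (simp only: pr_mult_right)
  finally show ?thesis .
qed

text \<open>The right action of the first half of the coproduct of \<open>\<xi>\<close> commutes with
  \<open>\<psi>\<close> and meets that of the antipode of the second half.\<close>

lemma hom_act_bi_colinear:
  assumes \<psi>: "linA \<psi>" and comm: "\<And>\<xi> a. \<psi> (ract (pr \<xi>) a) = ract (pr \<xi>) (\<psi> a)"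
  shows "hom_act (op_tensor_triang K pr' Q Q') (bi_act A pr) (\<zeta>, \<xi>) \<psi> a = cou K \<xi> ** hact (pr \<zeta>) \<psi> a"
proof -
  note [simp] = lin_comp[OF \<psi>] \<psi>
  \<comment> \<open>the two right actions multiply to that of \<open>\<xi>\<^sub>1 S(\<xi>\<^sub>2)\<close>\<close>
  have rr: "sw K \<xi> (\<lambda>r s. ract (pr r) (ract (pr (ant K s)) b)) = cou K \<xi> ** b" for b
  proof -
    have l: "linA (ract (pr r))" for r using lin_ract[OF lin_id] by simp
    have "sw K \<xi> (\<lambda>r s. ract (pr r) (ract (pr (ant K s)) b)) 
      = sw K \<xi> (\<lambda>r s. sw A b (\<lambda>t z. sw A t (\<lambda>x y. pr r y ** pr (ant K s) z ** x)))"
      unfolding ract_def[of _ b] by (simp add: sw_out[OF l] lin_scale[OF l]) (simp add: ract_def scl_sw scl_comm)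
    also have "\<dots> = sw A b (\<lambda>x t. sw K \<xi> (\<lambda>r s. sw A t (\<lambda>y z. pr r y ** pr (ant K s) z ** x)))"
      by (subst coassoc_A) (simp_all add: sw_swap[where a=\<xi>])
    also have "\<dots> = sw A b (\<lambda>x t. cou K \<xi> ** pr 1 t ** x)"
      unfolding pr_mult_left by (subst K.sw_ant_right[where sv="scl A" and f="\<lambda>z. pr z _ ** _"]) simp_all
    also have "\<dots> = cou K \<xi> ** b"
      unfolding pr_one_left scl_comm[of "cou K \<xi>"] by (subst sw_cou_right[where sv="scl A"]) (simp_all add: lin_scaleI)
    finally show ?thesis .
  qed
  have lr: "lact (pr p) (ract (pr r) b) = ract (pr r) (lact (pr p) b)" for p r b
  proof -
    have l: "linA (ract (pr r))" for r using lin_ract[OF lin_id] by simp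
    have l': "linA (lact (pr r))" for r using lin_lact[OF lin_id] by simp
    have "lact (pr p) (ract (pr r) b) = sw A b (\<lambda>t z. sw A t (\<lambda>x y. pr p x ** pr r z ** y))"
      unfolding ract_def by (simp add: sw_out[OF l'] lin_scale[OF l']) (simp add: lact_def scl_sw scl_comm)
    also have "\<dots> = sw A b (\<lambda>x t. sw A t (\<lambda>y z. pr p x ** pr r z ** y))"
      by (subst coassoc_A) simp_all
    also have "\<dots> = ract (pr r) (lact (pr p) b)"
      unfolding lact_def by (simp add: sw_out[OF l] lin_scale[OF l]) (simp add: ract_def scl_sw scl_comm)
    finally show ?thesis .
  qed
  have "hom_act (op_tensor_triang K pr' Q Q') (bi_act A pr) (\<zeta>, \<xi>) \<psi> a
     = sw K \<zeta> (\<lambda>p q. sw K \<xi> (\<lambda>r s. bi_act A pr (p, r) (\<psi> (bi_act A pr (inv (ant K) q, ant K s) a))))"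
    by (simp add: hom_act_def op_tensor_triang_def sw_def sum_list_concat_map case_prod_unfold comp_def)
  also have "\<dots> = sw K \<zeta> (\<lambda>p q. sw K \<xi> (\<lambda>r s. lact (pr p) (\<psi> (ract (pr r) (ract (pr (ant K s)) (lact (pr (inv (ant K) q)) a))))))"
    by (simp add: bi_act_lact lr comm)
  also have "\<dots> = sw K \<zeta> (\<lambda>p q. lact (pr p) (\<psi> (cou K \<xi> ** lact (pr (inv (ant K) q)) a)))"
    unfolding rr[symmetric] by (subst sw_out[where f="\<lambda>z. lact (pr _) (\<psi> z)" and s="scl A" and s'="scl A"]) simp_all
  also have "\<dots> = cou K \<xi> ** sw K \<zeta> (\<lambda>p q. lact (pr p) (\<psi> (lact (pr (inv (ant K) q)) a)))"
  proof -
    have l: "linA (\<lambda>z. lact (pr p) (\<psi> z))" for p by simp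
    show ?thesis by (simp add: lin_scale[OF l] scl_sw)
  qed
  also have "\<dots> = cou K \<xi> ** hom_act (op_triang K pr' Q) (left_act A pr) \<zeta> \<psi> a"
    by (simp add: hom_act_def op_triang_def sw_def left_act_lact)
  also have "\<dots> = cou K \<xi> ** hact (pr \<zeta>) \<psi> a"
    by (simp only: hom_act_left[OF \<psi>])
  finally show ?thesis .
qed

end

context cotriangular_bij
begin

section \<open>The two braided Leibniz rules\<close>

text \<open>The term \<open>R(a'\<^sub>1, a\<^sub>1) \<psi>(a'\<^sub>2) a\<^sub>2 Rbar(a'\<^sub>3,
  a\<^sub>3)\<close>.\<close>

definition twist_term :: "('a \<Rightarrow> 'a) \<Rightarrow> 'a \<Rightarrow> 'a \<Rightarrow> 'a" where
  "twist_term \<psi> a a' = sw2 a' a (\<lambda>x b t s. sw2 t s (\<lambda>y c v n. R x b ** Rbar v n ** \<psi> y * c))"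

definition twisted_derivation :: "('a \<Rightarrow> 'a) \<Rightarrow> bool" where
  "twisted_derivation \<psi> \<longleftrightarrow> linA \<psi> \<and> (\<forall>a a'. \<psi> (a * a') = \<psi> a * a' + twist_term \<psi> a a')"

text \<open>Braided commutativity for the product \<open>z e\<close>.\<close>

lemma mult_conjugate:
  "sw2 z e (\<lambda>z1 e1 t s. sw2 t s (\<lambda>z2 e2 z3 e3. Rbar z1 e1 ** R z3 e3 ** e2 * z2)) = z * e"
  by (subst (1) sw2_flip, subst (2) sw2_flip, subst mult_axiom[of z e]) (simp add: Rbar_flip)

text \<open>The left side is \<open>R(a'\<^sub>1, a\<^sub>1) Rbar(\<psi>(a'\<^sub>2)\<^sub>1, a\<^sub>2)
  a\<^sub>3 \<psi>(a'\<^sub>2)\<^sub>2\<close>. By \<open>Rbar_comm\<close> the matrix moves to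
  the second leg of \<open>\<psi>(a'\<^sub>2)\<close>, where colinearity replaces that leg by
  \<open>a'\<^sub>3\<close>.\<close>

lemma twist_term_colinear:
  assumes \<psi>: "linA \<psi>" 
   and colin: "\<And>y c d. sw A (\<psi> y) (\<lambda>z1 z2. Rbar z2 c ** z1 * d) = sw A y (\<lambda>y1 y2. Rbar y2 c ** \<psi> y1 * d)"
  shows "adj \<psi> a' (\<lambda>p w. sw A a (\<lambda>x y. Rbar p x ** y * w)) = twist_term \<psi> a a'"
proof -
  note [simp] = lin_comp[OF \<psi>] \<psi>
  have "adj \<psi> a' (\<lambda>p w. sw A a (\<lambda>x y. Rbar p x ** y * w))
    = sw A a' (\<lambda>x y. sw A (\<psi> y) (\<lambda>z1 z2. sw A a (\<lambda>b t. sw A t (\<lambda>b2 c. R x b ** Rbar z1 b2 ** c * z2))))"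
    by (simp add: adj_def Rbar_mult_left Rbar_Sinv_left coassoc_A)
  also have "\<dots> = sw A a' (\<lambda>x y. sw A a (\<lambda>b t. R x b ** sw2 (\<psi> y) t (\<lambda>z1 b2 z2 c. Rbar z1 b2 ** c * z2)))"
    by (simp add: sw_swap[where b=a] scl_sw sw2_def)
  also have "\<dots> = sw A a' (\<lambda>x y. sw A a (\<lambda>b t. R x b ** sw2 (\<psi> y) t (\<lambda>z1 b2 z2 c. Rbar z2 c ** z1 * b2)))"
    by (subst Rbar_comm) simp_all
  also have "\<dots> = sw A a' (\<lambda>x y. sw A a (\<lambda>b t. R x b ** sw A t (\<lambda>b2 c. sw A y (\<lambda>y1 y2. Rbar y2 c ** \<psi> y1 * b2))))"
  proof -
    have "sw2 (\<psi> y) t (\<lambda>z1 b2 z2 c. Rbar z2 c ** z1 * b2) = sw A t (\<lambda>b2 c. sw A y (\<lambda>y1 y2. Rbar y2 c ** \<psi> y1 * b2))" for y t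
      unfolding sw2_def colin[symmetric] by (rule sw_swap)
    then show ?thesis by (simp only:)
  qed
  also have "\<dots> = twist_term \<psi> a a'"
  proof -
    have "sw A t (\<lambda>b2 c. sw A y (\<lambda>y1 y2. Rbar y2 c ** \<psi> y1 * b2)) = sw2 y t (\<lambda>y b2 v c. Rbar v c ** \<psi> y * b2)" for y t
      unfolding sw2_def by (rule sw_swap)
    then show ?thesis unfolding twist_term_def by (simp only: scl_sw2[symmetric] sw2_def[of a'])
  qed
  finally show ?thesis .
qed

text \<open>Here \<open>Rbar\<close> and \<open>R\<close> stand on both sides of the product of the middle
  legs of \<open>a\<close> and \<open>\<psi>(a'\<^sub>2)\<close>, so that
  \<open>mult_conjugate\<close> removes them for every linear \<open>\<psi>\<close>.\<close>

lemma twist_term_bicovariant: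
  assumes \<psi>: "linA \<psi>"
  shows "sw A a' (\<lambda>x t. sw A t (\<lambda>y v. sw A (\<psi> y) (\<lambda>c d. sw A d (\<lambda>d1 d2. sw A a (\<lambda>b t. sw A t (\<lambda>m n. 
     Rbar (c * Sinv x) b ** R (d2 * ant A v) n ** m * d1))))))
   = twist_term \<psi> a a'"
proof -
  note [simp] = lin_comp[OF \<psi>] \<psi>
  have e: "sw A t (\<lambda>m n. Rbar (c * s) b ** G m n) = sw A b (\<lambda>b1 b2. sw A t (\<lambda>m n. Rbar s b1 ** Rbar c b2 ** G m n))" 
    for t c s b G
    by (simp add: Rbar_mult_left sw_swap[where b=b])
  have e2: "R (d2 * ant A v) n ** u = sw A n (\<lambda>n1 n2. R d2 n1 ** Rbar v n2 ** u)" for d2 v n u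
    by (simp add: R_mult_left R_ant_left)
  have 1: "sw A z (\<lambda>c d. sw A d (\<lambda>d1 d2. sw A a (\<lambda>b t. sw A t (\<lambda>m n. 
     Rbar (c * Sinv x) b ** R (d2 * ant A v) n ** m * d1))))
    = sw A a (\<lambda>b t. sw A t (\<lambda>s n. R x b ** Rbar v n ** z * s))" for z x v
  proof -
    have "sw A z (\<lambda>c d. sw A d (\<lambda>d1 d2. sw A a (\<lambda>b t. sw A t (\<lambda>m n. 
       Rbar (c * Sinv x) b ** R (d2 * ant A v) n ** m * d1))))
      = sw A z (\<lambda>c d. sw A d (\<lambda>d1 d2. sw A a (\<lambda>b1 t. sw A t (\<lambda>b2 t. sw A t (\<lambda>m t. sw A t (\<lambda>n1 n2. 
       R x b1 ** Rbar v n2 ** Rbar c b2 ** R d2 n1 ** m * d1))))))"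
      unfolding e e2 by (simp add: coassoc_A scl_sw Rbar_Sinv_left scl_comm)
    also have "\<dots> = sw A a (\<lambda>b1 t. sw A t (\<lambda>s n2. sw A s (\<lambda>b2 t. sw A t (\<lambda>m n1. sw A z (\<lambda>c d. sw A d (\<lambda>d1 d2.
       R x b1 ** Rbar v n2 ** Rbar c b2 ** R d2 n1 ** m * d1))))))"
    proof -
      have p: "sw A z (\<lambda>c d. sw A d (\<lambda>d1 d2. sw A a (\<lambda>b1 t. sw A t (\<lambda>b2 t. sw A t (\<lambda>m t. sw A t (\<lambda>n1 n2. G c d1 d2 b1 b2 m n1 n2))))))
        = sw A a (\<lambda>b1 t. sw A t (\<lambda>b2 t. sw A t (\<lambda>m t. sw A t (\<lambda>n1 n2. sw A z (\<lambda>c d. sw A d (\<lambda>d1 d2. G c d1 d2 b1 b2 m n1 n2))))))" 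
        for G :: "'a \<Rightarrow> 'a \<Rightarrow> 'a \<Rightarrow> 'a \<Rightarrow> 'a \<Rightarrow> 'a \<Rightarrow> 'a \<Rightarrow> 'a \<Rightarrow> 'a"
      proof -
        have q: "sw A d (\<lambda>d1 d2. sw A a (\<lambda>b1 t. sw A t (\<lambda>b2 t. sw A t (\<lambda>m t. sw A t (\<lambda>n1 n2. G c d1 d2 b1 b2 m n1 n2)))))
          = sw A a (\<lambda>b1 t. sw A t (\<lambda>b2 t. sw A t (\<lambda>m t. sw A t (\<lambda>n1 n2. sw A d (\<lambda>d1 d2. G c d1 d2 b1 b2 m n1 n2)))))" for c d
          by (simp only: sw_swap[where a=d])
        show ?thesis unfolding q by (simp only: sw_swap[where a=z])
      qed
      show ?thesis unfolding p by (simp add: coassoc_A)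
    qed
    also have "\<dots> = sw A a (\<lambda>b t. sw A t (\<lambda>s n. R x b ** Rbar v n ** z * s))"
    proof -
      have "z * s = sw A s (\<lambda>b2 t. sw A t (\<lambda>m n1. sw A z (\<lambda>c d. sw A d (\<lambda>d1 d2. (Rbar c b2 ** R d2 n1 ** m * d1)))))" for s
      proof -
        have q: "sw A d (\<lambda>d1 d2. sw A t (\<lambda>m n. Rbar c b ** R d2 n ** m * d1)) = 
           sw A t (\<lambda>m n. sw A d (\<lambda>d1 d2. Rbar c b ** R d2 n ** m * d1))" for c d b t
          by (rule sw_swap)
        show ?thesis unfolding mult_conjugate[of z s, symmetric] sw2_def q by (simp only: sw_swap[where a=z])
      qed
      then show ?thesis by (simp only: scl_sw[symmetric])
    qed
    finally show ?thesis .
  qed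
  show ?thesis unfolding 1 twist_term_def sw2_def
    by (simp only: sw_swap[where b=a])
qed

lemma lact_hact_contracts:
  assumes \<psi>: "linA \<psi>"
  shows "contracts (\<lambda>f g. sw A a (\<lambda>x y. g x ** y) * hact f \<psi> a') (adj \<psi> a' (\<lambda>p w. sw A a (\<lambda>x y. Rbar p x ** y * w)))"
proof (rule contracts_cong)
  show "contracts (\<lambda>f g. adj \<psi> a' (\<lambda>p w. sw A a (\<lambda>x y. f p ** g x ** y * w))) 
     (adj \<psi> a' (\<lambda>p w. sw A a (\<lambda>x y. Rbar p x ** y * w)))"
    by (intro contracts_intros)
  show "sw A a (\<lambda>x y. g x ** y) * hact f \<psi> a' = adj \<psi> a' (\<lambda>p w. sw A a (\<lambda>x y. f p ** g x ** y * w))" for f g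
  proof -
    have "sw A a (\<lambda>x y. g x ** y) * hact f \<psi> a' = adj \<psi> a' (\<lambda>p w. sw A a (\<lambda>x y. g x ** y) * (f p ** w))"
      unfolding hact_def by (rule adj_out[where f="\<lambda>z. sw A a (\<lambda>x y. g x ** y) * z"]) simp
    then show ?thesis
      by (simp add: sw_mult_out scl_mult_left scl_mult_right scl_sw)
  qed
qed

end

context paired_cotriangular
begin

lemma braided_Der_op:
  assumes det: "determined (op_triang K pr Rbar) (scl A)"
  shows "braided_Der (op_triang K pr Rbar) (scl A) (left_act A pr) = {\<psi>. braided_derivation \<psi>}"
proof -
  have "contract (op_triang K pr Rbar) (scl A) (\<lambda>r r'. left_act A pr r' a * hom_act (op_triang K pr Rbar) (left_act A pr) r \<psi> a')
    = adj \<psi> a' (\<lambda>p w. sw A a (\<lambda>x y. Rbar p x ** y * w))" if "linA \<psi>" for \<psi> a a'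
    unfolding hom_act_left[OF that] left_act_lact lact_def
    by (rule contract_contracts[OF lact_hact_contracts[OF that] det, where \<pi>="\<lambda>x. x"]) (simp_all add: op_triang_def)
  then show ?thesis
    unfolding braided_Der_def braided_derivation_def by (auto simp: lin_iff_module_hom)
qed

lemma braided_Der_op_tensor:
  assumes det: "determined (op_tensor_triang K pr R Rbar) (scl A)"
  shows "braided_Der (op_tensor_triang K pr R Rbar) (scl A) (bi_act A pr) = {\<psi>. twisted_derivation \<psi>}"
proof -
  let ?T = "op_tensor_triang K pr R Rbar"
  have "contract ?T (scl A) (\<lambda>r r'. bi_act A pr r' a * hom_act ?T (bi_act A pr) r \<psi> a')
    = twist_term \<psi> a a'" if \<psi>: "linA \<psi>" for \<psi> a a'
  proof (rule contract_eqI[OF det, where ts="[((c * Sinv x, d2 * ant A v), (b, n), m * d1). 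
       (x, t) \<leftarrow> cop A a', (y, v) \<leftarrow> cop A t, (c, d) \<leftarrow> cop A (\<psi> y), (d1, d2) \<leftarrow> cop A d, (b, t) \<leftarrow> cop A a, (m, n) \<leftarrow> cop A t]"])
    show "module (scl A)" by simp
    show "twist_term \<psi> a a' = (\<Sum>(p, q, w)\<leftarrow>[((c * Sinv x, d2 * ant A v), (b, n), m * d1). 
       (x, t) \<leftarrow> cop A a', (y, v) \<leftarrow> cop A t, (c, d) \<leftarrow> cop A (\<psi> y), (d1, d2) \<leftarrow> cop A d, (b, t) \<leftarrow> cop A a, (m, n) \<leftarrow> cop A t].
       trmat ?T p q ** w)"
      unfolding twist_term_bicovariant[OF \<psi>, symmetric] op_tensor_triang_def
      by (simp add: sum_list_concat_map case_prod_unfold comp_def sw_def scale_scale)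
    fix r r' :: "'u \<times> 'u"
    obtain \<zeta> \<xi> \<zeta>' \<xi>' where r [simp]: "r = (\<zeta>, \<xi>)" "r' = (\<zeta>', \<xi>')" by (cases r, cases r')
    have "bi_act A pr r' a * hom_act ?T (bi_act A pr) r \<psi> a' 
      = sw A a' (\<lambda>x t. sw A t (\<lambda>y v. sw A (\<psi> y) (\<lambda>c d. sw A d (\<lambda>d1 d2. sw A a (\<lambda>b t. sw A t (\<lambda>m n.
          ((pr \<zeta>' b * pr \<xi>' n) ** m) * (pr \<zeta> (c * Sinv x) ** pr \<xi> (d2 * ant A v) ** d1)))))))"
    proof -
      have b: "bi_act A pr (\<zeta>', \<xi>') a = sw A a (\<lambda>b t. sw A t (\<lambda>m n. (pr \<zeta>' b * pr \<xi>' n) ** m))"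
        by (simp add: bi_act_def sw3_eq)
      show ?thesis unfolding r hom_act_bi[OF \<psi>] mult_sw unfolding b sw_mult_out ..
    qed
    then show "bi_act A pr r' a * hom_act ?T (bi_act A pr) r \<psi> a' = (\<Sum>(p, q, w)\<leftarrow>[((c * Sinv x, d2 * ant A v), (b, n), m * d1). 
       (x, t) \<leftarrow> cop A a', (y, v) \<leftarrow> cop A t, (c, d) \<leftarrow> cop A (\<psi> y), (d1, d2) \<leftarrow> cop A d, (b, t) \<leftarrow> cop A a, (m, n) \<leftarrow> cop A t].
       (tpair ?T r p * tpair ?T r' q) ** w)"
      by (simp add: op_tensor_triang_def sum_list_concat_map case_prod_unfold comp_def sw_def scl_mult_left scl_mult_right scale_scale ac_simps)
  qed
  then show ?thesis
    unfolding braided_Der_def twisted_derivation_def by (auto simp: lin_iff_module_hom)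
qed

end

section \<open>Tensors as lists\<close>

text \<open>The analogue of a Sweedler sum whose summands are tensors, i.e. lists up to
  \<open>tensor_eq\<close>. Membership in the coinvariants and colinearity are equalities of
  tensors over modules that need not be free, so that pairings may fail to detect them.\<close>

definition bind :: "('x \<times> 'y) list \<Rightarrow> ('x \<Rightarrow> 'y \<Rightarrow> 'z list) \<Rightarrow> 'z list" where
  "bind t F = concat (map (\<lambda>(x, y). F x y) t)"

lemma bind_simps [simp]: "bind [] F = []" "bind ((x, y) # t) F = F x y @ bind t F" "bind (s @ t) F = bind s F @ bind t F"
  by (simp_all add: bind_def)

lemma bind_assoc: "bind (bind t F) G = bind t (\<lambda>x y. bind (F x y) G)"
  by (induction t) auto

lemma map_eq_bind: "map (\<lambda>(x, y). f x y) t = bind t (\<lambda>x y. [f x y])"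
  by (induction t) auto

lemma concat_map_concat: "concat (map f (concat (map g xs))) = concat (map (\<lambda>x. concat (map f (g x))) xs)"
  by (induction xs) simp_all

lemma bind_single [simp]: "bind t (\<lambda>x y. [(x, y)]) = t"
  by (induction t) auto

locale tensor_target =
  fixes s1 :: "'k::comm_ring_1 \<Rightarrow> 'c::ab_group_add \<Rightarrow> 'c" and s2 :: "'k \<Rightarrow> 'd::ab_group_add \<Rightarrow> 'd"
  assumes mod1: "module s1" and mod2: "module s2"
begin

abbreviation teq where "teq \<equiv> tensor_eq s1 s2"

lemma teq_refl [simp]: "teq t t" unfolding tensor_eq_def by (rule tens_refl)
lemma teq_sym: "teq t u \<Longrightarrow> teq u t" unfolding tensor_eq_def by (rule tens_sym)
lemma teq_trans [trans]: "teq t u \<Longrightarrow> teq u v \<Longrightarrow> teq t v" unfolding tensor_eq_def by (rule tens_trans)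
lemma teq_append: "teq t t' \<Longrightarrow> teq u u' \<Longrightarrow> teq (t @ u) (t' @ u')" unfolding tensor_eq_def by (rule tens_append)
lemma teq_comm: "teq (t @ u) (u @ t)" unfolding tensor_eq_def by (rule tens_comm)
lemma teq_zero: "teq [(0, b)] []" unfolding tensor_eq_def by (rule tens_zero)
lemma teq_add_left: "teq [(a + a', b)] [(a, b), (a', b)]" unfolding tensor_eq_def by (rule tens_add_left)
lemma teq_add_right: "teq [(a, b + b')] [(a, b), (a, b')]" unfolding tensor_eq_def by (rule tens_add_right)
lemma teq_balance: "teq [(s1 c a, b)] [(a, s2 c b)]" 
  unfolding tensor_eq_def by (rule tens_balance) auto

lemma teq_middle: "teq ((t @ u) @ (v @ w)) ((t @ v) @ (u @ w))"
proof -
  have "teq (t @ (u @ v) @ w) (t @ (v @ u) @ w)"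
    by (intro teq_append teq_comm teq_refl)
  then show ?thesis by simp
qed

lemma teq_bind_cong: 
  assumes "\<And>x y. teq (F x y) (G x y)" shows "teq (bind t F) (bind t G)"
proof (induction t)
  case (Cons a t)
  then show ?case using assms by (cases a) (simp add: teq_append)
qed simp

lemma teq_bind_append: "teq (bind t (\<lambda>x y. F x y @ G x y)) (bind t F @ bind t G)"
proof (induction t)
  case (Cons a t)
  obtain x y where [simp]: "a = (x, y)" by (cases a)
  have "teq ((F x y @ G x y) @ bind t (\<lambda>x y. F x y @ G x y)) ((F x y @ G x y) @ (bind t F @ bind t G))"
    by (rule teq_append[OF teq_refl Cons.IH])
  also have "teq \<dots> ((F x y @ bind t F) @ (G x y @ bind t G))" by (rule teq_middle)
  finally show ?case by simp
qed simp

lemma teq_swap: "teq (bind t (\<lambda>x y. bind u (F x y))) (bind u (\<lambda>x' y'. bind t (\<lambda>x y. F x y x' y')))"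
proof (induction t)
  case Nil
  show ?case by (induction u) auto
next
  case (Cons a t)
  obtain x y where [simp]: "a = (x, y)" by (cases a)
  have "teq (bind u (F x y) @ bind t (\<lambda>x y. bind u (F x y))) (bind u (F x y) @ bind u (\<lambda>x' y'. bind t (\<lambda>x y. F x y x' y')))"
    by (rule teq_append[OF teq_refl Cons.IH])
  also have "teq \<dots> (bind u (\<lambda>x' y'. F x y x' y' @ bind t (\<lambda>x y. F x y x' y')))"
    by (rule teq_sym[OF teq_bind_append])
  finally show ?case by simp
qed

lemma teq_neg: "teq (t @ map (\<lambda>(x, y). (- x, y)) t) []"
proof (induction t)
  case (Cons a t)
  obtain x y where [simp]: "a = (x, y)" by (cases a)
  let ?n = "map (\<lambda>(x, y). (- x, y))"
  have "teq (([(x, y)] @ t) @ ([(- x, y)] @ ?n t)) (([(x, y)] @ [(- x, y)]) @ (t @ ?n t))" by (rule teq_middle)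
  also have "teq \<dots> ([(0, y)] @ [])"
    using teq_sym[OF teq_add_left[of x "- x" y]] by (intro teq_append Cons.IH) simp
  also have "teq \<dots> []" using teq_zero by simp
  finally show ?case by simp
qed simp

text \<open>Tensors form a group under concatenation.\<close>

lemma teq_idem: assumes "teq t (t @ t)" shows "teq t []"
proof -
  let ?n = "map (\<lambda>(x, y). (- x, y)) t"
  have "teq (t @ []) (t @ (t @ ?n))" by (rule teq_append[OF teq_refl teq_sym[OF teq_neg]])
  also have "teq \<dots> (t @ ?n)" using teq_append[OF teq_sym[OF assms] teq_refl, of ?n] by simp
  also have "teq \<dots> []" by (rule teq_neg)
  finally show ?thesis by simp
qed

definition tscale :: "'k \<Rightarrow> ('c \<times> 'd) list \<Rightarrow> ('c \<times> 'd) list" where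
  "tscale c t = bind t (\<lambda>x y. [(s1 c x, y)])"

definition tlin :: "('k \<Rightarrow> 'x::ab_group_add \<Rightarrow> 'x) \<Rightarrow> ('x \<Rightarrow> ('c \<times> 'd) list) \<Rightarrow> bool" where
  "tlin s T \<longleftrightarrow> (\<forall>x y. teq (T (x + y)) (T x @ T y)) \<and> (\<forall>c x. teq (T (s c x)) (tscale c (T x)))"

lemma tlin_add: "tlin s T \<Longrightarrow> teq (T (x + y)) (T x @ T y)"
  and tlin_scale: "tlin s T \<Longrightarrow> teq (T (s c x)) (tscale c (T x))"
  by (simp_all add: tlin_def)

lemma tlin_zero: "tlin s T \<Longrightarrow> teq (T 0) []"
  using tlin_add[of s T 0 0] by (simp add: teq_idem)

lemma tlin_sum:
  assumes T: "tlin s T" shows "teq (T (\<Sum>(x, y)\<leftarrow>t. g x y)) (bind t (\<lambda>x y. T (g x y)))"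
proof (induction t)
  case (Cons a t)
  obtain x y where [simp]: "a = (x, y)" by (cases a)
  have "teq (T (g x y + (\<Sum>(x, y)\<leftarrow>t. g x y))) (T (g x y) @ T (\<Sum>(x, y)\<leftarrow>t. g x y))" by (rule tlin_add[OF T])
  also have "teq \<dots> (T (g x y) @ bind t (\<lambda>x y. T (g x y)))" by (rule teq_append[OF teq_refl Cons.IH])
  finally show ?case by simp
qed (simp add: tlin_zero[OF T])

lemma tlin_sw: "tlin s T \<Longrightarrow> teq (T (sw B a g)) (bind (cop B a) (\<lambda>x y. T (g x y)))"
  unfolding sw_def by (rule tlin_sum)

lemma tlin_pair_left: "lin s s1 f \<Longrightarrow> tlin s (\<lambda>x. [(f x, h)])"
  unfolding tlin_def tscale_def using teq_add_left by (simp add: lin_add lin_scale)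

lemma tlin_pair_right: "lin s s2 f \<Longrightarrow> tlin s (\<lambda>x. [(h, f x)])"
  unfolding tlin_def tscale_def using teq_add_right teq_sym[OF teq_balance] by (simp add: lin_add lin_scale)

lemma tlin_comp: "tlin s' T \<Longrightarrow> lin s s' f \<Longrightarrow> tlin s (\<lambda>x. T (f x))"
  unfolding tlin_def by (simp add: lin_add lin_scale)

lemma tscale_bind: "tscale c (bind t F) = bind t (\<lambda>x y. tscale c (F x y))"
  by (simp add: tscale_def bind_assoc)

lemma tlin_bind: 
  assumes "\<And>x y. tlin s (\<lambda>v. F v x y)" shows "tlin s (\<lambda>v. bind t (\<lambda>x y. F v x y))"
  unfolding tlin_def
proof (intro conjI allI)
  fix v w c
  have "teq (bind t (\<lambda>x y. F (v + w) x y)) (bind t (\<lambda>x y. F v x y @ F w x y))"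
    by (rule teq_bind_cong) (rule tlin_add[OF assms])
  then show "teq (bind t (\<lambda>x y. F (v + w) x y)) (bind t (\<lambda>x y. F v x y) @ bind t (\<lambda>x y. F w x y))"
    using teq_bind_append teq_trans by blast
  show "teq (bind t (\<lambda>x y. F (s c v) x y)) (tscale c (bind t (\<lambda>x y. F v x y)))"
    unfolding tscale_bind by (rule teq_bind_cong) (rule tlin_scale[OF assms])
qed

lemma teq_bind:
  assumes "tensor_eq s s' t t'" and l: "\<And>y. tlin s (\<lambda>x. F x y)" and r: "\<And>x. tlin s' (\<lambda>y. F x y)"
  shows "teq (bind t F) (bind t' F)"
proof -
  have "tens_eq (range (\<lambda>c. (s c, s' c))) t t'" using assms(1) by (simp add: tensor_eq_def)
  then show ?thesis
  proof (induction rule: tens_eq.induct)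
    case (tens_zero b)
    show ?case using tlin_zero[OF l] by simp
  next
    case (tens_balance f g a b)
    then obtain c where [simp]: "f = s c" "g = s' c" by auto
    show ?case using teq_trans[OF tlin_scale[OF l] teq_sym[OF tlin_scale[OF r]]] by simp
  next
    case (tens_sym s t) show ?case by (rule teq_sym[OF tens_sym.IH])
  next
    case (tens_trans s t w) show ?case by (rule teq_trans[OF tens_trans.IH])
  qed (simp_all add: teq_comm teq_append tlin_add[OF l] tlin_add[OF r])
qed

lemma teq_collect_left: "teq (bind t (\<lambda>x y. [(g x y, h)])) [(\<Sum>(x, y)\<leftarrow>t. g x y, h)]"
  using tlin_sum[OF tlin_pair_left[OF lin_id]] by (rule teq_sym)

lemma teq_collect_right: "teq (bind t (\<lambda>x y. [(h, g x y)])) [(h, \<Sum>(x, y)\<leftarrow>t. g x y)]"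
  using tlin_sum[OF tlin_pair_right[OF lin_id]] by (rule teq_sym)

end

locale hopf_tensor_target = hopf_algebra A + tensor_target s1 s2
  for A :: "('k::comm_ring_1, 'a::ring_1) hopf" 
   and s1 :: "'k \<Rightarrow> 'c::ab_group_add \<Rightarrow> 'c" and s2 :: "'k \<Rightarrow> 'd::ab_group_add \<Rightarrow> 'd"
begin

lemma tlin_bind_cop:
  assumes f: "lin s (scl A) f" and l: "\<And>y. tlin (scl A) (\<lambda>x. F x y)" and r: "\<And>x. tlin (scl A) (\<lambda>y. F x y)"
  shows "tlin s (\<lambda>v. bind (cop A (f v)) (\<lambda>x y. F x y))"
proof (rule tlin_comp[OF _ f])
  show "tlin (scl A) (\<lambda>v. bind (cop A v) (\<lambda>x y. F x y))"
    unfolding tlin_def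
  proof (intro conjI allI)
    fix x y c
    show "teq (bind (cop A (x + y)) (\<lambda>x y. F x y)) (bind (cop A x) (\<lambda>x y. F x y) @ bind (cop A y) (\<lambda>x y. F x y))"
      using teq_bind[OF cop_add l r] by simp
    have "teq (bind (cop A (scl A c x)) F) (bind (bind (cop A x) (\<lambda>p q. [(scl A c p, q)])) F)"
    proof -
      have "[(scl A c p, q). (p, q) \<leftarrow> cop A x] = bind (cop A x) (\<lambda>p q. [(scl A c p, q)])" by (rule map_eq_bind)
      then show ?thesis using teq_bind[OF cop_scl l r, of c x] by simp
    qed
    also have "teq \<dots> (tscale c (bind (cop A x) F))"
      unfolding bind_assoc tscale_bind by (rule teq_bind_cong) (simp add: tlin_scale[OF l])
    finally show "teq (bind (cop A (scl A c x)) (\<lambda>x y. F x y)) (tscale c (bind (cop A x) (\<lambda>x y. F x y)))" .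
  qed
qed

lemma bind_coassoc:
  assumes l1: "\<And>y z. tlin (scl A) (\<lambda>x. F x y z)" and l2: "\<And>x z. tlin (scl A) (\<lambda>y. F x y z)" 
    and l3: "\<And>x y. tlin (scl A) (\<lambda>z. F x y z)"
  shows "teq (bind (cop A a) (\<lambda>w z. bind (cop A w) (\<lambda>x y. F x y z))) (bind (cop A a) (\<lambda>x w. bind (cop A w) (\<lambda>y z. F x y z)))"
proof -
  let ?b = "\<lambda>t. concat (map (\<lambda>(x, y, z). F x y z) t)"
  have "teq (?b t) (?b t')" if "tensor3_eq (scl A) t t'" for t t'
    using that
  proof (induction rule: tensor3_eq.induct)
    case (tens3_sym t w) show ?case by (rule teq_sym[OF tens3_sym.IH])
  next
    case (tens3_trans t w v) show ?case by (rule teq_trans[OF tens3_trans.IH])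
  next
    case (tens3_zero y z) show ?case using tlin_zero[OF l1] by simp
  next
    case (tens3_scale_12 c x y z)
    show ?case using teq_trans[OF tlin_scale[OF l1] teq_sym[OF tlin_scale[OF l2]]] by simp
  next
    case (tens3_scale_23 x c y z)
    show ?case using teq_trans[OF tlin_scale[OF l2] teq_sym[OF tlin_scale[OF l3]]] by simp
  qed (simp_all add: teq_comm teq_append tlin_add[OF l1] tlin_add[OF l2] tlin_add[OF l3])
  from this[OF coassoc, of a] show ?thesis
    by (simp add: bind_def cop3_def concat_map_concat comp_def case_prod_unfold)
qed

end

section \<open>Colinear maps\<close>

locale hopf_coaction = hopf_algebra A
  for A :: "('k::comm_ring_1, 'a::ring_1) hopf" +
  fixes sH :: "'k \<Rightarrow> 'h::ab_group_add \<Rightarrow> 'h" and \<pi> :: "'a \<Rightarrow> 'h"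
  assumes mod_H [simp]: "module sH" and lin_\<pi>0: "lin (scl A) sH \<pi>"
begin

sublocale hopf_tensor_target A "scl A" sH
  by (intro hopf_tensor_target.intro tensor_target.intro hopf_algebra_axioms mod_A mod_H)

lemma lin_\<pi>: "lin s (scl A) f \<Longrightarrow> lin s sH (\<lambda>x. \<pi> (f x))"
  by (rule lin_comp[OF lin_\<pi>0])

lemma coaction_bind: "coaction A \<pi> a = bind (cop A a) (\<lambda>x y. [(x, \<pi> y)])"
  unfolding coaction_def by (rule map_eq_bind)

lemma tlin_coaction: "tlin (scl A) (coaction A \<pi>)"
  unfolding coaction_bind[abs_def]
  by (rule tlin_bind_cop) (simp_all add: tlin_pair_left tlin_pair_right lin_\<pi>)

definition colinear :: "('a \<Rightarrow> 'a) \<Rightarrow> bool" where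
  "colinear u \<longleftrightarrow> (\<forall>a. teq (coaction A \<pi> (u a)) [(u x, h). (x, h) \<leftarrow> coaction A \<pi> a])"

lemma colinearD: "colinear u \<Longrightarrow> teq (coaction A \<pi> (u a)) (bind (cop A a) (\<lambda>x y. [(u x, \<pi> y)]))"
  unfolding colinear_def map_eq_bind coaction_bind by (simp add: bind_assoc)

lemma colinearI: "(\<And>a. teq (coaction A \<pi> (u a)) (bind (cop A a) (\<lambda>x y. [(u x, \<pi> y)]))) \<Longrightarrow> colinear u"
  unfolding colinear_def map_eq_bind coaction_bind by (simp add: bind_assoc)

lemma sw_colinear:
  assumes "colinear u" "\<And>y. lin (scl A) sv (\<lambda>x. G x y)" "\<And>x. lin sH sv (G x)"
  shows "sw A (u a) (\<lambda>x y. G x (\<pi> y)) = sw A a (\<lambda>x y. G (u x) (\<pi> y))"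
proof -
  have "(\<Sum>(x, y)\<leftarrow>coaction A \<pi> (u a). G x y) = (\<Sum>(x, y)\<leftarrow>[(u x, h). (x, h) \<leftarrow> coaction A \<pi> a]. G x y)"
    by (rule tensor_eq_sum[where s="scl A" and s'=sH]) (use assms in \<open>simp_all add: colinear_def\<close>)
  then show ?thesis by (simp add: coaction_def sw_def comp_def case_prod_unfold)
qed

lemma colinear_id: "colinear (\<lambda>x. x)"
  by (rule colinearI) (simp add: coaction_bind)

lemma colinear_comp:
  assumes u: "colinear u" and l: "linV (scl A) u" and v: "colinear v" 
  shows "colinear (\<lambda>x. u (v x))"
proof (rule colinearI)
  fix a
  have "teq (coaction A \<pi> (u (v a))) (bind (coaction A \<pi> (v a)) (\<lambda>x h. [(u x, h)]))"
    using colinearD[OF u, of "v a"] by (simp add: coaction_bind bind_assoc)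
  also have "teq \<dots> (bind (bind (cop A a) (\<lambda>x y. [(v x, \<pi> y)])) (\<lambda>x h. [(u x, h)]))"
    by (rule teq_bind[OF colinearD[OF v]]) (simp_all add: tlin_pair_left tlin_pair_right lin_\<pi> l)
  finally show "teq (coaction A \<pi> (u (v a))) (bind (cop A a) (\<lambda>x y. [(u (v x), \<pi> y)]))"
    by (simp add: bind_assoc)
qed

text \<open>By coassociativity the coaction only reaches the last leg, on which the members of the family
  act.\<close>

lemma colinear_sw:
  assumes G: "\<And>x. colinear (G x)" and l1: "\<And>y. linV (scl A) (\<lambda>x. G x y)" and l2: "\<And>x. linV (scl A) (G x)"
  shows "colinear (\<lambda>a. sw A a G)"
proof (rule colinearI)
  fix a
  have "teq (coaction A \<pi> (sw A a G)) (bind (cop A a) (\<lambda>x y. coaction A \<pi> (G x y)))"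
    by (rule tlin_sw[OF tlin_coaction])
  also have "teq \<dots> (bind (cop A a) (\<lambda>x w. bind (cop A w) (\<lambda>y z. [(G x y, \<pi> z)])))"
    by (rule teq_bind_cong[OF colinearD[OF G]])
  also have "teq \<dots> (bind (cop A a) (\<lambda>w z. bind (cop A w) (\<lambda>x y. [(G x y, \<pi> z)])))"
    by (rule teq_sym[OF bind_coassoc]) (simp_all add: tlin_pair_left tlin_pair_right lin_\<pi> l1 l2)
  also have "teq \<dots> (bind (cop A a) (\<lambda>w z. [(sw A w G, \<pi> z)]))"
    unfolding sw_def by (rule teq_bind_cong[OF teq_collect_left])
  finally show "teq (coaction A \<pi> (sw A a G)) (bind (cop A a) (\<lambda>w z. [(sw A w G, \<pi> z)]))" .
qed

lemma colinear_add: 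
  assumes u: "colinear u" and v: "colinear v" shows "colinear (\<lambda>x. u x + v x)"
proof (rule colinearI)
  fix a
  have "teq (coaction A \<pi> (u a + v a)) (coaction A \<pi> (u a) @ coaction A \<pi> (v a))"
    by (rule tlin_add[OF tlin_coaction])
  also have "teq \<dots> (bind (cop A a) (\<lambda>x y. [(u x, \<pi> y)]) @ bind (cop A a) (\<lambda>x y. [(v x, \<pi> y)]))"
    by (intro teq_append colinearD u v)
  also have "teq \<dots> (bind (cop A a) (\<lambda>x y. [(u x, \<pi> y)] @ [(v x, \<pi> y)]))"
    by (rule teq_sym[OF teq_bind_append])
  also have "teq \<dots> (bind (cop A a) (\<lambda>x y. [(u x + v x, \<pi> y)]))"
    by (rule teq_bind_cong) (use teq_sym[OF teq_add_left] in simp)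
  finally show "teq (coaction A \<pi> (u a + v a)) (bind (cop A a) (\<lambda>x y. [(u x + v x, \<pi> y)]))" .
qed

lemma colinear_scl: 
  assumes u: "colinear u" shows "colinear (\<lambda>x. scl A c (u x))"
proof (rule colinearI)
  fix a
  have "teq (coaction A \<pi> (scl A c (u a))) (tscale c (coaction A \<pi> (u a)))"
    by (rule tlin_scale[OF tlin_coaction])
  also have "teq \<dots> (tscale c (bind (cop A a) (\<lambda>x y. [(u x, \<pi> y)])))"
    unfolding tscale_def by (rule teq_bind[OF colinearD[OF u]]) (simp_all add: tlin_pair_left tlin_pair_right lin_\<pi>)
  finally show "teq (coaction A \<pi> (scl A c (u a))) (bind (cop A a) (\<lambda>x y. [(scl A c (u x), \<pi> y)]))"
    by (simp add: tscale_def bind_assoc)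
qed

lemma colinear_minus: "colinear u \<Longrightarrow> colinear (\<lambda>x. - u x)"
  using colinear_scl[of u "-1"] by simp

lemma colinear_diff: "colinear u \<Longrightarrow> colinear v \<Longrightarrow> colinear (\<lambda>x. u x - v x)"
  using colinear_add[of u "\<lambda>x. - v x"] colinear_minus by simp

lemma colinear_zero: "colinear (\<lambda>x. 0)"
  using colinear_scl[OF colinear_id, of 0] by simp

lemma colinear_list: "(\<And>z. z \<in> set zs \<Longrightarrow> colinear (F z)) \<Longrightarrow> colinear (\<lambda>x. \<Sum>z\<leftarrow>zs. F z x)"
  by (induction zs) (simp_all add: colinear_zero colinear_add)

end

section \<open>Quantum homogeneous spaces\<close>

locale quantum_bundle = cotriangular_bij A R Rbar + H: hopf_algebra H
  for A :: "('k::comm_ring_1, 'a::ring_1) hopf" and R Rbar and H :: "('k, 'h::ring_1) hopf" +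
  fixes \<pi> :: "'a \<Rightarrow> 'h"
  assumes hopf_map: "hopf_map A H \<pi>"
begin

lemma pi_one [simp]: "\<pi> 1 = 1" and pi_mult: "\<pi> (a * b) = \<pi> a * \<pi> b"
  and cop_pi: "tensor_eq (scl H) (scl H) (cop H (\<pi> a)) [(\<pi> x, \<pi> y). (x, y) \<leftarrow> cop A a]"
  and cou_pi: "cou H (\<pi> a) = cou A a"
  using hopf_map by (simp_all add: hopf_map_def)

sublocale hopf_coaction A "scl H" \<pi>
  by unfold_locales (use hopf_map in \<open>simp_all add: hopf_map_def lin_iff_module_hom\<close>)

declare lin_\<pi> [simp]

text \<open>For the coaction of \<open>A\<close> on itself the colinear maps are the right-invariant ones.\<close>

sublocale invar: hopf_coaction A "scl A" "\<lambda>x. x"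
  by unfold_locales simp_all

lemma colinear_adj:
  assumes \<psi>: "colinear \<psi>" "linA \<psi>" 
   and F: "\<And>p. colinear (F p)" "\<And>w. linA (\<lambda>p. F p w)" "\<And>p. linA (F p)"
  shows "colinear (\<lambda>a. adj \<psi> a F)"
proof -
  note [simp] = lin_comp[OF \<psi>(2)] \<psi>(2) lin_comp[OF F(2)] lin_comp[OF F(3)] F
  have "colinear (\<lambda>b. sw A b (\<lambda>p w. F (p * Sinv x) w))" for x
    by (rule colinear_sw) simp_all
  then have "colinear (\<lambda>y. sw A (\<psi> y) (\<lambda>p w. F (p * Sinv x) w))" for x
    by (rule colinear_comp[OF _ _ \<psi>(1)]) simp
  then show ?thesis unfolding adj_def by (rule colinear_sw) simp_all
qed

lemma colinear_hact:
  assumes \<psi>: "colinear \<psi>" "linA \<psi>" and f: "linK f"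
  shows "colinear (hact f \<psi>)"
  unfolding hact_def[abs_def] using f by (intro colinear_adj[OF \<psi>] colinear_scl colinear_id) simp_all

lemma colinear_cross:
  assumes \<psi>: "colinear \<psi>" "linA \<psi>" and \<chi>: "colinear \<chi>" "linA \<chi>"
  shows "colinear (cross \<chi> \<psi>)"
proof -
  have "colinear (\<lambda>a. adj \<psi> a (\<lambda>p. hact (Rbar p) \<chi>))"
    by (intro colinear_adj[OF \<psi>] colinear_hact[OF \<chi>]) (simp_all add: \<chi> hact_def)
  then show ?thesis by (simp add: hact_def[abs_def] cross_def[abs_def])
qed

lemma colinear_bracket:
  assumes u: "colinear u" "linA u" and v: "colinear v" "linA v"
  shows "colinear (bracket u v)"
  unfolding bracket_def[abs_def] by (rule colinear_diff[OF colinear_comp[OF u v(1)] colinear_cross[OF u v]])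

lemma colinear_lact: "linK f \<Longrightarrow> colinear (lact f)"
  unfolding lact_def[abs_def] by (intro colinear_sw colinear_scl colinear_id) simp_all

definition base :: "'a set" where "base = coinvariants A H \<pi>"

lemma base_iff: "b \<in> base \<longleftrightarrow> teq (coaction A \<pi> b) [(b, 1)]"
  by (simp add: base_def coinvariants_def)

lemma base_add: "a \<in> base \<Longrightarrow> b \<in> base \<Longrightarrow> a + b \<in> base"
  unfolding base_iff
  by (rule teq_trans[OF tlin_add[OF tlin_coaction]], rule teq_trans[OF teq_append])
     (assumption, assumption, use teq_sym[OF teq_add_left] in simp)

lemma base_colinear:
  assumes u: "colinear u" "linA u" and b: "b \<in> base" shows "u b \<in> base"
proof -
  have "teq (coaction A \<pi> (u b)) (bind (coaction A \<pi> b) (\<lambda>x h. [(u x, h)]))"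
    using colinearD[OF u(1), of b] by (simp add: coaction_bind bind_assoc)
  also have "teq \<dots> (bind [(b, 1)] (\<lambda>x h. [(u x, h)]))"
    by (rule teq_bind[where s="scl A" and s'="scl H"]) (use b in \<open>simp_all add: base_iff tlin_pair_left tlin_pair_right u\<close>)
  finally show ?thesis by (simp add: base_iff)
qed

lemma base_scl: "b \<in> base \<Longrightarrow> c ** b \<in> base"
  by (rule base_colinear[OF colinear_scl[OF colinear_id]]) simp_all

lemma base_diff: "a \<in> base \<Longrightarrow> b \<in> base \<Longrightarrow> a - b \<in> base"
  using base_add[OF _ base_scl, of a b "-1"] by simp

lemma colinear_base_mult:
  assumes b: "b \<in> base" and u: "colinear u"
  shows "colinear (\<lambda>a. b * u a)"
proof (rule colinearI)
  fix a
  have "teq (coaction A \<pi> (b * u a)) (bind (bind (cop A b) (\<lambda>x y. bind (cop A (u a)) (\<lambda>x' y'. [(x * x', y * y')]))) (\<lambda>x y. [(x, \<pi> y)]))"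
    unfolding coaction_bind
  proof (rule teq_bind)
    have "[(x * x', y * y'). (x, y) \<leftarrow> cop A b, (x', y') \<leftarrow> cop A (u a)] = bind (cop A b) (\<lambda>x y. bind (cop A (u a)) (\<lambda>x' y'. [(x * x', y * y')]))"
      unfolding map_eq_bind[symmetric] by (simp add: bind_def)
    then show "tensor_eq (scl A) (scl A) (cop A (b * u a)) (bind (cop A b) (\<lambda>x y. bind (cop A (u a)) (\<lambda>x' y'. [(x * x', y * y')])))"
      using cop_mult[of b "u a"] by simp
  qed (simp_all add: tlin_pair_left tlin_pair_right)
  also have "\<dots> = bind (coaction A \<pi> b) (\<lambda>x h. bind (coaction A \<pi> (u a)) (\<lambda>x' h'. [(x * x', h * h')]))"
    by (simp add: coaction_bind bind_assoc pi_mult)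
  also have "teq \<dots> (bind [(b, 1)] (\<lambda>x h. bind (coaction A \<pi> (u a)) (\<lambda>x' h'. [(x * x', h * h')])))"
    by (rule teq_bind[where s="scl A" and s'="scl H"]) (use b in \<open>simp_all add: base_iff tlin_bind tlin_pair_left tlin_pair_right\<close>)
  also have "\<dots> = bind (coaction A \<pi> (u a)) (\<lambda>x' h'. [(b * x', h')])" by simp
  also have "teq \<dots> (bind (bind (cop A a) (\<lambda>x y. [(u x, \<pi> y)])) (\<lambda>x' h'. [(b * x', h')]))"
    by (rule teq_bind[OF colinearD[OF u]]) (simp_all add: tlin_pair_left tlin_pair_right)
  finally show "teq (coaction A \<pi> (b * u a)) (bind (cop A a) (\<lambda>x y. [(b * u x, \<pi> y)]))"
    by (simp add: bind_assoc)
qed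

lemma sw_pi_ant: "sw A a (\<lambda>x y. \<pi> x * ant H (\<pi> y)) = scl H (cou A a) 1"
proof -
  have "sw H (\<pi> a) (\<lambda>x y. x * ant H y) = sw A a (\<lambda>x y. \<pi> x * ant H (\<pi> y))"
    unfolding sw_def by (subst tensor_eq_sum[OF cop_pi, where sv="scl H"]) (simp_all add: comp_def case_prod_unfold)
  then show ?thesis using H.ant_right[of "\<pi> a"] by (simp add: sw_def cou_pi)
qed

text \<open>Up to the factors \<open>p\<close> and \<open>h\<close> this is \<open>(1 \<otimes>
  \<pi>(t\<^sub>1)) (S(t\<^sub>3) \<otimes> S(\<pi>(t\<^sub>2))) = S(t) \<otimes> 1\<close>.\<close>

lemma antipode_cancel:
  "teq (bind (cop A t) (\<lambda>d r. bind (cop A r) (\<lambda>e f. [(p * ant A f, h * (\<pi> d * ant H (\<pi> e)))]))) [(p * ant A t, h)]"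
proof -
  have "teq (bind (cop A t) (\<lambda>d r. bind (cop A r) (\<lambda>e f. [(p * ant A f, h * (\<pi> d * ant H (\<pi> e)))]))) 
     (bind (cop A t) (\<lambda>g f. bind (cop A g) (\<lambda>d e. [(p * ant A f, h * (\<pi> d * ant H (\<pi> e)))])))"
    by (rule teq_sym[OF bind_coassoc]) (simp_all add: tlin_pair_left tlin_pair_right)
  also have "teq \<dots> (bind (cop A t) (\<lambda>g f. [(p * ant A f, sw A g (\<lambda>d e. h * (\<pi> d * ant H (\<pi> e))))]))"
    unfolding sw_def by (rule teq_bind_cong[OF teq_collect_right])
  also have "\<dots> = bind (cop A t) (\<lambda>g f. [(p * ant A f, scl H (cou A g) h)])"
    by (simp add: H.mult_sw[symmetric] sw_pi_ant H.scl_mult_right)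
  also have "teq \<dots> (bind (cop A t) (\<lambda>g f. [(cou A g ** p * ant A f, h)]))"
    by (rule teq_bind_cong) (rule teq_sym[OF teq_balance])
  also have "teq \<dots> [(sw A t (\<lambda>g f. cou A g ** p * ant A f), h)]"
    unfolding sw_def by (rule teq_collect_left)
  also have "\<dots> = [(p * ant A t, h)]"
    by (subst sw_cou_left[where sv="scl A"]) simp_all
  finally show ?thesis .
qed

text \<open>The map \<open>y \<mapsto> S(y\<^sub>2) \<otimes> S(\<pi>(y\<^sub>1))\<close> is a convolution
  inverse of the coaction.\<close>

lemma counit_cancel:
  "teq (bind (cop A y) (\<lambda>y1 y2. bind (cop A y1) (\<lambda>c d. bind (cop A y2) (\<lambda>e f. [(p * (c * ant A f), h * (\<pi> d * ant H (\<pi> e)))]))))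
     [(cou A y ** p, h)]"
proof -
  have "teq (bind (cop A y) (\<lambda>y1 y2. bind (cop A y1) (\<lambda>c d. bind (cop A y2) (\<lambda>e f. [(p * (c * ant A f), h * (\<pi> d * ant H (\<pi> e)))]))))
    (bind (cop A y) (\<lambda>c r. bind (cop A r) (\<lambda>d y2. bind (cop A y2) (\<lambda>e f. [(p * c * ant A f, h * (\<pi> d * ant H (\<pi> e)))]))))"
    unfolding mult.assoc[of p]
    by (rule bind_coassoc) (simp_all add: tlin_pair_left tlin_pair_right tlin_bind tlin_bind_cop)
  also have "teq \<dots> (bind (cop A y) (\<lambda>c r. [(p * c * ant A r, h)]))"
    by (rule teq_bind_cong[OF antipode_cancel])
  also have "teq \<dots> [(sw A y (\<lambda>c r. p * c * ant A r), h)]"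
    unfolding sw_def by (rule teq_collect_left)
  also have "\<dots> = [(cou A y ** p, h)]"
    unfolding mult.assoc by (subst sw_ant_right[where sv="scl A"]) simp_all
  finally show ?thesis .
qed

text \<open>The convolution product of \<open>u\<close> with the antipode; for \<open>u\<close> a sum of
  \<open>c\<^sub>i u\<^sub>i\<close> with \<open>u\<^sub>i\<close> right-invariant it takes
  \<open>a\<close> to the sum of \<open>\<epsilon>(u\<^sub>i(a)) c\<^sub>i\<close>.\<close>

definition symbol :: "('a \<Rightarrow> 'a) \<Rightarrow> 'a \<Rightarrow> 'a" where
  "symbol u a = sw A a (\<lambda>x y. u x * ant A y)"

lemma lin_symbol: "linA u \<Longrightarrow> linA (symbol u)"
  unfolding symbol_def[abs_def] by (simp add: lin_comp)

lemma symbol_apply: 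
  assumes "linA u" shows "sw A a (\<lambda>x y. symbol u x * y) = u a"
proof -
  note [simp] = lin_comp[OF assms]
  have "sw A a (\<lambda>x y. symbol u x * y) = sw A a (\<lambda>x t. sw A t (\<lambda>y z. u x * (ant A y * z)))"
    unfolding symbol_def by (simp add: sw_mult_out coassoc_A mult.assoc)
  also have "\<dots> = sw A a (\<lambda>x t. cou A t ** u x)"
    by (subst sw_ant_left[where sv="scl A"]) simp_all
  also have "\<dots> = u a" by (subst sw_cou_right[where sv="scl A"]) simp_all
  finally show ?thesis .
qed

text \<open>Let \<open>\<theta>\<close> be the symbol, \<open>\<delta>\<close> the coaction and
  \<open>\<omega>\<close> its convolution inverse from \<open>counit_cancel\<close>. Then
  \<open>\<delta>(\<theta>(a)) = \<delta>(\<theta>(a\<^sub>1)) \<delta>(a\<^sub>2)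
  \<omega>(a\<^sub>3) = \<delta>(u(a\<^sub>1)) \<omega>(a\<^sub>2)\<close>, which by colinearity
  is \<open>(u(a\<^sub>1) \<otimes> \<pi>(a\<^sub>2)) \<omega>(a\<^sub>3) = u(a\<^sub>1)
  S(a\<^sub>2) \<otimes> 1\<close>.\<close>

lemma symbol_base:
  assumes u: "colinear u" and l: "linA u" shows "symbol u a \<in> base"
proof -
  let ?\<theta> = "symbol u"
  note [simp] = lin_comp[OF l] lin_comp[OF lin_symbol[OF l]] tlin_pair_left tlin_pair_right tlin_bind tlin_bind_cop
  define Y where "Y b y2 = bind (coaction A \<pi> b) (\<lambda>p h. bind (cop A y2) (\<lambda>e f. [(p * ant A f, h * ant H (\<pi> e))]))" for b y2
  have Y': "Y b y2 = bind (cop A b) (\<lambda>p q. bind (cop A y2) (\<lambda>e f. [(p * ant A f, \<pi> q * ant H (\<pi> e))]))" for b y2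
    by (simp add: Y_def coaction_bind bind_assoc)
  have Yl: "tlin (scl A) (\<lambda>b. Y b y2)" and Yr: "tlin (scl A) (Y b)" for b y2
    unfolding Y' by simp_all
  have "teq (coaction A \<pi> (?\<theta> a)) (bind (cop A a) (\<lambda>x y. coaction A \<pi> (cou A y ** ?\<theta> x)))"
  proof -
    have "?\<theta> a = sw A a (\<lambda>x y. cou A y ** ?\<theta> x)" by (subst sw_cou_right[where sv="scl A"]) simp_all
    then show ?thesis using tlin_sw[OF tlin_coaction] by metis
  qed
  also have "teq \<dots> (bind (cop A a) (\<lambda>x y. bind (cop A (?\<theta> x)) (\<lambda>p q. [(cou A y ** p, \<pi> q)])))"
    by (rule teq_bind_cong) (use tlin_scale[OF tlin_coaction] in \<open>simp add: coaction_bind tscale_def bind_assoc\<close>)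
  also have "teq \<dots> (bind (cop A a) (\<lambda>x y. bind (cop A (?\<theta> x)) (\<lambda>p q. 
     bind (cop A y) (\<lambda>y1 y2. bind (cop A y1) (\<lambda>c d. bind (cop A y2) (\<lambda>e f. [(p * (c * ant A f), \<pi> q * (\<pi> d * ant H (\<pi> e)))]))))))"
    by (intro teq_bind_cong teq_sym[OF counit_cancel])
  also have "teq \<dots> (bind (cop A a) (\<lambda>x y. bind (cop A y) (\<lambda>y1 y2. bind (cop A (?\<theta> x)) (\<lambda>p q. 
     bind (cop A y1) (\<lambda>c d. bind (cop A y2) (\<lambda>e f. [(p * (c * ant A f), \<pi> q * (\<pi> d * ant H (\<pi> e)))]))))))"
    by (intro teq_bind_cong teq_swap)
  also have "teq \<dots> (bind (cop A a) (\<lambda>x y. bind (cop A y) (\<lambda>y1 y2. Y (?\<theta> x * y1) y2)))"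
  proof (intro teq_bind_cong)
    fix x y1 y2
    let ?b = "?\<theta> x"
    have "[(x * x', y * y'). (x, y) \<leftarrow> cop A ?b, (x', y') \<leftarrow> cop A y1] = bind (cop A ?b) (\<lambda>x y. bind (cop A y1) (\<lambda>x' y'. [(x * x', y * y')]))"
      unfolding map_eq_bind[symmetric] by (simp add: bind_def)
    then have "tensor_eq (scl A) (scl A) (cop A (?b * y1)) (bind (cop A ?b) (\<lambda>x y. bind (cop A y1) (\<lambda>x' y'. [(x * x', y * y')])))"
      using cop_mult[of ?b y1] by simp
    from teq_bind[OF this, of "\<lambda>p q. bind (cop A y2) (\<lambda>e f. [(p * ant A f, \<pi> q * ant H (\<pi> e))])"]
    show "teq (bind (cop A ?b) (\<lambda>p q. bind (cop A y1) (\<lambda>c d. bind (cop A y2) (\<lambda>e f. [(p * (c * ant A f), \<pi> q * (\<pi> d * ant H (\<pi> e)))])))) (Y (?b * y1) y2)"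
      unfolding Y' by (simp add: bind_assoc pi_mult mult.assoc teq_sym)
  qed
  also have "teq \<dots> (bind (cop A a) (\<lambda>w y2. bind (cop A w) (\<lambda>x y1. Y (?\<theta> x * y1) y2)))"
    by (rule teq_sym[OF bind_coassoc]) (auto intro!: tlin_comp[OF Yl] Yr)
  also have "teq \<dots> (bind (cop A a) (\<lambda>w y2. Y (u w) y2))"
  proof (intro teq_bind_cong)
    show "teq (bind (cop A w) (\<lambda>x y1. Y (?\<theta> x * y1) y2)) (Y (u w) y2)" for w y2
      using tlin_sw[OF Yl, where B=A and a=w and g="\<lambda>x y. ?\<theta> x * y"] by (simp add: symbol_apply[OF l] teq_sym)
  qed
  also have "teq \<dots> (bind (cop A a) (\<lambda>w y2. bind (cop A w) (\<lambda>p q. bind (cop A y2) (\<lambda>e f. [(u p * ant A f, \<pi> q * ant H (\<pi> e))]))))"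
  proof (intro teq_bind_cong)
    show "teq (Y (u w) y2) (bind (cop A w) (\<lambda>p q. bind (cop A y2) (\<lambda>e f. [(u p * ant A f, \<pi> q * ant H (\<pi> e))])))" for w y2
      using teq_bind[OF colinearD[OF u], of "\<lambda>p h. bind (cop A y2) (\<lambda>e f. [(p * ant A f, h * ant H (\<pi> e))])" w]
      by (simp add: Y_def bind_assoc)
  qed
  also have "teq \<dots> (bind (cop A a) (\<lambda>p t. bind (cop A t) (\<lambda>q y2. bind (cop A y2) (\<lambda>e f. [(u p * ant A f, \<pi> q * ant H (\<pi> e))]))))"
    by (rule bind_coassoc) simp_all
  also have "teq \<dots> (bind (cop A a) (\<lambda>p t. [(u p * ant A t, 1)]))"
    by (rule teq_bind_cong) (use antipode_cancel[where h=1] in simp)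
  also have "teq \<dots> [(?\<theta> a, 1)]"
    unfolding symbol_def sw_def by (rule teq_collect_left)
  finally show ?thesis by (simp add: base_iff)
qed

section \<open>Colinear combinations of invariant derivations\<close>

definition invariant_derivations :: "('a \<Rightarrow> 'a) set" where
  "invariant_derivations = {u. twisted_derivation u \<and> invar.colinear u}"

lemma invar_colinear_iff:
  "invar.colinear u \<longleftrightarrow> (\<forall>a. tensor_eq (scl A) (scl A) (cop A (u a)) [(u x, y). (x, y) \<leftarrow> cop A a])"
proof -
  have "coaction A (\<lambda>x. x) a = cop A a" for a by (simp add: coaction_def)
  then show ?thesis by (simp add: invar.colinear_def)
qed

lemma colinear_if_invar_colinear:
  assumes u: "invar.colinear u" shows "colinear u"
proof (rule colinearI)
  fix a
  have "teq (bind (cop A (u a)) (\<lambda>x y. [(x, \<pi> y)])) (bind (bind (cop A a) (\<lambda>x y. [(u x, y)])) (\<lambda>x y. [(x, \<pi> y)]))"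
    by (rule teq_bind[where s="scl A" and s'="scl A"])
       (use invar.colinearD[OF u, of a] in \<open>simp_all add: invar.coaction_bind tlin_pair_left tlin_pair_right\<close>)
  then show "teq (coaction A \<pi> (u a)) (bind (cop A a) (\<lambda>x y. [(u x, \<pi> y)]))"
    by (simp add: coaction_bind bind_assoc)
qed

text \<open>Apply the counit to the first leg of the coproduct of \<open>u(a)\<close>.\<close>

lemma invariant_apply:
  assumes u: "invar.colinear u" shows "u a = sw A a (\<lambda>x y. cou A (u x) ** y)"
proof -
  have "sw A (u a) (\<lambda>x y. cou A x ** y) = sw A a (\<lambda>x y. cou A (u x) ** y)"
    by (rule invar.sw_colinear[OF u, where sv="scl A"]) simp_all
  then show ?thesis using cou_left[of "u a"] by (simp add: sw_def)
qed

lemma twist_term_add: "twist_term (\<lambda>x. u x + v x) a a' = twist_term u a a' + twist_term v a a'"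
  unfolding twist_term_def sw2_def by (simp add: distrib_right scale_right_distrib sw_add)

lemma twist_term_scl: "twist_term (\<lambda>x. c ** u x) a a' = c ** twist_term u a a'"
  unfolding twist_term_def sw2_def by (simp add: scl_mult_left scl_sw scl_comm)

lemma twisted_add: 
  assumes "twisted_derivation u" "twisted_derivation v" shows "twisted_derivation (\<lambda>x. u x + v x)"
  using assms unfolding twisted_derivation_def by (simp add: twist_term_add algebra_simps)

lemma twisted_scl: 
  assumes "twisted_derivation u" shows "twisted_derivation (\<lambda>x. c ** u x)"
  using assms unfolding twisted_derivation_def by (simp add: twist_term_scl scale_right_distrib scl_mult_left)

lemma invariant_derivations_diff_scl:
  assumes "u \<in> invariant_derivations" "v \<in> invariant_derivations"
  shows "(\<lambda>x. u x - (c ** v x)) \<in> invariant_derivations"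
proof -
  have e: "(\<lambda>x. u x - (c ** v x)) = (\<lambda>x. u x + (- c) ** v x)" by simp
  have "twisted_derivation (\<lambda>x. u x + (- c) ** v x)"
    using assms by (intro twisted_add twisted_scl) (simp_all add: invariant_derivations_def)
  moreover have "invar.colinear (\<lambda>x. u x + (- c) ** v x)"
    using assms by (intro invar.colinear_add invar.colinear_scl) (simp_all add: invariant_derivations_def)
  ultimately show ?thesis unfolding e invariant_derivations_def by blast
qed

text \<open>Divide the functional \<open>\<epsilon> \<circ> u\<close> by \<open>d\<close> and reconstruct
  \<open>v\<close> from the quotient; the Leibniz rule for \<open>v\<close> holds because
  \<open>A\<close> has no torsion.\<close>

lemma invariant_derivation_divide:
  assumes dom: "\<And>x y :: 'k. x * y = 0 \<Longrightarrow> x = 0 \<or> y = 0"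
   and tf: "\<And>c v. c ** v = 0 \<Longrightarrow> c = 0 \<or> v = 0"
   and u: "u \<in> invariant_derivations" and d: "d \<noteq> 0" "\<And>a. d dvd cou A (u a)"
  shows "\<exists>v\<in>invariant_derivations. \<forall>a. u a = d ** v a"
proof -
  have tu: "twisted_derivation u" and lu: "linA u" and iu: "invar.colinear u"
    using u by (simp_all add: invariant_derivations_def twisted_derivation_def)
  obtain f where f: "\<And>a. cou A (u a) = d * f a" using d(2) unfolding dvd_def by metis
  have canc: "x = y" if "d * x = d * y" for x y
    using dom[of d "x - y"] that d(1) by (simp add: algebra_simps)
  have cancA: "x = y" if "d ** x = d ** y" for x y
    using tf[of d "x - y"] that d(1) by (simp add: scale_right_diff_distrib)
  have lf: "linK f" unfolding lin_def
  proof (intro conjI allI; rule canc)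
    show "d * f (x + y) = d * (f x + f y)" for x y
      using lin_add[OF lin_cou[OF lu], of x y] by (simp add: f algebra_simps)
    show "d * f (c ** x) = d * (c * f x)" for c x
      using lin_scale[OF lin_cou[OF lu], of c x] by (simp add: f algebra_simps)
  qed
  define v where "v = (\<lambda>a. sw A a (\<lambda>x y. f x ** y))"
  have uv: "u a = d ** v a" for a
    unfolding v_def invariant_apply[OF iu, of a] by (simp add: f scl_sw scale_scale)
  have "invar.colinear v"
    unfolding v_def by (intro invar.colinear_sw invar.colinear_scl invar.colinear_id) (simp_all add: lf)
  moreover have "twisted_derivation v"
    unfolding twisted_derivation_def
  proof (intro conjI allI)
    show "linA v" unfolding v_def by (simp add: lf)
    fix a a'
    have "d ** v (a * a') = d ** (v a * a' + twist_term v a a')"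
      using tu unfolding twisted_derivation_def 
      by (simp add: uv scale_right_distrib scl_mult_left[symmetric] twist_term_scl[symmetric] flip: uv)
    then show "v (a * a') = v a * a' + twist_term v a a'" by (rule cancA)
  qed
  ultimately show ?thesis using uv by (auto simp: invariant_derivations_def)
qed

text \<open>Gaussian elimination, one summand \<open>c1 u1\<close> at a time. Some value \<open>d\<close> of
  \<open>\<epsilon> \<circ> u1\<close>, attained at \<open>a0\<close>, divides all others, so
  \<open>u1 = d v\<close> with \<open>v\<close> invariant and \<open>\<epsilon>(v(a0)) =
  1\<close>. The total coefficient of \<open>v\<close> is then the value \<open>b\<close> of the
  given function at \<open>a0\<close>, which lies in the base, and the other summands are
  corrected by multiples of \<open>v\<close>. Elements of the base are never
  divided: a multiple of \<open>x\<close> may lie in the base when \<open>x\<close> does not.\<close>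

lemma base_valued_sum_in_tensor_maps:
  assumes min_dvd: "\<And>S :: 'k set. S \<noteq> {} \<Longrightarrow> \<exists>d\<in>S. \<forall>s\<in>S. d dvd s"
   and dom: "\<And>x y :: 'k. x * y = 0 \<Longrightarrow> x = 0 \<or> y = 0"
   and tf: "\<And>c v. c ** v = 0 \<Longrightarrow> c = 0 \<or> v = 0"
  shows "set ts \<subseteq> UNIV \<times> invariant_derivations \<Longrightarrow> (\<And>a. (\<Sum>(c, u)\<leftarrow>ts. cou A (u a) ** c) \<in> base)
   \<Longrightarrow> (\<lambda>a. \<Sum>(c, u)\<leftarrow>ts. c * u a) \<in> tensor_maps base invariant_derivations"
proof (induction "length ts" arbitrary: ts)
  case 0
  then have "(\<lambda>a. \<Sum>(c, u)\<leftarrow>ts. c * u a) = (\<lambda>a. \<Sum>(b, u)\<leftarrow>[]. b * u a)" by simp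
  then show ?case unfolding tensor_maps_def by (intro CollectI exI[of _ "[]"]) simp
next
  case (Suc n)
  obtain c1 u1 rest where ts: "ts = (c1, u1) # rest" and n: "n = length rest"
    using Suc(2) by (cases ts) auto
  have u1: "u1 \<in> invariant_derivations" and rest: "set rest \<subseteq> UNIV \<times> invariant_derivations"
    using Suc(3) by (auto simp: ts)
  have iu1: "invar.colinear u1" using u1 by (simp add: invariant_derivations_def)
  show ?case
  proof (cases "\<forall>a. cou A (u1 a) = 0")
    case True
    then have z: "u1 a = 0" for a
      by (subst invariant_apply[OF iu1]) (use True in \<open>simp add: sw_def case_prod_unfold\<close>)
    have "(\<lambda>a. \<Sum>(c, u)\<leftarrow>rest. c * u a) \<in> tensor_maps base invariant_derivations"
      by (rule Suc(1)[OF n rest]) (use Suc(4) True in \<open>simp add: ts\<close>)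
    then show ?thesis by (simp add: ts z)
  next
    case False
    obtain a0 where a0: "\<And>a. cou A (u1 a0) dvd cou A (u1 a)"
      using min_dvd[of "range (\<lambda>a. cou A (u1 a))"] by auto
    define d where "d = cou A (u1 a0)"
    have d0: "d \<noteq> 0" using False a0 by (auto simp: d_def)
    obtain v where v: "v \<in> invariant_derivations" and u1v: "\<And>a. u1 a = d ** v a"
      using invariant_derivation_divide[OF dom tf u1 d0] a0 by (auto simp: d_def)
    define b where "b = (\<Sum>(c, u)\<leftarrow>ts. cou A (u a0) ** c)"
    have b: "b \<in> base" unfolding b_def by (rule Suc(4))
    define rest' where "rest' = map (\<lambda>(c, u). (c, \<lambda>a. u a - (cou A (u a0) ** v a))) rest"
    have b_rest: "b = d ** c1 + (\<Sum>(c, u)\<leftarrow>rest. cou A (u a0) ** c)"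
      by (simp add: b_def ts d_def)
    have 1: "(\<Sum>(c, u)\<leftarrow>ts. c * u a) = b * v a + (\<Sum>(c, u)\<leftarrow>rest'. c * u a)" for a
    proof -
      have "(\<Sum>(c, u)\<leftarrow>rest'. c * u a) = (\<Sum>(c, u)\<leftarrow>rest. c * u a) - (\<Sum>(c, u)\<leftarrow>rest. cou A (u a0) ** c) * v a"
        unfolding rest'_def by (simp add: comp_def case_prod_unfold right_diff_distrib sum_list_subtractf 
            sum_list_mult_const[symmetric] scl_mult_left scl_mult_right)
      then show ?thesis by (simp add: ts b_rest u1v distrib_right scl_mult_left scl_mult_right)
    qed
    have 2: "(\<Sum>(c, u)\<leftarrow>rest'. cou A (u a) ** c) 
       = (\<Sum>(c, u)\<leftarrow>ts. cou A (u a) ** c) - (cou A (v a) ** b)" for a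
    proof -
      have l: "linA (scl A e)" for e by (simp add: lin_scaleI)
      have cs: "cou A (x - (e ** y)) = cou A x - e * cou A y" for x y e
        using lin_diff[OF lin_cou0] lin_scale[OF lin_cou0] by simp
      have "(\<Sum>(c, u)\<leftarrow>rest'. cou A (u a) ** c) 
         = (\<Sum>(c, u)\<leftarrow>rest. cou A (u a) ** c) - (cou A (v a) ** (\<Sum>(c, u)\<leftarrow>rest. cou A (u a0) ** c))"
        unfolding rest'_def by (simp add: comp_def case_prod_unfold cs scale_left_diff_distrib sum_list_subtractf 
            lin_sum_list[OF l] scale_scale mult.commute)
      then show ?thesis using lin_scale[OF lin_cou0, of d "v a"] 
        by (simp add: ts b_rest u1v scale_right_distrib scale_scale mult.commute)
    qed
    have "(\<lambda>a. \<Sum>(c, u)\<leftarrow>rest'. c * u a) \<in> tensor_maps base invariant_derivations"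
    proof (rule Suc(1))
      show "n = length rest'" by (simp add: rest'_def n)
      show "set rest' \<subseteq> UNIV \<times> invariant_derivations"
        using rest unfolding rest'_def by (auto intro!: invariant_derivations_diff_scl v)
      show "(\<Sum>(c, u)\<leftarrow>rest'. cou A (u a) ** c) \<in> base" for a
        unfolding 2 by (intro base_diff base_scl b Suc(4))
    qed
    then obtain t where t: "set t \<subseteq> base \<times> invariant_derivations" 
      "(\<lambda>a. \<Sum>(c, u)\<leftarrow>rest'. c * u a) = (\<lambda>a. \<Sum>(c, u)\<leftarrow>t. c * u a)" unfolding tensor_maps_def by auto
    \<comment> \<open>one more summand \<open>b v\<close> than for the shorter list\<close>
    show ?thesis unfolding tensor_maps_def
    proof (intro CollectI exI conjI)
      show "set ((b, v) # t) \<subseteq> base \<times> invariant_derivations" using t b v by auto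
      show "(\<lambda>a. \<Sum>(c, u)\<leftarrow>ts. c * u a) = (\<lambda>a. \<Sum>(c, u)\<leftarrow>(b, v) # t. c * u a)"
        using t(2) by (simp add: 1 fun_eq_iff)
    qed
  qed
qed

definition vertical :: "('a \<Rightarrow> 'a) set" where
  "vertical = {u. braided_derivation u \<and> colinear u \<and> (\<forall>b\<in>base. u b = 0)}"

text \<open>Through \<open>RH\<close> the form \<open>R\<close> sees the second leg of \<open>u(y)\<close>
  only after projection to \<open>H\<close>.\<close>

lemma braided_iff_twisted:
  assumes RH: "\<And>a b. R a b = RH (\<pi> a) (\<pi> b)" and lRH: "\<And>h. lin (scl H) (*) (RH h)" and u: "colinear u"
  shows "braided_derivation u \<longleftrightarrow> twisted_derivation u"
proof -
  have "adj u a' (\<lambda>p w. sw A a (\<lambda>x y. Rbar p x ** y * w)) = twist_term u a a'" if l: "linA u" for a a'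
  proof (rule twist_term_colinear[OF l])
    show "sw A (u y) (\<lambda>z1 z2. Rbar z2 c ** z1 * d) = sw A y (\<lambda>y1 y2. Rbar y2 c ** u y1 * d)" for y c d
      using sw_colinear[OF u, where sv="scl A" and G="\<lambda>x h. RH (\<pi> c) h ** x * d" and a=y] 
      by (simp add: lRH Rbar_flip RH)
  qed
  then show ?thesis unfolding braided_derivation_def twisted_derivation_def by auto
qed

lemma vertical_eq:
  assumes RH: "\<And>a b. R a b = RH (\<pi> a) (\<pi> b)" and lRH: "\<And>h. lin (scl H) (*) (RH h)" 
   and min_dvd: "\<And>S :: 'k set. S \<noteq> {} \<Longrightarrow> \<exists>d\<in>S. \<forall>s\<in>S. d dvd s"
   and dom: "\<And>x y :: 'k. x * y = 0 \<Longrightarrow> x = 0 \<or> y = 0"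
   and tf: "\<And>c v. c ** v = 0 \<Longrightarrow> c = 0 \<or> v = 0"
   and fund: "{u. twisted_derivation u} = tensor_maps UNIV invariant_derivations"
  shows "vertical = {u \<in> tensor_maps base invariant_derivations. \<forall>b\<in>base. u b = 0}"
proof (intro subset_antisym subsetI)
  fix u assume "u \<in> vertical"
  then have u: "braided_derivation u" "colinear u" "\<forall>b\<in>base. u b = 0" by (simp_all add: vertical_def)
  then have "twisted_derivation u" using braided_iff_twisted[OF RH lRH] by blast
  then have "u \<in> tensor_maps UNIV invariant_derivations" using fund by blast
  then obtain ts where ts: "set ts \<subseteq> UNIV \<times> invariant_derivations" "u = (\<lambda>a. \<Sum>(c, v)\<leftarrow>ts. c * v a)"
    unfolding tensor_maps_def by auto
  have sym: "symbol u a = (\<Sum>(c, v)\<leftarrow>ts. cou A (v a) ** c)" for a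
  proof -
    have "symbol u a = (\<Sum>(c, v)\<leftarrow>ts. sw A a (\<lambda>x y. c * v x * ant A y))"
      unfolding symbol_def ts(2) case_prod_unfold sum_list_mult_const[symmetric] sw_list_swap ..
    also have "\<dots> = (\<Sum>(c, v)\<leftarrow>ts. cou A (v a) ** c)"
    proof (rule arg_cong[where f=sum_list], rule map_cong[OF refl], clarify)
      fix c v assume "(c, v) \<in> set ts"
      then have v: "invar.colinear v" "linA v" 
        using ts(1) by (auto simp: invariant_derivations_def twisted_derivation_def)
      note [simp] = lin_comp[OF v(2)]
      have "sw A a (\<lambda>x y. c * v x * ant A y) = sw A (v a) (\<lambda>x y. c * (x * ant A y))"
        by (subst invar.sw_colinear[OF v(1), where sv="scl A" and G="\<lambda>x y. c * (x * ant A y)"]) (simp_all add: mult.assoc)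
      also have "\<dots> = cou A (v a) ** c" by (subst sw_ant_right[where sv="scl A"]) simp_all
      finally show "sw A a (\<lambda>x y. c * v x * ant A y) = cou A (v a) ** c" .
    qed
    finally show ?thesis .
  qed
  have "u \<in> tensor_maps base invariant_derivations"
    unfolding ts(2) 
    by (rule base_valued_sum_in_tensor_maps[OF min_dvd dom tf ts(1)])
       (use symbol_base[OF u(2) derivation_lin[OF u(1)]] in \<open>simp_all add: sym[symmetric]\<close>)
  then show "u \<in> {u \<in> tensor_maps base invariant_derivations. \<forall>b\<in>base. u b = 0}" using u(3) by simp
next
  fix u assume u: "u \<in> {u \<in> tensor_maps base invariant_derivations. \<forall>b\<in>base. u b = 0}"
  then obtain ts where ts: "set ts \<subseteq> base \<times> invariant_derivations" "u = (\<lambda>a. \<Sum>(c, v)\<leftarrow>ts. c * v a)"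
    unfolding tensor_maps_def by auto
  have "u \<in> tensor_maps UNIV invariant_derivations" using ts unfolding tensor_maps_def by auto
  then have t: "twisted_derivation u" using fund by blast
  have c: "colinear u" unfolding ts(2) case_prod_unfold
    using ts(1) by (intro colinear_list colinear_base_mult colinear_if_invar_colinear) (auto simp: invariant_derivations_def)
  show "u \<in> vertical" using t c u braided_iff_twisted[OF RH lRH c] by (simp add: vertical_def)
qed

end

section \<open>The braided Lie algebra of vertical derivations\<close>

locale vertical_lie = quantum_bundle A R Rbar H \<pi> + paired_cotriangular A R Rbar K "\<lambda>k a. pairH k (\<pi> a)"
  for A :: "('k::comm_ring_1, 'a::ring_1) hopf" and R Rbar and H :: "('k, 'h::ring_1) hopf" and \<pi> 
   and K :: "('k, 'v::ring_1) hopf" and pairH :: "'v \<Rightarrow> 'h \<Rightarrow> 'k" +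
  fixes RH RHbar :: "'h \<Rightarrow> 'h \<Rightarrow> 'k"
  assumes R_RH: "R a b = RH (\<pi> a) (\<pi> b)" and RHbar_flip: "RHbar x y = RH y x"
    and lin_pairH: "lin (scl H) (*) (pairH k)" and pairH_one: "pairH k 1 = cou K k"
    and det: "determined (op_triang K pairH RHbar) (scl A)"
    and det2: "determined (op_tensor_triang K pairH RH RHbar) (scl A)"
begin

abbreviation "T \<equiv> op_triang K pairH RHbar"
abbreviation "T2 \<equiv> op_tensor_triang K pairH RH RHbar"
abbreviation "pr \<equiv> \<lambda>k a. pairH k (\<pi> a)"

lemma contract_T:
  assumes "contracts \<Phi> v"
  shows "contract T (scl A) (\<lambda>r r'. \<Phi> (pr r) (pr r')) = v"
  by (rule contract_contracts[OF assms det, where \<pi>=\<pi>]) (simp_all add: op_triang_def RHbar_flip Rbar_flip R_RH)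

lemma verticalD:
  assumes "u \<in> vertical"
  shows "braided_derivation u" "linA u" "colinear u" "b \<in> base \<Longrightarrow> u b = 0"
  using assms derivation_lin by (auto simp: vertical_def)

text \<open>The left action maps the base to itself.\<close>

lemma hact_vanishes:
  assumes u: "linA u" and "\<forall>b\<in>base. u b = 0" and b: "b \<in> base"
  shows "hact (pr k) u b = 0"
proof -
  have "u (lact (pr q) b) = 0" for q
    using assms(2) base_colinear[OF colinear_lact _ b, of "pr q"] lin_lact[OF lin_id, of "pr q"] by simp
  moreover have "lact (pr p) 0 = 0" for p using lin_zero[OF lin_lact[OF lin_id, of "pr p"]] by simp
  ultimately have "hom_act (op_triang K pairH RHbar) (left_act A pr) k u b = 0"
    by (simp add: hom_act_def op_triang_def left_act_lact case_prod_unfold)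
  then show ?thesis by (simp add: hom_act_left[OF u])
qed

lemma vertical_hact: "u \<in> vertical \<Longrightarrow> hact (pr k) u \<in> vertical"
  using hact_vanishes[of u] unfolding vertical_def
  by (auto simp: derivation_hact colinear_hact derivation_lin)

text \<open>The crossed composition at \<open>b\<close> is a contraction of zeros.\<close>

lemma cross_vanishes:
  assumes u: "u \<in> vertical" and v: "v \<in> vertical" and b: "b \<in> base"
  shows "cross v u b = 0"
proof -
  note [simp] = verticalD(2)[OF u] verticalD(2)[OF v]
  have "hact (pr r') v (hact (pr r) u b) = 0" for r r'
    using verticalD(4)[OF vertical_hact[OF u] b] lin_zero[OF lin_hact'[OF _ verticalD(2)[OF v], of "pr r'"]] by simp
  then have "contract T (scl A) (\<lambda>r r'. 0) = cross v u b"
    using contract_T[OF contracts_cross[of u v b]] by simp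
  moreover have "contract T (scl A) (\<lambda>r r'. 0) = (0 :: 'a)"
    by (rule contract_eqI[OF det, where ts="[]"]) simp_all
  ultimately show ?thesis by simp
qed

lemma vertical_bracket:
  assumes u: "u \<in> vertical" and v: "v \<in> vertical" shows "bracket u v \<in> vertical"
proof -
  have "bracket u v b = 0" if b: "b \<in> base" for b
    unfolding bracket_def cross_vanishes[OF u v b] verticalD(4)[OF v b] lin_zero[OF verticalD(2)[OF u]] by simp
  then show ?thesis
    using verticalD(1-3)[OF u] verticalD(1-3)[OF v] unfolding vertical_def
    by (intro CollectI conjI derivation_bracket colinear_bracket ballI)
qed

lemma derivation_add:
  assumes "braided_derivation u" "braided_derivation v" shows "braided_derivation (\<lambda>x. u x + v x)"
  using assms unfolding braided_derivation_def by (simp add: adj_op_add algebra_simps)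

lemma derivation_scl:
  assumes "braided_derivation u" shows "braided_derivation (\<lambda>x. c ** u x)"
  using assms unfolding braided_derivation_def by (simp add: adj_op_scl scale_right_distrib scl_mult_left)

lemma vertical_add: "u \<in> vertical \<Longrightarrow> v \<in> vertical \<Longrightarrow> (\<lambda>a. u a + v a) \<in> vertical"
  by (simp add: vertical_def derivation_add colinear_add)

lemma vertical_scl: "u \<in> vertical \<Longrightarrow> (\<lambda>a. c ** u a) \<in> vertical"
  by (simp add: vertical_def derivation_scl colinear_scl)

lemma vertical_zero: "(\<lambda>a. 0) \<in> vertical"
proof -
  have "adj (\<lambda>x. 0) a' (\<lambda>p w. sw A a (\<lambda>x y. Rbar p x ** y * w)) = 0" for a a'
    using adj_op_scl[of "\<lambda>p w. sw A a (\<lambda>x y. Rbar p x ** y * w)" 0 "\<lambda>x. x" a'] by simp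
  then show ?thesis by (simp add: vertical_def colinear_zero braided_derivation_def)
qed

lemma vertical_braided_lie_algebra:
  assumes act: "\<And>k u. u \<in> vertical \<Longrightarrow> act k u = hact (pr k) u"
    and br: "\<And>u v. u \<in> vertical \<Longrightarrow> v \<in> vertical \<Longrightarrow> br u v = bracket u v"
  shows "braided_lie_algebra (scl K) T (scl A) act br vertical"
proof -
  note [simp] = act br vertical_hact vertical_bracket vertical_add vertical_scl vertical_zero verticalD(2)
  have prl: "K.linV (*) (\<lambda>k. pr k a)" for a using lin_pr_left0 .
  have cross_add: "cross (\<lambda>x. u x + v x) w a = cross u w a + cross v w a" for u v w a
    unfolding cross_def by (simp add: adj_op_add adj_add)
  have cross_add': "cross w (\<lambda>x. u x + v x) a = cross w u a + cross w v a" if [simp]: "linA w" for u v w a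
    unfolding cross_def by (simp add: adj_op_add)
  have cross_scl: "cross (\<lambda>x. c ** u x) w a = c ** cross u w a" for u w a c
    unfolding cross_def by (simp add: adj_op_scl scl_adj)
  have cross_scl': "cross w (\<lambda>x. c ** u x) a = c ** cross w u a" if [simp]: "linA w" for u w a c
    unfolding cross_def by (simp add: adj_op_scl)
  have jacobi: "bracket u (bracket v w) a = bracket (bracket u v) w a 
      + contract T (scl A) (\<lambda>r r'. bracket (hact (pr r') v) (bracket (hact (pr r) u) w) a)"
    if "u \<in> vertical" "v \<in> vertical" "w \<in> vertical" for u v w a
    using contract_T[OF contracts_jacobi[of u v w a]] that by simp
  have antisym: "bracket u v a = - contract T (scl A) (\<lambda>r r'. bracket (hact (pr r') v) (hact (pr r) u) a)"
    if "u \<in> vertical" "v \<in> vertical" for u v a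
    using contract_T[OF contracts_bracket_flip[of u v a]] that by simp
  have equivariant: "hact (pr k) (bracket u v) a = (\<Sum>(p, q)\<leftarrow>tcop T k. bracket (hact (pr p) u) (hact (pr q) v) a)"
    if "u \<in> vertical" "v \<in> vertical" for k u v a
  proof -
    have "hact (pr k) (bracket u v) a = (\<Sum>(g, h)\<leftarrow>map (\<lambda>(p, q). (pr p, pr q)) (cop K k). bracket (hact g u) (hact h v) a)"
      by (rule hact_bracket) (use that pr_mult_list in \<open>auto simp: comp_def case_prod_unfold\<close>)
    then show ?thesis by (simp add: op_triang_def comp_def case_prod_unfold)
  qed
  have act_mult: "hact (pr (k' * k)) u a = hact (pr k) (hact (pr k') u) a" if "u \<in> vertical" for k k' u a
    unfolding hact_def[of _ "hact _ u"] using that by (subst adj_hact) (simp_all add: pr_mult_left hact_def)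
  show ?thesis
    unfolding braided_lie_algebra_def
  proof (intro conjI)
    show "vertical \<subseteq> {u. module_hom (scl A) (scl A) u}"
      by (auto simp: lin_iff_module_hom)
    show "\<forall>u\<in>vertical. act (tone T) u = u"
      by (simp add: op_triang_def pr_one_left hact_def[abs_def] adj_cou')
    show "\<forall>k k'. \<forall>u\<in>vertical. act (tmult T k k') u = act k (act k' u)"
      by (auto simp: op_triang_def act_mult)
    show "\<forall>u\<in>vertical. \<forall>v\<in>vertical. br u v = (\<lambda>a. - contract T (scl A) (\<lambda>r r'. br (act r' v) (act r u) a))"
      using antisym by (simp add: fun_eq_iff)
    show "\<forall>u\<in>vertical. \<forall>v\<in>vertical. \<forall>w\<in>vertical. br u (br v w) =
        (\<lambda>a. br (br u v) w a + contract T (scl A) (\<lambda>r r'. br (act r' v) (br (act r u) w) a))"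
      using jacobi by (simp add: fun_eq_iff)
    show "\<forall>k. \<forall>u\<in>vertical. \<forall>v\<in>vertical. act k (br u v) = (\<lambda>a. \<Sum>(p, q)\<leftarrow>tcop T k. br (act p u) (act q v) a)"
      using equivariant by (simp add: fun_eq_iff)
    show "\<forall>k. \<forall>u\<in>vertical. \<forall>v\<in>vertical. act k (\<lambda>a. u a + v a) = (\<lambda>a. act k u a + act k v a)"
      by (simp add: hact_def adj_op_add fun_eq_iff)
    show "\<forall>k c. \<forall>u\<in>vertical. act k (\<lambda>a. c ** u a) = (\<lambda>a. c ** act k u a)"
      by (simp add: hact_def adj_op_scl fun_eq_iff)
    show "\<forall>k k'. \<forall>u\<in>vertical. act (k + k') u = (\<lambda>a. act k u a + act k' u a)"
      by (simp add: hact_def lin_add[OF prl] scale_left_distrib adj_add fun_eq_iff)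
    show "\<forall>c k. \<forall>u\<in>vertical. act (scl K c k) u = (\<lambda>a. c ** act k u a)"
      by (simp add: hact_def lin_scale[OF prl] scale_scale[symmetric] scl_adj fun_eq_iff)
    show "\<forall>u\<in>vertical. \<forall>v\<in>vertical. \<forall>w\<in>vertical. br (\<lambda>a. u a + v a) w = (\<lambda>a. br u w a + br v w a)"
      by (simp add: bracket_def cross_add' fun_eq_iff)
    show "\<forall>u\<in>vertical. \<forall>v\<in>vertical. \<forall>w\<in>vertical. br w (\<lambda>a. u a + v a) = (\<lambda>a. br w u a + br w v a)"
      by (auto simp: bracket_def cross_add fun_eq_iff lin_add[OF verticalD(2)])
    show "\<forall>c. \<forall>u\<in>vertical. \<forall>v\<in>vertical. br (\<lambda>a. c ** u a) v = (\<lambda>a. c ** br u v a)"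
      by (simp add: bracket_def cross_scl' fun_eq_iff scale_right_diff_distrib)
    show "\<forall>c. \<forall>u\<in>vertical. \<forall>v\<in>vertical. br u (\<lambda>a. c ** v a) = (\<lambda>a. c ** br u v a)"
      by (auto simp: bracket_def cross_scl fun_eq_iff scale_right_diff_distrib lin_scale[OF verticalD(2)])
  qed simp_all
qed

text \<open>The right action of the second factor commutes with colinear maps.\<close>

lemma hom_act_tensor:
  assumes u: "u \<in> vertical"
  shows "hom_act T2 (bi_act A pr) (\<zeta>, \<xi>) u = (\<lambda>a. cou K \<xi> ** hact (pr \<zeta>) u a)"
proof
  fix a
  note l = verticalD(2)[OF u]
  have "u (ract (pr \<xi>) a) = ract (pr \<xi>) (u a)" for \<xi> a
    unfolding ract_def 
    by (subst sw_colinear[OF verticalD(3)[OF u], where sv="scl A" and G="\<lambda>x h. pairH \<xi> h ** x"])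
       (simp_all add: lin_pairH sw_out[OF l] lin_scale[OF l])
  from hom_act_bi_colinear[OF l this] show "hom_act T2 (bi_act A pr) (\<zeta>, \<xi>) u a = cou K \<xi> ** hact (pr \<zeta>) u a" .
qed

lemma hom_act_tensor_one: "u \<in> vertical \<Longrightarrow> hom_act T2 (bi_act A pr) (\<zeta>, 1) u = hact (pr \<zeta>) u"
  by (simp add: hom_act_tensor K.cou_one)

lemma bracket_tensor:
  assumes u: "u \<in> vertical" and v: "v \<in> vertical"
  shows "braided_bracket T2 (scl A) (bi_act A pr) u v = bracket u v"
proof
  fix a
  note [simp] = verticalD(2)[OF u] verticalD(2)[OF v]
  obtain ts where ts: "\<And>f g. linK f \<Longrightarrow> linK g \<Longrightarrow> hact g v (hact f u a) = (\<Sum>(p, q, w)\<leftarrow>ts. (f p * g q) ** w)"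
      "cross v u a = (\<Sum>(p, q, w)\<leftarrow>ts. Rbar p q ** w)" using contracts_cross[of u v a] unfolding contracts_def by auto
  have RH1: "RH 1 1 = 1" using R_one_left[of 1] by (simp add: R_RH cou_one)
  have "contract T2 (scl A) (\<lambda>r r'. hom_act T2 (bi_act A pr) r' v (hom_act T2 (bi_act A pr) r u a)) = cross v u a"
  proof (rule contract_eqI[OF det2, where ts="map (\<lambda>(p, q, w). ((\<pi> p, 1), (\<pi> q, 1), w)) ts"])
    show "module (scl A)" by simp
    show "cross v u a = (\<Sum>(p, q, w)\<leftarrow>map (\<lambda>(p, q, w). ((\<pi> p, 1), (\<pi> q, 1), w)) ts. trmat T2 p q ** w)"
      unfolding ts(2) by (simp add: op_tensor_triang_def comp_def case_prod_unfold RH1 RHbar_flip R_RH Rbar_flip)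
    fix r r' :: "'v \<times> 'v"
    obtain \<zeta> \<xi> \<zeta>' \<xi>' where r [simp]: "r = (\<zeta>, \<xi>)" "r' = (\<zeta>', \<xi>')" by (cases r, cases r')
    have l: "linA (hact (pr \<zeta>') v)" by simp
    have lc: "linA (scl A c)" for c by (simp add: lin_scaleI)
    have "hom_act T2 (bi_act A pr) r' v (hom_act T2 (bi_act A pr) r u a) 
       = cou K \<xi>' ** cou K \<xi> ** hact (pr \<zeta>') v (hact (pr \<zeta>) u a)"
      by (simp add: hom_act_tensor u v lin_scale[OF l])
    also have "\<dots> = (\<Sum>(p, q, w)\<leftarrow>map (\<lambda>(p, q, w). ((\<pi> p, 1), (\<pi> q, 1), w)) ts. (tpair T2 r p * tpair T2 r' q) ** w)"
      by (simp add: ts(1) op_tensor_triang_def comp_def case_prod_unfold lin_sum_list[OF lc] pairH_one scale_scale ac_simps)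
    finally show "hom_act T2 (bi_act A pr) r' v (hom_act T2 (bi_act A pr) r u a) 
      = (\<Sum>(p, q, w)\<leftarrow>map (\<lambda>(p, q, w). ((\<pi> p, 1), (\<pi> q, 1), w)) ts. (tpair T2 r p * tpair T2 r' q) ** w)" .
  qed
  then show "braided_bracket T2 (scl A) (bi_act A pr) u v a = bracket u v a"
    by (simp add: braided_bracket_def bracket_def)
qed

end

lemma (in paired_cotriangular) braided_bracket_op:
  assumes det: "determined (op_triang K pr Rbar) (scl A)" and [simp]: "linA u" "linA v"
  shows "braided_bracket (op_triang K pr Rbar) (scl A) (left_act A pr) u v = bracket u v"
proof
  fix a
  have "contract (op_triang K pr Rbar) (scl A) (\<lambda>r r'. hact (pr r') v (hact (pr r) u a)) = cross v u a"
    by (rule contract_contracts[OF contracts_cross det, where \<pi>="\<lambda>x. x"]) (simp_all add: op_triang_def)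
  then show "braided_bracket (op_triang K pr Rbar) (scl A) (left_act A pr) u v a = bracket u v a"
    by (simp add: braided_bracket_def bracket_def hom_act_left)
qed

section \<open>The ground ring\<close>

context
  fixes \<phi> :: "'k::comm_ring_1 \<Rightarrow> 'f::field fps"
  assumes ground: "field_or_power_series \<phi>"
begin

lemma ground_cases:
  obtains (field) "\<And>c::'k. c \<noteq> 0 \<Longrightarrow> c dvd 1"
  | (fps) "bij \<phi>" "\<phi> 1 = 1" "\<And>x y. \<phi> (x * y) = \<phi> x * \<phi> y" "\<phi> 0 = 0" "\<And>x y. x dvd y \<longleftrightarrow> \<phi> x dvd \<phi> y"
proof (cases "\<forall>c::'k. c \<noteq> 0 \<longrightarrow> c dvd 1")
  case True then show ?thesis using field by blast
next
  case False
  then have f: "bij \<phi>" "\<phi> 1 = 1" "\<And>x y. \<phi> (x + y) = \<phi> x + \<phi> y" "\<And>x y. \<phi> (x * y) = \<phi> x * \<phi> y"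
    using ground unfolding field_or_power_series_def by blast+
  have "\<phi> 0 + \<phi> 0 = \<phi> 0 + 0" using f(3)[of 0 0] by (simp only: add_0_left add_0_right)
  then have 0: "\<phi> 0 = 0" by (rule add_left_imp_eq)
  have "x dvd y \<longleftrightarrow> \<phi> x dvd \<phi> y" for x y
  proof
    assume "\<phi> x dvd \<phi> y"
    then obtain z where "\<phi> y = \<phi> x * z" by (auto elim: dvdE)
    moreover obtain w where "z = \<phi> w" using f(1) by (metis bij_pointE)
    ultimately have "\<phi> y = \<phi> (x * w)" by (simp add: f(4))
    then have "y = x * w" using injD[OF bij_is_inj[OF f(1)]] by blast
    then show "x dvd y" by simp
  qed (auto simp: f(4) elim!: dvdE)
  then show ?thesis using fps f 0 by blast
qed

lemma ground_no_zero_divisors: "x = 0 \<or> y = 0" if "x * y = (0::'k)"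
proof (cases rule: ground_cases)
  case field
  show ?thesis
  proof (rule ccontr)
    assume "\<not> ?thesis"
    then obtain z where z: "1 = x * z" and "y \<noteq> 0" using field[of x] by (auto elim: dvdE)
    have "y = (x * z) * y" by (simp only: z[symmetric] mult_1_left)
    also have "\<dots> = (x * y) * z" by (simp only: ac_simps)
    finally show False using that \<open>y \<noteq> 0\<close> by simp
  qed
next
  case fps
  then have "\<phi> x * \<phi> y = 0" using that by (metis fps(3) fps(4))
  then have "\<phi> x = \<phi> 0 \<or> \<phi> y = \<phi> 0" by (simp add: fps(4))
  then show ?thesis using injD[OF bij_is_inj[OF fps(1)]] by blast
qed

text \<open>Over a field any nonzero element will do, for power series one of least order.\<close>

lemma ground_min_dvd: "\<exists>d\<in>S. \<forall>s\<in>S. d dvd s" if "S \<noteq> {}" for S :: "'k set"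
proof (cases "\<forall>s\<in>S. s = 0")
  case True then show ?thesis using that by auto
next
  case False
  then obtain s0 where s0: "s0 \<in> S" "s0 \<noteq> 0" by blast
  show ?thesis
  proof (cases rule: ground_cases)
    case field
    then have "s0 dvd s" for s using s0(2) dvd_trans[of s0 1 s] by auto
    then show ?thesis using s0 by blast
  next
    case fps
    have nz: "\<phi> s = 0 \<longleftrightarrow> s = 0" for s using fps(1,4) by (metis bij_pointE)
    obtain d where d: "d \<in> S" "d \<noteq> 0" "\<And>s. s \<in> S \<Longrightarrow> s \<noteq> 0 \<Longrightarrow> subdegree (\<phi> d) \<le> subdegree (\<phi> s)"
      using ex_has_least_nat[of "\<lambda>s. s \<in> S \<and> s \<noteq> 0" s0 "\<lambda>s. subdegree (\<phi> s)"] s0 by blast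
    have "d dvd s" if "s \<in> S" for s
    proof (cases "s = 0")
      case False
      then show ?thesis using d that by (simp add: fps(5) fps_dvd_iff nz)
    qed simp
    then show ?thesis using d(1) by blast
  qed
qed

lemma ground_adically_separated: "adically_separated TYPE('k)"
proof (cases rule: ground_cases)
  case field
  have "(0::'k) dvd c" if "\<not> c dvd 1" for c using field[of c] that by auto
  moreover have "x = 0" if "\<forall>n. (0::'k) ^ n dvd x" for x using that[rule_format, of 1] by simp
  ultimately show ?thesis unfolding adically_separated_def by blast
next
  case fps
  obtain X where X: "\<phi> X = fps_X" using bij_is_surj[OF fps(1)] by (metis surjD)
  have nz: "\<phi> s = 0 \<longleftrightarrow> s = 0" for s using injD[OF bij_is_inj[OF fps(1)], of s 0] fps(4) by auto
  have pow: "\<phi> (X ^ n) = fps_X ^ n" for n by (induction n) (simp_all add: fps(2,3) X)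
  have "X dvd c" if c: "\<not> c dvd 1" for c
  proof (cases "c = 0")
    case False
    then have c0: "\<phi> c \<noteq> 0" using nz by blast
    have "\<not> \<phi> c dvd 1" using c unfolding fps(5)[of c 1] fps(2) .
    then have "subdegree (\<phi> c) \<noteq> 0" using fps_dvd_iff[OF c0, of 1] by auto
    then have "fps_X dvd \<phi> c" using fps_dvd_iff[of "fps_X :: 'f fps" "\<phi> c"] c0 by auto
    then show ?thesis unfolding fps(5)[of X c] X .
  qed simp
  moreover have "x = 0" if x: "\<forall>n. X ^ n dvd x" for x
  proof (rule ccontr)
    assume "x \<noteq> 0"
    then have x0: "\<phi> x \<noteq> 0" using nz by blast
    have "X ^ Suc (subdegree (\<phi> x)) dvd x" using x by blast
    then have d: "fps_X ^ Suc (subdegree (\<phi> x)) dvd \<phi> x" unfolding fps(5)[of _ x] pow .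
    have "(fps_X ^ Suc (subdegree (\<phi> x)) :: 'f fps) \<noteq> 0" by (rule power_not_zero) simp
    from fps_dvd_iff[OF this x0] d show False unfolding fps_X_power_subdegree by simp
  qed
  ultimately show ?thesis unfolding adically_separated_def by blast
qed

end

section \<open>Gauge transformations and vertical vector fields\<close>

lemma inj_ant_if_separates:
  assumes "hopf_algebra A" "hopf_algebra K" "hopf_pairing K A pr" "bij (ant K)" "separates pr"
  shows "inj (ant A)"
proof (rule injI)
  interpret A: hopf_algebra A by fact
  fix a b assume ab: "ant A a = ant A b"
  have l: "lin (scl A) (*) (pr k)" for k
    using assms(3) unfolding hopf_pairing_def lin_iff_module_hom[OF A.mod_A module_mult, symmetric] by blast
  have "pr k (a - b) = 0" for k
  proof -
    obtain k' where k: "k = ant K k'" using bij_is_surj[OF assms(4)] by (rule surjE)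
    have "pr k (a - b) = pr k' (ant A a) - pr k' (ant A b)"
      unfolding k lin_diff[OF l] pairing_ant[OF assms(1-3)] ..
    then show ?thesis by (simp only: ab diff_self)
  qed
  then have "a - b = 0" using assms(5) unfolding separates_def by blast
  then show "a = b" by simp
qed

lemma dual_triangularD:
  assumes "dual_triangular U A pair R Rbar"
  shows "hopf_algebra U" "hopf_pairing U A pair" "bij (ant U)" "in_completion A pair R" "in_completion A pair Rbar"
proof -
  have t: "hopf_algebra U \<and> hopf_pairing U A pair \<and> triangular U A pair R Rbar"
    using assms by (simp only: dual_triangular_def)
  then show "hopf_algebra U" "hopf_pairing U A pair" by simp_all
  from t have "bij (ant U) \<and> in_completion A pair R \<and> in_completion A pair Rbar"
    unfolding triangular_def by (elim conjE) (intro conjI)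
  then show "bij (ant U)" "in_completion A pair R" "in_completion A pair Rbar" by simp_all
qed

lemma cotriangularD:
  assumes "cotriangular H RH RHbar"
  shows "bilinear_form H RH" "RHbar x y = RH y x"
  using assms unfolding cotriangular_def by blast+

theorem theorem7p3:
  fixes \<phi> :: "'k::comm_ring_1 \<Rightarrow> 'f::field fps"
    and A :: "('k, 'a::ring_1) hopf" and R Rbar :: "'a \<Rightarrow> 'a \<Rightarrow> 'k"
    and U :: "('k, 'u::ring_1) hopf" and pair :: "'u \<Rightarrow> 'a \<Rightarrow> 'k"
    and H :: "('k, 'h::ring_1) hopf" and RH RHbar :: "'h \<Rightarrow> 'h \<Rightarrow> 'k"
    and UH :: "('k, 'v::ring_1) hopf" and pairH :: "'v \<Rightarrow> 'h \<Rightarrow> 'k"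
    and \<pi> :: "'a \<Rightarrow> 'h" and \<iota> :: "'v \<Rightarrow> 'u"
  assumes ground: "field_or_power_series \<phi>"
    and A: "hopf_algebra A" "cotriangular A R Rbar"
    and U: "dual_triangular U A pair R Rbar" "separates pair"
    and H: "hopf_algebra H" "cotriangular H RH RHbar"
    and UH: "dual_triangular UH H pairH RH RHbar"
    and pi: "hopf_map A H \<pi>" "surj \<pi>"
    and galois: "hopf_galois A H \<pi>"
    and R_RH: "\<And>a b. R a b = RH (\<pi> a) (\<pi> b)"
    and UH_sub: "hopf_map UH U \<iota>" "inj \<iota>" "\<And>\<xi> a. pair (\<iota> \<xi>) a = pairH \<xi> (\<pi> a)"
    and fundamental: "Der_bicov A U pair R Rbar = tensor_maps UNIV (Der_inv A U pair R Rbar)"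
  shows
    "aut_braided A H \<pi> U pair Rbar =
       {u \<in> tensor_maps (coinvariants A H \<pi>) (Der_inv A U pair R Rbar).
          \<forall>b\<in>coinvariants A H \<pi>. u b = 0}
     \<and> (let K = op_triang U pair Rbar; act = left_act A pair;
            K2H = op_tensor_triang UH pairH RH RHbar; act2H = (\<lambda>(\<zeta>, \<xi>). bi_act A pair (\<iota> \<zeta>, \<iota> \<xi>))
        in braided_lie_iso (scl UH) (op_triang UH pairH RHbar) (scl A)
             (\<lambda>\<zeta>. hom_act K act (\<iota> \<zeta>)) (braided_bracket K (scl A) act)
             (aut_braided A H \<pi> U pair Rbar)
             (\<lambda>\<zeta>. hom_act K2H act2H (\<zeta>, 1)) (braided_bracket K2H (scl A) act2H)
             {u \<in> tensor_maps (coinvariants A H \<pi>) (Der_inv A U pair R Rbar).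
                \<forall>b\<in>coinvariants A H \<pi>. u b = 0}
             id)"
proof -
  note U' = dual_triangularD[OF U(1)] and UH' = dual_triangularD[OF UH] and H' = cotriangularD[OF H(2)]
  interpret A: hopf_algebra A by fact
  interpret H: hopf_algebra H by fact
  interpret UH: hopf_algebra UH by fact
  have quantum: "quantum_bundle A R Rbar H \<pi>"
    by (intro quantum_bundle.intro cotriangular_bij.intro cotriangular_hopf.intro cotriangular_hopf_axioms.intro
        cotriangular_bij_axioms.intro quantum_bundle_axioms.intro A H(1) pi(1)
        inj_ant_if_separates[OF A(1) U'(1,2,3) U(2)])
  interpret Q: quantum_bundle A R Rbar H \<pi> by (rule quantum)
  interpret P: paired_cotriangular A R Rbar U pair
    by (intro paired_cotriangular.intro Q.cotriangular_bij_axioms U'(1) paired_cotriangular_axioms.intro U'(2,3))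
  \<comment> \<open>\<open>UH\<close> acts on \<open>A\<close> through this Hopf pairing, and \<open>V\<close> below is the bundle seen from \<open>UH\<close>\<close>
  define pr where "pr = (\<lambda>k a. pairH k (\<pi> a))"
  have lpH: "lin (scl H) (*) (pairH k)" "UH.linV (*) (\<lambda>k. pairH k x)" for k x
    using UH'(2) by (simp_all add: hopf_pairing_def lin_iff_module_hom)
  have pairing_pr: "hopf_pairing UH A pr"
    unfolding hopf_pairing_def
  proof (intro conjI allI)
    show "module_hom (scl UH) (*) (\<lambda>\<xi>. pr \<xi> a)" for a by (simp add: lin_iff_module_hom pr_def lpH)
    show "module_hom (scl A) (*) (pr \<xi>)" for \<xi> by (simp add: lin_iff_module_hom pr_def lin_comp[OF lpH(1)])
    show "pr (\<xi> * \<eta>) a = (\<Sum>(x, y)\<leftarrow>cop A a. pr \<xi> x * pr \<eta> y)" for \<xi> \<eta> a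
    proof -
      have "pr (\<xi> * \<eta>) a = (\<Sum>(x, y)\<leftarrow>cop H (\<pi> a). pairH \<xi> x * pairH \<eta> y)"
        unfolding pr_def using UH'(2) unfolding hopf_pairing_def by blast
      also have "\<dots> = (\<Sum>(x, y)\<leftarrow>[(\<pi> x, \<pi> y). (x, y) \<leftarrow> cop A a]. pairH \<xi> x * pairH \<eta> y)"
        by (rule tensor_eq_sum[OF Q.cop_pi, where sv="(*)"]) (simp_all add: lpH)
      also have "\<dots> = (\<Sum>(x, y)\<leftarrow>cop A a. pr \<xi> x * pr \<eta> y)"
        by (simp add: comp_def case_prod_unfold pr_def)
      finally show ?thesis .
    qed
    show "pr \<xi> (a * b) = (\<Sum>(p, q)\<leftarrow>cop UH \<xi>. pr p a * pr q b)" for \<xi> a b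
      unfolding pr_def Q.pi_mult using UH'(2) unfolding hopf_pairing_def by blast
    show "pr 1 a = cou A a" for a
      unfolding pr_def Q.cou_pi[symmetric] using UH'(2) unfolding hopf_pairing_def by blast
    show "pr \<xi> 1 = cou UH \<xi>" for \<xi>
      unfolding pr_def Q.pi_one using UH'(2) unfolding hopf_pairing_def by blast
  qed
  note sep = ground_adically_separated[OF ground]
  have lpair: "\<And>\<zeta>. lin (scl A) (*) (pair \<zeta>)" by (rule P.lin_pr_right)
  have detU: "determined (op_triang U pair Rbar) (scl A)"
    by (rule determined_op_triang[OF sep U'(5) lpair U(2)])
  have detU2: "determined (op_tensor_triang U pair R Rbar) (scl A)"
    by (rule determined_op_tensor_triang[OF sep U'(5) U'(4) lpair U(2)]) simp
  interpret V: vertical_lie A R Rbar H \<pi> UH pairH RH RHbar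
  proof (intro vertical_lie.intro quantum paired_cotriangular.intro Q.cotriangular_bij_axioms UH'(1) 
      paired_cotriangular_axioms.intro vertical_lie_axioms.intro)
    show "hopf_pairing UH A (\<lambda>k a. pairH k (\<pi> a))" using pairing_pr by (simp add: pr_def)
    show "bij (ant UH)" by fact
    show "R a b = RH (\<pi> a) (\<pi> b)" for a b by (rule R_RH)
    show "RHbar x y = RH y x" for x y by (rule H'(2))
    show "lin (scl H) (*) (pairH k)" for k by (rule lpH)
    show "pairH k 1 = cou UH k" for k using UH'(2) unfolding hopf_pairing_def by blast
    show "determined (op_triang UH pairH RHbar) (scl A)"
      by (rule determined_op_triang[OF sep UH'(5) lpair U(2)])
    show "determined (op_tensor_triang UH pairH RH RHbar) (scl A)"
      by (rule determined_op_tensor_triang[OF sep UH'(5) UH'(4) lpair U(2)]) simp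
  qed
  have tf: "c = 0 \<or> v = 0" if "scl A c v = 0" for c v
  proof (rule ccontr)
    assume nz: "\<not> ?thesis"
    have "c * pair \<zeta> v = 0" for \<zeta> using lin_scale[OF lpair, of \<zeta> c v] that lin_zero[OF lpair] by simp
    then have "pair \<zeta> v = 0" for \<zeta> using ground_no_zero_divisors[OF ground] nz by blast
    then show False using U(2) nz unfolding separates_def by blast
  qed
  have lRH: "lin (scl H) (*) (RH h)" for h
    using H'(1) by (simp add: bilinear_form_def lin_iff_module_hom)
  have bicov: "Der_bicov A U pair R Rbar = {u. Q.twisted_derivation u}"
    unfolding Der_bicov_def by (rule P.braided_Der_op_tensor[OF detU2])
  have inv: "Der_inv A U pair R Rbar = Q.invariant_derivations"
    unfolding Der_inv_def bicov Q.invariant_derivations_def Q.invar_colinear_iff by blast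
  have aut: "aut_braided A H \<pi> U pair Rbar = Q.vertical"
    unfolding aut_braided_def P.braided_Der_op[OF detU] Q.vertical_def Q.base_def Q.colinear_def by blast
  have fund: "{u. Q.twisted_derivation u} = tensor_maps UNIV Q.invariant_derivations"
    using fundamental unfolding bicov inv .
  have eq: "Q.vertical = {u \<in> tensor_maps Q.base Q.invariant_derivations. \<forall>b\<in>Q.base. u b = 0}"
    by (rule Q.vertical_eq[OF R_RH lRH ground_min_dvd[OF ground] ground_no_zero_divisors[OF ground] tf fund])
  let ?K = "op_triang U pair Rbar" and ?act = "left_act A pair"
  let ?K2 = "op_tensor_triang UH pairH RH RHbar" and ?act2 = "\<lambda>(\<zeta>, \<xi>). bi_act A pair (\<iota> \<zeta>, \<iota> \<xi>)"
  \<comment> \<open>the pairing of \<open>UH\<close> with \<open>A\<close> is that of \<open>UH\<close> with \<open>H\<close> after \<open>\<pi>\<close>, which the inclusion \<open>\<iota>\<close> respects\<close>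
  have act2: "?act2 = bi_act A (\<lambda>k a. pairH k (\<pi> a))"
    by (auto simp: fun_eq_iff bi_act_def UH_sub(3))
  have 1: "hom_act ?K ?act (\<iota> \<zeta>) u = Q.hact (\<lambda>a. pairH \<zeta> (\<pi> a)) u" if "u \<in> Q.vertical" for \<zeta> u
    unfolding P.hom_act_left[OF V.verticalD(2)[OF that]] UH_sub(3) ..
  have 2: "braided_bracket ?K (scl A) ?act u v = Q.bracket u v" if "u \<in> Q.vertical" "v \<in> Q.vertical" for u v
    by (rule P.braided_bracket_op[OF detU V.verticalD(2)[OF that(1)] V.verticalD(2)[OF that(2)]])
  have 3: "hom_act ?K2 ?act2 (\<zeta>, 1) u = Q.hact (\<lambda>a. pairH \<zeta> (\<pi> a)) u" if "u \<in> Q.vertical" for \<zeta> u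
    unfolding act2 by (rule V.hom_act_tensor_one[OF that])
  have 4: "braided_bracket ?K2 (scl A) ?act2 u v = Q.bracket u v" if "u \<in> Q.vertical" "v \<in> Q.vertical" for u v
    unfolding act2 by (rule V.bracket_tensor[OF that])
  have lie1: "braided_lie_algebra (scl UH) (op_triang UH pairH RHbar) (scl A) (\<lambda>\<zeta>. hom_act ?K ?act (\<iota> \<zeta>)) (braided_bracket ?K (scl A) ?act) Q.vertical"
    by (rule V.vertical_braided_lie_algebra[OF 1 2])
  have lie2: "braided_lie_algebra (scl UH) (op_triang UH pairH RHbar) (scl A) (\<lambda>\<zeta>. hom_act ?K2 ?act2 (\<zeta>, 1)) (braided_bracket ?K2 (scl A) ?act2) Q.vertical"
    by (rule V.vertical_braided_lie_algebra[OF 3 4])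
  have "braided_lie_iso (scl UH) (op_triang UH pairH RHbar) (scl A)
             (\<lambda>\<zeta>. hom_act ?K ?act (\<iota> \<zeta>)) (braided_bracket ?K (scl A) ?act) Q.vertical
             (\<lambda>\<zeta>. hom_act ?K2 ?act2 (\<zeta>, 1)) (braided_bracket ?K2 (scl A) ?act2) Q.vertical id"
    unfolding braided_lie_iso_def
    by (intro conjI lie1 lie2 ballI allI bij_betw_id) (simp_all only: id_apply 1 2 3 4)
  then show ?thesis
    unfolding Let_def aut inv Q.base_def[symmetric] eq[symmetric] by blast
qed

end
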